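(* Let $\underline{C}$ be a triangulated category. The following conditions are equivalent. (i) There exists a strongly semi-orthogonal generating family $\{\underline{A}_i\}_{i\in\mathbb{Z}}$ in $\underline{C}$ such that all of the $\underline{A}_i$ are abelian semi-simple. (ii) There exists a semi-orthogonal family $\{\underline{A}_i\}_{i\in\mathbb{Z}}$ in $\underline{C}$ such that for $\underline{C}^{t\le 0}$ (resp. $\underline{C}^{t\ge 0}$) being the envelope of $\bigcup_{i\in\mathbb{Z},\,j\ge 0}\underline{A}_i[j]$ (resp. of $\bigcup_{i\in\mathbb{Z},\,j\le 0}\underline{A}_i[j]$), the pair $(\underline{C}^{t\le 0},\underline{C}^{t\ge 0})$ yields a $t$-structure for $\underline{C}$. (ii') There exists a semi-orthogonal family $\{\underline{A}_i\}_{i\in\mathbb{Z}}$ in $\underline{C}$ such that the envelope of $\bigcup_{i\in\mathbb{Z}}\underline{A}_i$ yields the heart of a certain $t$-structure $t$ for $\underline{C}$. (iii) There exist a $t$-structure $t$ for $\underline{C}$, with heart $\underline{Ht}$, and a semi-orthogonal family $\{\underline{A}_i\subset\underline{Ht}\}_{i\in\mathbb{Z}}$ that satisfy the following condition: for each $X\in\underline{C}^{t=0}$ there exists an exhaustive separated increasing filtration by subobjects $W_{\le i}X$, $i\in\mathbb{Z}$ (in the abelian category $\underline{Ht}$), such that $W_{\le i}X/W_{\le i-1}X$ belongs to $\operatorname{Obj}\underline{A}_i$ for all $i\in\mathbb{Z}$. (iii') There exist $t$ and $\{\underline{A}_i\subset\underline{Ht}\}$ as in (iii) such that the filtration of any $X\in\underline{C}^{t=0}$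 described in (iii) exists and is $\underline{Ht}$-functorially determined by $X$. (iv) There are a $t$-structure $t$ and a weight structure $w$ for $\underline{C}$ such that for any $X\in\underline{C}^{t=0}$ and $i\in\mathbb{Z}$ there exists a nice decomposition of $X$ for this $i$. (iv') There are $t,w$ for $\underline{C}$ such that nice decompositions exist (for all $X\in\underline{C}^{t=0}$ and $i\in\mathbb{Z}$), and they are also $\underline{Ht}$-functorial in $X$ (if we fix $i$); the corresponding functors $X\mapsto w_{\le i}X$ and $X\mapsto w_{\ge i+1}X$ are exact on $\underline{Ht}$. (v) There are $t,w$ for $\underline{C}$ such that for any $X\in\underline{C}^{t=0}$, $i\in\mathbb{Z}$, there exists a choice of $w_{\le i}X$ such that the morphism $\operatorname{Im}\big((w_{\le i}X)^{\tau=0}\to X\big)\to X$ (image taken in $\underline{Ht}$) extends to a nice decomposition of $X$ (for this $i$). (v') There are $t,w$ for $\underline{C}$ such that for any $X\in\underline{C}^{t=0}$, any $i\in\mathbb{Z}$ and any choice of $w_{\le i}X$ the morphism $\operatorname{Im}\big((w_{\le i}X)^{\tau=0}\to X\big)\to X$ extends to a nice decomposition of $X$ (for this $i$).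
   Context: All $t$-structures $t$ and weight structures $w$ considered are assumed to be bounded (see below). For $D,E\subset\operatorname{Obj}\underline{C}$ write $D\perp E$ if $\underline{C}(X,Y)=0$ for all $X\in D$, $Y\in E$ (for subcategories: for their classes of objects). $t$-structures use the cohomological convention: $\underline{C}^{t\le i}=\underline{C}^{t\le 0}[-i]$, $\underline{C}^{t\ge i}=\underline{C}^{t\ge 0}[-i]$, $\underline{C}^{t\le 0}$ is stable under $[1]$, $\underline{C}^{t\le 0}\perp\underline{C}^{t\ge 1}$, and $\underline{C}^{t=0}=\underline{C}^{t\le 0}\cap\underline{C}^{t\ge 0}=\operatorname{Obj}\underline{Ht}$ ($\underline{Ht}$ is the heart). $X^{\tau=i}\in\underline{C}^{t=0}$ is the $i$-th cohomology of $X$ with respect to $t$. The $t$-structure is bounded if every object lies in $\underline{C}^{t\le n}\cap\underline{C}^{t\ge -n}$ for some $n$. A weight structure $w$ on $\underline{C}$ is a pair of classes $\underline{C}^{w\le 0},\underline{C}^{w\ge 0}\subset\operatorname{Obj}\underline{C}$, closed under retracts (and finite sums) in $\underline{C}$, such that, with $\underline{C}^{w\le i}=\underline{C}^{w\le 0}[i]$ and $\underline{C}^{w\ge i}=\underline{C}^{w\ge 0}[i]$: $\underline{C}^{w\le 0}\subset\underline{C}^{w\le 1}$, $\underline{C}^{w\ge 1}\subset\underline{C}^{w\ge 0}$; $\underline{C}^{w\le 0}\perp\underline{C}^{w\ge 1}$; and for every $X$ there is a distinguished triangle $A\to X\to B$ with $A\in \underline{C}^{w\le 0}$, $B\in\underline{C}^{w\ge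 1}$. Shifting, for every $X$ and $i\in\mathbb{Z}$ there are (non-canonical) distinguished triangles $w_{\le i}X\to X\to w_{\ge i+1}X$ with $w_{\le i}X\in\underline{C}^{w\le i}$, $w_{\ge i+1}X\in\underline{C}^{w\ge i+1}$; "a choice of $w_{\le i}X$" means a choice of such a triangle. $w$ is bounded if every object lies in $\underline{C}^{w\le n}\cap\underline{C}^{w\ge -n}$ for some $n$. Given $t,w$, such a triangle is called nice, and is called a nice decomposition of $X$ (for this $i$), if $w_{\le i}X$, $X$, $w_{\ge i+1}X$ all lie in $\underline{C}^{t=0}$. A morphism $Y\to X$ extends to a nice decomposition of $X$ for $i$ if it is the first morphism of such a nice triangle. A class $D\subset\operatorname{Obj}\underline{C}$ is extension-stable if for any distinguished triangle $A\to B\to C$ with $A,C\in D$ one has $B\in D$. The envelope of a class of objects (or of a subcategory) is the smallest extension-stable subcategory of $\underline{C}$ containing it. All $\underline{A}_i$ are (full) additive subcategories of $\underline{C}$. A family $\{\underline{A}_i\}_{i\in\mathbb{Z}}$ is semi-orthogonal if $\underline{A}_i\perp\underline{A}_j[s]$ for all $i,j,s\in\mathbb{Z}$ such that $s<0$ or $s>i-j$. It is strongly semi-orthogonal if moreover $\underline{A}_i\perp\underline{A}_j$ for all $i>j$ (and so for all $i\ne j$). It is generating if the smallest strictly full triangulated subcategory of $\underline{C}$ containing all objects of all $\underline{A}_i$ is $\underline{C}$.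
   Formalization: In (iii) and (iii'), "exhaustive separated" is taken to mean finite: W_{≤i}X = X for large i and W_{≤i}X = 0 for small i; with only union X and intersection 0 the equivalence fails, e.g. for D^b of an infinite product of module categories of growing global dimension. *)

theory Defs
  imports "HOL-Algebra.Group"
begin

section \<open>Categories, preadditive and additive categories\<close>

record ('o, 'm) cat =
  Obj :: "'o set"
  Arr :: "'m set"
  Dom :: "'m \<Rightarrow> 'o"
  Cod :: "'m \<Rightarrow> 'o"
  Ident :: "'o \<Rightarrow> 'm"
  Comp :: "'m \<Rightarrow> 'm \<Rightarrow> 'm"  (infixr "\<cdot>\<index>" 75)

record ('o, 'm) precat = "('o, 'm) cat" +
  Plus :: "'m \<Rightarrow> 'm \<Rightarrow> 'm"
  Zero :: "'o \<Rightarrow> 'o \<Rightarrow> 'm"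

definition Hom :: "('o, 'm, 'z) cat_scheme \<Rightarrow> 'o \<Rightarrow> 'o \<Rightarrow> 'm set" where
  "Hom C X Y = {f \<in> Arr C. Dom C f = X \<and> Cod C f = Y}"

locale category =
  fixes C :: "('o, 'm, 'z) cat_scheme" (structure)
  assumes Dom_Obj: "f \<in> Arr C \<Longrightarrow> Dom C f \<in> Obj C"
    and Cod_Obj: "f \<in> Arr C \<Longrightarrow> Cod C f \<in> Obj C"
    and Id_Hom: "X \<in> Obj C \<Longrightarrow> Ident C X \<in> Hom C X X"
    and Comp_Hom: "\<lbrakk>f \<in> Hom C X Y; g \<in> Hom C Y Z\<rbrakk> \<Longrightarrow> g \<cdot> f \<in> Hom C X Z"
    and Comp_assoc: "\<lbrakk>f \<in> Hom C W X; g \<in> Hom C X Y; h \<in> Hom C Y Z\<rbrakk> \<Longrightarrow> (h \<cdot> g) \<cdot> f = h \<cdot> (g \<cdot> f)"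
    and Comp_Id: "f \<in> Hom C X Y \<Longrightarrow> f \<cdot> Ident C X = f"
    and Id_Comp: "f \<in> Hom C X Y \<Longrightarrow> Ident C Y \<cdot> f = f"

definition Hom_group :: "('o, 'm, 'z) precat_scheme \<Rightarrow> 'o \<Rightarrow> 'o \<Rightarrow> 'm monoid" where
  "Hom_group C X Y = \<lparr>carrier = Hom C X Y, monoid.mult = Plus C, one = Zero C X Y\<rparr>"

definition Neg :: "('o, 'm, 'z) precat_scheme \<Rightarrow> 'm \<Rightarrow> 'm" where
  "Neg C f = inv\<^bsub>Hom_group C (Dom C f) (Cod C f)\<^esub> f"

locale preadditive_category = category C
  for C :: "('o, 'm, 'z) precat_scheme" (structure) +
  assumes Hom_comm_group: "\<lbrakk>X \<in> Obj C; Y \<in> Obj C\<rbrakk> \<Longrightarrow> comm_group (Hom_group C X Y)"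
    and Comp_Plus: "\<lbrakk>f \<in> Hom C X Y; g \<in> Hom C X Y; h \<in> Hom C Y Z\<rbrakk>
      \<Longrightarrow> h \<cdot> Plus C f g = Plus C (h \<cdot> f) (h \<cdot> g)"
    and Plus_Comp: "\<lbrakk>f \<in> Hom C X Y; g \<in> Hom C X Y; e \<in> Hom C W X\<rbrakk>
      \<Longrightarrow> Plus C f g \<cdot> e = Plus C (f \<cdot> e) (g \<cdot> e)"

definition is_isomorphism :: "('o, 'm, 'z) cat_scheme \<Rightarrow> 'm \<Rightarrow> bool" where
  "is_isomorphism C f \<longleftrightarrow> f \<in> Arr C \<and> (\<exists>g \<in> Hom C (Cod C f) (Dom C f).
     g \<cdot>\<^bsub>C\<^esub> f = Ident C (Dom C f) \<and> f \<cdot>\<^bsub>C\<^esub> g = Ident C (Cod C f))"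

definition is_zero :: "('o, 'm, 'z) cat_scheme \<Rightarrow> 'o \<Rightarrow> bool" where
  "is_zero C Z \<longleftrightarrow> Z \<in> Obj C \<and>
     (\<forall>X \<in> Obj C. (\<exists>!f. f \<in> Hom C X Z) \<and> (\<exists>!f. f \<in> Hom C Z X))"

definition is_biproduct :: "('o, 'm, 'z) precat_scheme \<Rightarrow> 'o \<Rightarrow> 'o \<Rightarrow> 'o \<Rightarrow> bool" where
  "is_biproduct C X Y S \<longleftrightarrow> S \<in> Obj C \<and>
     (\<exists>i \<in> Hom C X S. \<exists>j \<in> Hom C Y S. \<exists>p \<in> Hom C S X. \<exists>q \<in> Hom C S Y.
        p \<cdot>\<^bsub>C\<^esub> i = Ident C X \<and> q \<cdot>\<^bsub>C\<^esub> j = Ident C Y \<and>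
        q \<cdot>\<^bsub>C\<^esub> i = Zero C X Y \<and> p \<cdot>\<^bsub>C\<^esub> j = Zero C Y X \<and>
        Plus C (i \<cdot>\<^bsub>C\<^esub> p) (j \<cdot>\<^bsub>C\<^esub> q) = Ident C S)"

locale additive_category = preadditive_category C
  for C :: "('o, 'm, 'z) precat_scheme" (structure) +
  assumes ex_zero: "\<exists>Z. is_zero C Z"
    and ex_biproduct: "\<lbrakk>X \<in> Obj C; Y \<in> Obj C\<rbrakk> \<Longrightarrow> \<exists>S. is_biproduct C X Y S"

definition is_functor ::
  "('o, 'm, 'y) cat_scheme \<Rightarrow> ('p, 'n, 'z) cat_scheme \<Rightarrow> ('o \<Rightarrow> 'p) \<Rightarrow> ('m \<Rightarrow> 'n) \<Rightarrow> bool" where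
  "is_functor C D F G \<longleftrightarrow>
     (\<forall>X \<in> Obj C. F X \<in> Obj D \<and> G (Ident C X) = Ident D (F X)) \<and>
     (\<forall>f \<in> Arr C. G f \<in> Hom D (F (Dom C f)) (F (Cod C f))) \<and>
     (\<forall>f \<in> Arr C. \<forall>g \<in> Arr C. Cod C f = Dom C g \<longrightarrow> G (g \<cdot>\<^bsub>C\<^esub> f) = G g \<cdot>\<^bsub>D\<^esub> G f)"

definition additive_functor ::
  "('o, 'm, 'y) precat_scheme \<Rightarrow> ('p, 'n, 'z) precat_scheme \<Rightarrow> ('o \<Rightarrow> 'p) \<Rightarrow> ('m \<Rightarrow> 'n) \<Rightarrow> bool" where
  "additive_functor C D F G \<longleftrightarrow> is_functor C D F G \<and>
     (\<forall>f \<in> Arr C. \<forall>g \<in> Hom C (Dom C f) (Cod C f). G (Plus C f g) = Plus D (G f) (G g))"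

text \<open>Full subcategories of \<open>C\<close> are given by classes \<open>D \<subseteq> Obj C\<close> of objects, not required to be
  closed under isomorphism.\<close>

definition full_sub :: "('o, 'm, 'z) cat_scheme \<Rightarrow> 'o set \<Rightarrow> ('o, 'm, 'z) cat_scheme" where
  "full_sub C D = C\<lparr>Obj := D, Arr := {f \<in> Arr C. Dom C f \<in> D \<and> Cod C f \<in> D}\<rparr>"

definition additive_sub :: "('o, 'm, 'z) precat_scheme \<Rightarrow> 'o set \<Rightarrow> bool" where
  "additive_sub C D \<longleftrightarrow> D \<subseteq> Obj C \<and> additive_category (full_sub C D)"

definition iso_closed :: "('o, 'm, 'z) cat_scheme \<Rightarrow> 'o set \<Rightarrow> bool" where
  "iso_closed C D \<longleftrightarrow> (\<forall>f. is_isomorphism C f \<and> Dom C f \<in> D \<longrightarrow> Cod C f \<in> D)"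

definition retract_closed :: "('o, 'm, 'z) cat_scheme \<Rightarrow> 'o set \<Rightarrow> bool" where
  "retract_closed C D \<longleftrightarrow> (\<forall>X \<in> Obj C. \<forall>Y \<in> D. \<forall>i \<in> Hom C X Y. \<forall>p \<in> Hom C Y X.
     p \<cdot>\<^bsub>C\<^esub> i = Ident C X \<longrightarrow> X \<in> D)"

definition sum_closed :: "('o, 'm, 'z) precat_scheme \<Rightarrow> 'o set \<Rightarrow> bool" where
  "sum_closed C D \<longleftrightarrow> (\<forall>Z. is_zero C Z \<longrightarrow> Z \<in> D) \<and>
     (\<forall>X \<in> D. \<forall>Y \<in> D. \<forall>S. is_biproduct C X Y S \<longrightarrow> S \<in> D)"

definition perp :: "('o, 'm, 'z) precat_scheme \<Rightarrow> 'o set \<Rightarrow> 'o set \<Rightarrow> bool" where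
  "perp C D E \<longleftrightarrow> (\<forall>X \<in> D. \<forall>Y \<in> E. Hom C X Y = {Zero C X Y})"


section \<open>Abelian categories\<close>

definition is_mono :: "('o, 'm, 'z) cat_scheme \<Rightarrow> 'm \<Rightarrow> bool" where
  "is_mono C f \<longleftrightarrow> f \<in> Arr C \<and> (\<forall>g \<in> Arr C. \<forall>h \<in> Arr C.
     Dom C g = Dom C h \<and> Cod C g = Dom C f \<and> Cod C h = Dom C f \<and> f \<cdot>\<^bsub>C\<^esub> g = f \<cdot>\<^bsub>C\<^esub> h \<longrightarrow> g = h)"

definition is_epi :: "('o, 'm, 'z) cat_scheme \<Rightarrow> 'm \<Rightarrow> bool" where
  "is_epi C f \<longleftrightarrow> f \<in> Arr C \<and> (\<forall>g \<in> Arr C. \<forall>h \<in> Arr C.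
     Cod C g = Cod C h \<and> Dom C g = Cod C f \<and> Dom C h = Cod C f \<and> g \<cdot>\<^bsub>C\<^esub> f = h \<cdot>\<^bsub>C\<^esub> f \<longrightarrow> g = h)"

definition is_kernel :: "('o, 'm, 'z) precat_scheme \<Rightarrow> 'm \<Rightarrow> 'm \<Rightarrow> bool" where
  "is_kernel C f k \<longleftrightarrow> f \<in> Arr C \<and> k \<in> Arr C \<and> Cod C k = Dom C f \<and>
     f \<cdot>\<^bsub>C\<^esub> k = Zero C (Dom C k) (Cod C f) \<and>
     (\<forall>g \<in> Arr C. Cod C g = Dom C f \<and> f \<cdot>\<^bsub>C\<^esub> g = Zero C (Dom C g) (Cod C f) \<longrightarrow>
        (\<exists>!u. u \<in> Hom C (Dom C g) (Dom C k) \<and> k \<cdot>\<^bsub>C\<^esub> u = g))"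

definition is_cokernel :: "('o, 'm, 'z) precat_scheme \<Rightarrow> 'm \<Rightarrow> 'm \<Rightarrow> bool" where
  "is_cokernel C f e \<longleftrightarrow> f \<in> Arr C \<and> e \<in> Arr C \<and> Dom C e = Cod C f \<and>
     e \<cdot>\<^bsub>C\<^esub> f = Zero C (Dom C f) (Cod C e) \<and>
     (\<forall>g \<in> Arr C. Dom C g = Cod C f \<and> g \<cdot>\<^bsub>C\<^esub> f = Zero C (Dom C f) (Cod C g) \<longrightarrow>
        (\<exists>!u. u \<in> Hom C (Cod C e) (Cod C g) \<and> u \<cdot>\<^bsub>C\<^esub> e = g))"

definition is_image :: "('o, 'm, 'z) precat_scheme \<Rightarrow> 'm \<Rightarrow> 'm \<Rightarrow> bool" where
  "is_image C f m \<longleftrightarrow> (\<exists>e. is_cokernel C f e \<and> is_kernel C e m)"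

definition short_exact :: "('o, 'm, 'z) precat_scheme \<Rightarrow> 'm \<Rightarrow> 'm \<Rightarrow> bool" where
  "short_exact C f g \<longleftrightarrow> is_kernel C g f \<and> is_cokernel C f g"

locale abelian_category = additive_category C
  for C :: "('o, 'm, 'z) precat_scheme" (structure) +
  assumes ex_kernel: "f \<in> Arr C \<Longrightarrow> \<exists>k. is_kernel C f k"
    and ex_cokernel: "f \<in> Arr C \<Longrightarrow> \<exists>e. is_cokernel C f e"
    and mono_normal: "is_mono C f \<Longrightarrow> \<exists>g. is_kernel C g f"
    and epi_normal: "is_epi C f \<Longrightarrow> \<exists>g. is_cokernel C g f"

text \<open>Semi-simplicity means that all short exact sequences split; existence of simple objects or
  finite length is not required.\<close>

locale semisimple_abelian_category = abelian_category C
  for C :: "('o, 'm, 'z) precat_scheme" (structure) +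
  assumes short_exact_split: "short_exact C f g \<Longrightarrow>
    \<exists>s \<in> Hom C (Cod C g) (Dom C g). g \<cdot> s = Ident C (Cod C g)"

definition exact_functor ::
  "('o, 'm, 'y) precat_scheme \<Rightarrow> ('p, 'n, 'z) precat_scheme \<Rightarrow> ('o \<Rightarrow> 'p) \<Rightarrow> ('m \<Rightarrow> 'n) \<Rightarrow> bool" where
  "exact_functor C D F G \<longleftrightarrow> additive_functor C D F G \<and>
     (\<forall>f g. short_exact C f g \<longrightarrow> short_exact D (G f) (G g))"


section \<open>Triangulated categories\<close>

text \<open>\<open>ShO C n\<close> and \<open>ShM C n\<close> are the action of the shift \<open>[n]\<close> on objects and morphisms, i.e.
  the \<open>n\<close>-th power of the automorphism \<open>[1]\<close>. The objects of a triangle \<open>(f, g, h)\<close> are determined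
  by its morphisms: \<open>Dom f \<rightarrow> Cod f \<rightarrow> Cod g \<rightarrow> (Dom f)[1]\<close>.\<close>

record ('o, 'm) tricat = "('o, 'm) precat" +
  ShO :: "int \<Rightarrow> 'o \<Rightarrow> 'o"
  ShM :: "int \<Rightarrow> 'm \<Rightarrow> 'm"
  Tri :: "('m \<times> 'm \<times> 'm) set"

definition is_triangle :: "('o, 'm, 'z) tricat_scheme \<Rightarrow> 'm \<Rightarrow> 'm \<Rightarrow> 'm \<Rightarrow> bool" where
  "is_triangle C f g h \<longleftrightarrow> f \<in> Arr C \<and> g \<in> Arr C \<and> h \<in> Arr C \<and>
     Dom C g = Cod C f \<and> Dom C h = Cod C g \<and> Cod C h = ShO C 1 (Dom C f)"

locale triangulated_category = additive_category C
  for C :: "('o, 'm, 'z) tricat_scheme" (structure) +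
  assumes shift_functor: "additive_functor C C (ShO C n) (ShM C n)"
    and ShO_0: "X \<in> Obj C \<Longrightarrow> ShO C 0 X = X"
    and ShM_0: "f \<in> Arr C \<Longrightarrow> ShM C 0 f = f"
    and ShO_add: "X \<in> Obj C \<Longrightarrow> ShO C (m + n) X = ShO C m (ShO C n X)"
    and ShM_add: "f \<in> Arr C \<Longrightarrow> ShM C (m + n) f = ShM C m (ShM C n f)"
    and Tri_triangle: "(f, g, h) \<in> Tri C \<Longrightarrow> is_triangle C f g h"
    and Tri_Id: "\<lbrakk>X \<in> Obj C; is_zero C Z\<rbrakk>
      \<Longrightarrow> (Ident C X, Zero C X Z, Zero C Z (ShO C 1 X)) \<in> Tri C"
    and Tri_iso: "\<lbrakk>(f, g, h) \<in> Tri C; is_triangle C f' g' h';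
        is_isomorphism C u; u \<in> Hom C (Dom C f) (Dom C f');
        is_isomorphism C v; v \<in> Hom C (Cod C f) (Cod C f');
        is_isomorphism C w; w \<in> Hom C (Cod C g) (Cod C g');
        v \<cdot> f = f' \<cdot> u; w \<cdot> g = g' \<cdot> v; ShM C 1 u \<cdot> h = h' \<cdot> w\<rbrakk>
      \<Longrightarrow> (f', g', h') \<in> Tri C"
    and Tri_extend: "f \<in> Arr C \<Longrightarrow> \<exists>g h. (f, g, h) \<in> Tri C"
    and Tri_rotate: "is_triangle C f g h
      \<Longrightarrow> (f, g, h) \<in> Tri C \<longleftrightarrow> (g, h, Neg C (ShM C 1 f)) \<in> Tri C"
    and Tri_morphism: "\<lbrakk>(f, g, h) \<in> Tri C; (f', g', h') \<in> Tri C;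
        u \<in> Hom C (Dom C f) (Dom C f'); v \<in> Hom C (Cod C f) (Cod C f'); v \<cdot> f = f' \<cdot> u\<rbrakk>
      \<Longrightarrow> \<exists>w \<in> Hom C (Cod C g) (Cod C g'). w \<cdot> g = g' \<cdot> v \<and> ShM C 1 u \<cdot> h = h' \<cdot> w"
    and Tri_octahedron: "\<lbrakk>Dom C g = Cod C f; (f, f\<^sub>1, f\<^sub>2) \<in> Tri C; (g, g\<^sub>1, g\<^sub>2) \<in> Tri C;
        (g \<cdot> f, h\<^sub>1, h\<^sub>2) \<in> Tri C\<rbrakk>
      \<Longrightarrow> \<exists>a \<in> Hom C (Cod C f\<^sub>1) (Cod C h\<^sub>1). \<exists>b \<in> Hom C (Cod C h\<^sub>1) (Cod C g\<^sub>1).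
            (a, b, ShM C 1 f\<^sub>1 \<cdot> g\<^sub>2) \<in> Tri C \<and>
            a \<cdot> f\<^sub>1 = h\<^sub>1 \<cdot> g \<and> h\<^sub>2 \<cdot> a = f\<^sub>2 \<and>
            b \<cdot> h\<^sub>1 = g\<^sub>1 \<and> g\<^sub>2 \<cdot> b = ShM C 1 f \<cdot> h\<^sub>2"

definition shift_class :: "('o, 'm, 'z) tricat_scheme \<Rightarrow> 'o set \<Rightarrow> int \<Rightarrow> 'o set" where
  "shift_class C D n = ShO C n ` D"

definition ext_stable :: "('o, 'm, 'z) tricat_scheme \<Rightarrow> 'o set \<Rightarrow> bool" where
  "ext_stable C D \<longleftrightarrow> (\<forall>f g h. (f, g, h) \<in> Tri C \<and> Dom C f \<in> D \<and> Cod C g \<in> D \<longrightarrow> Cod C f \<in> D)"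

definition envelope :: "('o, 'm, 'z) tricat_scheme \<Rightarrow> 'o set \<Rightarrow> 'o set" where
  "envelope C D = \<Inter>{E. E \<subseteq> Obj C \<and> ext_stable C E \<and> D \<subseteq> E}"

definition triangulated_sub :: "('o, 'm, 'z) tricat_scheme \<Rightarrow> 'o set \<Rightarrow> bool" where
  "triangulated_sub C D \<longleftrightarrow> D \<subseteq> Obj C \<and> iso_closed C D \<and> (\<exists>Z \<in> D. is_zero C Z) \<and>
     (\<forall>X \<in> D. \<forall>n. ShO C n X \<in> D) \<and>
     (\<forall>f g h. (f, g, h) \<in> Tri C \<and> Dom C f \<in> D \<and> Cod C f \<in> D \<longrightarrow> Cod C g \<in> D)"

definition generated_sub :: "('o, 'm, 'z) tricat_scheme \<Rightarrow> 'o set \<Rightarrow> 'o set" where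
  "generated_sub C D = \<Inter>{E. triangulated_sub C E \<and> D \<subseteq> E}"


section \<open>Bounded t-structures\<close>

text \<open>A t-structure is the pair \<open>t\<close> of the classes \<open>C\<^sup>t\<^sup>\<le>\<^sup>0\<close> and \<open>C\<^sup>t\<^sup>\<ge>\<^sup>0\<close> (cohomological convention).\<close>

definition tle :: "('o, 'm, 'z) tricat_scheme \<Rightarrow> 'o set \<times> 'o set \<Rightarrow> int \<Rightarrow> 'o set" where
  "tle C t i = shift_class C (fst t) (- i)"

definition tge :: "('o, 'm, 'z) tricat_scheme \<Rightarrow> 'o set \<times> 'o set \<Rightarrow> int \<Rightarrow> 'o set" where
  "tge C t i = shift_class C (snd t) (- i)"

definition t_structure :: "('o, 'm, 'z) tricat_scheme \<Rightarrow> 'o set \<times> 'o set \<Rightarrow> bool" where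
  "t_structure C t \<longleftrightarrow>
     fst t \<subseteq> Obj C \<and> snd t \<subseteq> Obj C \<and> iso_closed C (fst t) \<and> iso_closed C (snd t) \<and>
     tle C t 0 \<subseteq> tle C t 1 \<and> tge C t 1 \<subseteq> tge C t 0 \<and>
     perp C (tle C t 0) (tge C t 1) \<and>
     (\<forall>X \<in> Obj C. \<exists>a b c. (a, b, c) \<in> Tri C \<and> Cod C a = X \<and>
        Dom C a \<in> tle C t 0 \<and> Cod C b \<in> tge C t 1)"

definition bounded_t_structure :: "('o, 'm, 'z) tricat_scheme \<Rightarrow> 'o set \<times> 'o set \<Rightarrow> bool" where
  "bounded_t_structure C t \<longleftrightarrow> t_structure C t \<and>
     (\<forall>X \<in> Obj C. \<exists>n. X \<in> tle C t n \<inter> tge C t (- n))"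

definition heart :: "('o, 'm, 'z) tricat_scheme \<Rightarrow> 'o set \<times> 'o set \<Rightarrow> 'o set" where
  "heart C t = tle C t 0 \<inter> tge C t 0"

definition Ht :: "('o, 'm, 'z) tricat_scheme \<Rightarrow> 'o set \<times> 'o set \<Rightarrow> ('o, 'm, 'z) tricat_scheme" where
  "Ht C t = full_sub C (heart C t)"

text \<open>\<open>is_H0 C t Y p q\<close>: \<open>p\<close> is a truncation \<open>\<tau>\<^sub>\<le>\<^sub>0Y \<rightarrow> Y\<close> and \<open>q\<close> a truncation
  \<open>\<tau>\<^sub>\<le>\<^sub>0Y \<rightarrow> \<tau>\<^sub>\<ge>\<^sub>0\<tau>\<^sub>\<le>\<^sub>0Y\<close>, so that \<open>Cod C q\<close> is the zeroth cohomology of \<open>Y\<close>.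
  \<open>is_H0_map\<close> describes the morphism induced by \<open>f\<close> on zeroth cohomology.\<close>

definition is_H0 ::
  "('o, 'm, 'z) tricat_scheme \<Rightarrow> 'o set \<times> 'o set \<Rightarrow> 'o \<Rightarrow> 'm \<Rightarrow> 'm \<Rightarrow> bool" where
  "is_H0 C t Y p q \<longleftrightarrow>
     (\<exists>b c. (p, b, c) \<in> Tri C \<and> Cod C p = Y \<and> Dom C p \<in> tle C t 0 \<and> Cod C b \<in> tge C t 1) \<and>
     (\<exists>r c. (r, q, c) \<in> Tri C \<and> Cod C r = Dom C p \<and> Dom C r \<in> tle C t (- 1) \<and> Cod C q \<in> tge C t 0)"

definition is_H0_map ::
  "('o, 'm, 'z) tricat_scheme \<Rightarrow> 'o set \<times> 'o set \<Rightarrow> 'm \<Rightarrow> 'm \<Rightarrow> 'm \<Rightarrow> 'm \<Rightarrow> 'm \<Rightarrow> 'm \<Rightarrow> bool" where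
  "is_H0_map C t f p q p' q' h \<longleftrightarrow>
     is_H0 C t (Dom C f) p q \<and> is_H0 C t (Cod C f) p' q' \<and> h \<in> Hom C (Cod C q) (Cod C q') \<and>
     (\<exists>g \<in> Hom C (Dom C p) (Dom C p'). p' \<cdot>\<^bsub>C\<^esub> g = f \<cdot>\<^bsub>C\<^esub> p \<and> h \<cdot>\<^bsub>C\<^esub> q = q' \<cdot>\<^bsub>C\<^esub> g)"

text \<open>For \<open>f : Y \<rightarrow> X\<close> with \<open>X\<close> in the heart, \<open>m\<close> is the inclusion into \<open>X\<close> of the image, in the
  heart, of the zeroth cohomology of \<open>Y\<close>; here the zeroth cohomology of \<open>X\<close> is \<open>X\<close> itself.\<close>

definition is_image_H0 ::
  "('o, 'm, 'z) tricat_scheme \<Rightarrow> 'o set \<times> 'o set \<Rightarrow> 'm \<Rightarrow> 'm \<Rightarrow> bool" where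
  "is_image_H0 C t f m \<longleftrightarrow>
     (\<exists>p q h. is_H0_map C t f p q (Ident C (Cod C f)) (Ident C (Cod C f)) h \<and> is_image (Ht C t) h m)"


section \<open>Bounded weight structures and nice decompositions\<close>

text \<open>A weight structure is the pair \<open>w\<close> of the classes \<open>C\<^sup>w\<^sup>\<le>\<^sup>0\<close> and \<open>C\<^sup>w\<^sup>\<ge>\<^sup>0\<close>. Unlike for t-structures,
  the shifts are covariant in the index.\<close>

definition wle :: "('o, 'm, 'z) tricat_scheme \<Rightarrow> 'o set \<times> 'o set \<Rightarrow> int \<Rightarrow> 'o set" where
  "wle C w i = shift_class C (fst w) i"

definition wge :: "('o, 'm, 'z) tricat_scheme \<Rightarrow> 'o set \<times> 'o set \<Rightarrow> int \<Rightarrow> 'o set" where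
  "wge C w i = shift_class C (snd w) i"

definition weight_decomp ::
  "('o, 'm, 'z) tricat_scheme \<Rightarrow> 'o set \<times> 'o set \<Rightarrow> int \<Rightarrow> 'o \<Rightarrow> 'm \<Rightarrow> 'm \<Rightarrow> 'm \<Rightarrow> bool" where
  "weight_decomp C w i X a b c \<longleftrightarrow> (a, b, c) \<in> Tri C \<and> Cod C a = X \<and>
     Dom C a \<in> wle C w i \<and> Cod C b \<in> wge C w (i + 1)"

definition weight_structure :: "('o, 'm, 'z) tricat_scheme \<Rightarrow> 'o set \<times> 'o set \<Rightarrow> bool" where
  "weight_structure C w \<longleftrightarrow>
     fst w \<subseteq> Obj C \<and> snd w \<subseteq> Obj C \<and>
     retract_closed C (fst w) \<and> retract_closed C (snd w) \<and>
     sum_closed C (fst w) \<and> sum_closed C (snd w) \<and>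
     wle C w 0 \<subseteq> wle C w 1 \<and> wge C w 1 \<subseteq> wge C w 0 \<and>
     perp C (wle C w 0) (wge C w 1) \<and>
     (\<forall>X \<in> Obj C. \<exists>a b c. weight_decomp C w 0 X a b c)"

definition bounded_weight_structure :: "('o, 'm, 'z) tricat_scheme \<Rightarrow> 'o set \<times> 'o set \<Rightarrow> bool" where
  "bounded_weight_structure C w \<longleftrightarrow> weight_structure C w \<and>
     (\<forall>X \<in> Obj C. \<exists>n. X \<in> wle C w n \<inter> wge C w (- n))"

definition nice_decomp ::
  "('o, 'm, 'z) tricat_scheme \<Rightarrow> 'o set \<times> 'o set \<Rightarrow> 'o set \<times> 'o set \<Rightarrow> int \<Rightarrow> 'o \<Rightarrow>
   'm \<Rightarrow> 'm \<Rightarrow> 'm \<Rightarrow> bool" where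
  "nice_decomp C t w i X a b c \<longleftrightarrow> weight_decomp C w i X a b c \<and>
     Dom C a \<in> heart C t \<and> X \<in> heart C t \<and> Cod C b \<in> heart C t"

definition extends_to_nice ::
  "('o, 'm, 'z) tricat_scheme \<Rightarrow> 'o set \<times> 'o set \<Rightarrow> 'o set \<times> 'o set \<Rightarrow> int \<Rightarrow> 'o \<Rightarrow> 'm \<Rightarrow> bool" where
  "extends_to_nice C t w i X m \<longleftrightarrow> (\<exists>b c. nice_decomp C t w i X m b c)"

text \<open>\<open>functorial_nice_decomp C t w i L LM R RM\<close>: \<open>(L, LM)\<close> and \<open>(R, RM)\<close> are endofunctors of the heart,
  and there are nice triangles \<open>L X \<rightarrow> X \<rightarrow> R X \<rightarrow> (L X)[1]\<close> natural in \<open>X\<close>.\<close>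

definition functorial_nice_decomp ::
  "('o, 'm, 'z) tricat_scheme \<Rightarrow> 'o set \<times> 'o set \<Rightarrow> 'o set \<times> 'o set \<Rightarrow> int \<Rightarrow>
   ('o \<Rightarrow> 'o) \<Rightarrow> ('m \<Rightarrow> 'm) \<Rightarrow> ('o \<Rightarrow> 'o) \<Rightarrow> ('m \<Rightarrow> 'm) \<Rightarrow> bool" where
  "functorial_nice_decomp C t w i L LM R RM \<longleftrightarrow>
     is_functor (Ht C t) (Ht C t) L LM \<and> is_functor (Ht C t) (Ht C t) R RM \<and>
     (\<exists>a b c.
        (\<forall>X \<in> heart C t. nice_decomp C t w i X (a X) (b X) (c X) \<and>
           Dom C (a X) = L X \<and> Cod C (b X) = R X) \<and>
        (\<forall>X \<in> heart C t. \<forall>Y \<in> heart C t. \<forall>f \<in> Hom C X Y.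
           f \<cdot>\<^bsub>C\<^esub> a X = a Y \<cdot>\<^bsub>C\<^esub> LM f \<and>
           RM f \<cdot>\<^bsub>C\<^esub> b X = b Y \<cdot>\<^bsub>C\<^esub> f \<and>
           ShM C 1 (LM f) \<cdot>\<^bsub>C\<^esub> c X = c Y \<cdot>\<^bsub>C\<^esub> RM f))"


section \<open>Semi-orthogonal families and filtrations\<close>

definition semi_orthogonal :: "('o, 'm, 'z) tricat_scheme \<Rightarrow> (int \<Rightarrow> 'o set) \<Rightarrow> bool" where
  "semi_orthogonal C A \<longleftrightarrow> (\<forall>i. additive_sub C (A i)) \<and>
     (\<forall>i j s. s < 0 \<or> s > i - j \<longrightarrow> perp C (A i) (shift_class C (A j) s))"

definition strongly_semi_orthogonal :: "('o, 'm, 'z) tricat_scheme \<Rightarrow> (int \<Rightarrow> 'o set) \<Rightarrow> bool" where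
  "strongly_semi_orthogonal C A \<longleftrightarrow> semi_orthogonal C A \<and> (\<forall>i j. i > j \<longrightarrow> perp C (A i) (A j))"

definition generating :: "('o, 'm, 'z) tricat_scheme \<Rightarrow> (int \<Rightarrow> 'o set) \<Rightarrow> bool" where
  "generating C A \<longleftrightarrow> generated_sub C (\<Union>i. A i) = Obj C"

text \<open>\<open>W i\<close> is the inclusion of the subobject \<open>W\<^sub>\<le>\<^sub>i X\<close> of \<open>X\<close>, \<open>u\<close> below the inclusion of
  \<open>W\<^sub>\<le>\<^sub>i\<^sub>-\<^sub>1 X\<close> into \<open>W\<^sub>\<le>\<^sub>i X\<close>, and \<open>Cod H q\<close> their quotient. In line with the boundedness of all structures,
  exhaustive means \<open>W\<^sub>\<le>\<^sub>i X = X\<close> for \<open>i\<close> large enough, and separated means \<open>W\<^sub>\<le>\<^sub>i X = 0\<close> for \<open>i\<close> small enough.\<close>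

definition weight_filtration ::
  "('o, 'm, 'z) precat_scheme \<Rightarrow> (int \<Rightarrow> 'o set) \<Rightarrow> 'o \<Rightarrow> (int \<Rightarrow> 'm) \<Rightarrow> bool" where
  "weight_filtration H A X W \<longleftrightarrow>
     (\<forall>i. is_mono H (W i) \<and> Cod H (W i) = X) \<and>
     (\<exists>n. \<forall>i \<ge> n. is_isomorphism H (W i)) \<and>
     (\<exists>n. \<forall>i \<le> n. is_zero H (Dom H (W i))) \<and>
     (\<forall>i. \<exists>u \<in> Hom H (Dom H (W (i - 1))) (Dom H (W i)). \<exists>q.
        W i \<cdot>\<^bsub>H\<^esub> u = W (i - 1) \<and> is_cokernel H u q \<and> Cod H q \<in> A i)"

text \<open>Every morphism \<open>X \<rightarrow> Y\<close> maps \<open>W\<^sub>\<le>\<^sub>i X\<close> into \<open>W\<^sub>\<le>\<^sub>i Y\<close>, for all filtrations of the given kind. For the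
  identity of \<open>X\<close> this says that the filtration is uniquely determined by \<open>X\<close>; since the \<open>W i\<close> are
  monomorphisms, the induced morphisms respect identities and composition.\<close>

definition filtrations_functorial ::
  "('o, 'm, 'z) precat_scheme \<Rightarrow> (int \<Rightarrow> 'o set) \<Rightarrow> bool" where
  "filtrations_functorial H A \<longleftrightarrow>
     (\<forall>X \<in> Obj H. \<forall>Y \<in> Obj H. \<forall>f \<in> Hom H X Y. \<forall>W V.
        weight_filtration H A X W \<and> weight_filtration H A Y V \<longrightarrow>
        (\<forall>i. \<exists>!g. g \<in> Hom H (Dom H (W i)) (Dom H (V i)) \<and> V i \<cdot>\<^bsub>H\<^esub> g = f \<cdot>\<^bsub>H\<^esub> W i))"

definition all_equivalent :: "bool list \<Rightarrow> bool" where
  "all_equivalent Ps \<longleftrightarrow> (\<forall>P \<in> set Ps. \<forall>Q \<in> set Ps. P \<longleftrightarrow> Q)"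

end

theory Submission
  imports Defs
begin

text \<open>For classes of objects let \<open>star D E\<close> be the class of all \<open>Y\<close> in distinguished triangles
  \<open>X \<rightarrow> Y \<rightarrow> Z\<close> with \<open>X \<in> D\<close>, \<open>Z \<in> E\<close>. The octahedral axiom makes \<open>star\<close> associative, so generators can
  be sorted inside an iterated extension as soon as single ones can be swapped. Sorting the \<open>A\<^sub>i[j]\<close> by
  the weight \<open>i + j\<close> (allowed by semi-orthogonality) gives a weight structure, and sorting them by the sign
  of \<open>j\<close> (allowed for semi-simple \<open>A\<^sub>i\<close>, since there a map is a split epimorphism followed by a split
  monomorphism) gives the t-structure. Sorting by weight inside the t-classes leads to nice decompositions.

  Conversely, if nice decompositions exist, the \<open>A\<^sub>i\<close> are the objects of the heart that are pure of weight
  \<open>i\<close>: quotients of objects of weight at most \<open>i\<close> and subobjects of objects of weight at least \<open>i\<close> in the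
  heart are again such, so every map of pure objects splits off its kernel and cokernel. All remaining
  uniqueness and functoriality follows from the orthogonality axioms.\<close>

section \<open>Preadditive categories\<close>

text \<open>Shifts raise weights by one, and a nonzero arrow
  \<open>A\<^sub>i[j] \<rightarrow> A\<^sub>k[l]\<close> forces j \<le> l and k + l \<le> i + j. Two
  terms of an extension can be exchanged when its connecting map vanishes. When sorting by weight it
  always does, as it would have to raise the weight. When sorting by the sign of the shift, one
  borderline case is left: an arrow between unshifted objects. Strong semi-orthogonality leaves only
  arrows inside a single \<open>A\<^sub>i\<close>, and semi-simplicity is what handles these.
  Envelopes need not be closed under retracts, so the weight classes are orthogonals of generators,
  and membership is usually shown by exhibiting a retract. An object of the heart is sorted twice,
  once in each t-class; neither result need have its terms in the heart, and only the comparison of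
  the two gives a nice decomposition. In the other direction, quotients of objects of weight at most
  \<open>i\<close> and subobjects of objects of weight at least \<open>i\<close> are controlled by
  orthogonality alone. Subobjects of objects of weight at most \<open>i\<close> need a splitting
  argument, and exactness of the weight functors rests on it.\<close>

lemma Hom_iff [simp]: "f \<in> Hom C X Y \<longleftrightarrow> f \<in> Arr C \<and> Dom C f = X \<and> Cod C f = Y"
  by (simp add: Hom_def)

context category
begin

lemma Ident_simps [simp]:
  assumes "X \<in> Obj C"
  shows "Ident C X \<in> Arr C" "Dom C (Ident C X) = X" "Cod C (Ident C X) = X"
  using Id_Hom[OF assms] by auto

lemma comp_simps [simp]:
  assumes "f \<in> Arr C" "g \<in> Arr C" "Dom C g = Cod C f"
  shows "g \<cdot> f \<in> Arr C" "Dom C (g \<cdot> f) = Dom C f" "Cod C (g \<cdot> f) = Cod C g"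
  using Comp_Hom[of f "Dom C f" "Cod C f" g "Cod C g"] assms by auto

lemma Obj_simps [simp]:
  assumes "f \<in> Arr C"
  shows "Dom C f \<in> Obj C" "Cod C f \<in> Obj C"
  using assms Dom_Obj Cod_Obj by auto

lemma comp_Ident_right [simp]: "f \<in> Arr C \<Longrightarrow> Dom C f = X \<Longrightarrow> f \<cdot> Ident C X = f"
  using Comp_Id[of f X "Cod C f"] by auto

lemma comp_Ident_left [simp]: "f \<in> Arr C \<Longrightarrow> Cod C f = Y \<Longrightarrow> Ident C Y \<cdot> f = f"
  using Id_Comp[of f "Dom C f" Y] by auto

lemma comp_assoc:
  assumes "f \<in> Arr C" "g \<in> Arr C" "h \<in> Arr C" "Dom C g = Cod C f" "Dom C h = Cod C g"
  shows "(h \<cdot> g) \<cdot> f = h \<cdot> (g \<cdot> f)"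
  using Comp_assoc[of f "Dom C f" "Cod C f" g "Cod C g" h "Cod C h"] assms by auto

text \<open>The inverse is an explicit argument because triangles transported along isomorphisms are
  written with it, see \<open>Tri_transport\<close>.\<close>

definition inverse_pair :: "'m \<Rightarrow> 'm \<Rightarrow> bool" where
  "inverse_pair f g \<longleftrightarrow> f \<in> Arr C \<and> g \<in> Arr C \<and> Dom C g = Cod C f \<and> Cod C g = Dom C f \<and>
     g \<cdot> f = Ident C (Dom C f) \<and> f \<cdot> g = Ident C (Cod C f)"

lemma is_isomorphism_iff: "is_isomorphism C f \<longleftrightarrow> (\<exists>g. inverse_pair f g)"
  by (auto simp: is_isomorphism_def inverse_pair_def)

lemma inverse_pair_Ident: "X \<in> Obj C \<Longrightarrow> inverse_pair (Ident C X) (Ident C X)"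
  by (auto simp: inverse_pair_def)

end

context preadditive_category
begin

lemma Zero_simps [simp]:
  assumes "X \<in> Obj C" "Y \<in> Obj C"
  shows "Zero C X Y \<in> Arr C" "Dom C (Zero C X Y) = X" "Cod C (Zero C X Y) = Y"
proof -
  interpret G: comm_group "Hom_group C X Y" using assms by (rule Hom_comm_group)
  have "Zero C X Y \<in> Hom C X Y" using G.one_closed by (simp add: Hom_group_def)
  then show "Zero C X Y \<in> Arr C" "Dom C (Zero C X Y) = X" "Cod C (Zero C X Y) = Y" by auto
qed

lemma Plus_simps [simp]:
  assumes "f \<in> Arr C" "g \<in> Arr C" "Dom C g = Dom C f" "Cod C g = Cod C f"
  shows "Plus C f g \<in> Arr C" "Dom C (Plus C f g) = Dom C f" "Cod C (Plus C f g) = Cod C f"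
proof -
  interpret G: comm_group "Hom_group C (Dom C f) (Cod C f)"
    using assms by (intro Hom_comm_group) auto
  have "Plus C f g \<in> Hom C (Dom C f) (Cod C f)"
    using G.m_closed[of f g] assms by (simp add: Hom_group_def)
  then show "Plus C f g \<in> Arr C" "Dom C (Plus C f g) = Dom C f" "Cod C (Plus C f g) = Cod C f"
    by auto
qed

lemma Neg_simps [simp]:
  assumes "f \<in> Arr C"
  shows "Neg C f \<in> Arr C" "Dom C (Neg C f) = Dom C f" "Cod C (Neg C f) = Cod C f"
    and Plus_Neg [simp]: "Plus C f (Neg C f) = Zero C (Dom C f) (Cod C f)"
proof -
  interpret G: comm_group "Hom_group C (Dom C f) (Cod C f)"
    using assms by (intro Hom_comm_group) auto
  have f: "f \<in> carrier (Hom_group C (Dom C f) (Cod C f))"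
    using assms by (simp add: Hom_group_def)
  show "Neg C f \<in> Arr C" "Dom C (Neg C f) = Dom C f" "Cod C (Neg C f) = Cod C f"
    using G.inv_closed[OF f] by (auto simp: Neg_def Hom_group_def)
  show "Plus C f (Neg C f) = Zero C (Dom C f) (Cod C f)"
    using G.r_inv[OF f] by (simp add: Neg_def Hom_group_def)
qed

lemma Plus_assoc:
  assumes "f \<in> Arr C" "g \<in> Arr C" "h \<in> Arr C" "Dom C g = Dom C f" "Cod C g = Cod C f"
    "Dom C h = Dom C f" "Cod C h = Cod C f"
  shows "Plus C (Plus C f g) h = Plus C f (Plus C g h)"
proof -
  interpret G: comm_group "Hom_group C (Dom C f) (Cod C f)"
    using assms by (intro Hom_comm_group) auto
  show ?thesis using G.m_assoc[of f g h] assms by (simp add: Hom_group_def)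
qed

lemma Plus_commute:
  assumes "f \<in> Arr C" "g \<in> Arr C" "Dom C g = Dom C f" "Cod C g = Cod C f"
  shows "Plus C f g = Plus C g f"
proof -
  interpret G: comm_group "Hom_group C (Dom C f) (Cod C f)"
    using assms by (intro Hom_comm_group) auto
  show ?thesis using G.m_comm[of f g] assms by (simp add: Hom_group_def)
qed

lemma Plus_Zero [simp]:
  assumes "f \<in> Arr C" "Dom C f = X" "Cod C f = Y"
  shows "Plus C f (Zero C X Y) = f" "Plus C (Zero C X Y) f = f"
proof -
  interpret G: comm_group "Hom_group C (Dom C f) (Cod C f)"
    using assms by (intro Hom_comm_group) auto
  show "Plus C f (Zero C X Y) = f" "Plus C (Zero C X Y) f = f"
    using G.r_one[of f] G.l_one[of f] assms by (simp_all add: Hom_group_def)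
qed

lemma Neg_Plus [simp]:
  assumes "f \<in> Arr C"
  shows "Plus C (Neg C f) f = Zero C (Dom C f) (Cod C f)"
  using assms Plus_commute[of f "Neg C f"] by simp

lemma Plus_cancel_right:
  assumes "f \<in> Arr C" "g \<in> Arr C" "h \<in> Arr C" "Dom C f = Dom C h" "Cod C f = Cod C h"
    "Dom C g = Dom C h" "Cod C g = Cod C h" "Plus C f h = Plus C g h"
  shows "f = g"
proof -
  have "Plus C (Plus C f h) (Neg C h) = Plus C (Plus C g h) (Neg C h)" using assms by simp
  then show ?thesis using assms(1-7) by (simp add: Plus_assoc)
qed

lemma eq_Neg_iff:
  assumes "f \<in> Arr C" "g \<in> Arr C" "Dom C g = Dom C f" "Cod C g = Cod C f"
    "Plus C f g = Zero C (Dom C f) (Cod C f)"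
  shows "f = Neg C g"
  using assms by (intro Plus_cancel_right[of f "Neg C g" g]) auto

lemma Neg_Neg [simp]: "f \<in> Arr C \<Longrightarrow> Neg C (Neg C f) = f"
  using eq_Neg_iff[of f "Neg C f"] by simp

lemma eq_if_diff_Zero:
  assumes "f \<in> Arr C" "g \<in> Arr C" "Dom C g = Dom C f" "Cod C g = Cod C f"
    "Plus C f (Neg C g) = Zero C (Dom C f) (Cod C f)"
  shows "f = g"
  using assms eq_Neg_iff[of f "Neg C g"] by simp

lemma comp_Plus:
  assumes "f \<in> Arr C" "g \<in> Arr C" "h \<in> Arr C" "Dom C g = Dom C f" "Cod C g = Cod C f"
    "Dom C h = Cod C f"
  shows "h \<cdot> Plus C f g = Plus C (h \<cdot> f) (h \<cdot> g)"
  using assms by (intro Comp_Plus) auto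

lemma Plus_comp:
  assumes "f \<in> Arr C" "g \<in> Arr C" "h \<in> Arr C" "Dom C g = Dom C f" "Cod C g = Cod C f"
    "Dom C f = Cod C h"
  shows "Plus C f g \<cdot> h = Plus C (f \<cdot> h) (g \<cdot> h)"
  using assms by (intro Plus_Comp) auto

lemma idem_Zero:
  assumes "f \<in> Arr C" "Plus C f f = f"
  shows "f = Zero C (Dom C f) (Cod C f)"
  using assms by (intro Plus_cancel_right[of f _ f]) auto

lemma comp_Zero [simp]:
  assumes "h \<in> Arr C" "X \<in> Obj C" "Dom C h = Y"
  shows "h \<cdot> Zero C X Y = Zero C X (Cod C h)"
proof -
  have Y: "Y \<in> Obj C" using assms by auto
  have "Plus C (h \<cdot> Zero C X Y) (h \<cdot> Zero C X Y) = h \<cdot> Zero C X Y"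
    using assms Y by (subst comp_Plus[symmetric]) auto
  from idem_Zero[OF _ this] show ?thesis using assms Y by simp
qed

lemma Zero_comp [simp]:
  assumes "h \<in> Arr C" "Y \<in> Obj C" "Cod C h = X"
  shows "Zero C X Y \<cdot> h = Zero C (Dom C h) Y"
proof -
  have X: "X \<in> Obj C" using assms by auto
  have "Plus C (Zero C X Y \<cdot> h) (Zero C X Y \<cdot> h) = Zero C X Y \<cdot> h"
    using assms X by (subst Plus_comp[symmetric]) auto
  from idem_Zero[OF _ this] show ?thesis using assms X by simp
qed

lemma comp_Neg:
  assumes "f \<in> Arr C" "h \<in> Arr C" "Dom C h = Cod C f"
  shows "h \<cdot> Neg C f = Neg C (h \<cdot> f)"
proof (rule eq_Neg_iff)
  show "Plus C (h \<cdot> Neg C f) (h \<cdot> f) = Zero C (Dom C (h \<cdot> Neg C f)) (Cod C (h \<cdot> Neg C f))"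
    using assms comp_Plus[of "Neg C f" f h] by simp
qed (use assms in auto)

lemma Neg_comp:
  assumes "f \<in> Arr C" "h \<in> Arr C" "Dom C h = Cod C f"
  shows "Neg C h \<cdot> f = Neg C (h \<cdot> f)"
proof (rule eq_Neg_iff)
  show "Plus C (Neg C h \<cdot> f) (h \<cdot> f) = Zero C (Dom C (Neg C h \<cdot> f)) (Cod C (Neg C h \<cdot> f))"
    using assms Plus_comp[of "Neg C h" h f] by simp
qed (use assms in auto)

lemma Neg_Zero [simp]:
  "X \<in> Obj C \<Longrightarrow> Y \<in> Obj C \<Longrightarrow> Neg C (Zero C X Y) = Zero C X Y"
  using eq_Neg_iff[of "Zero C X Y" "Zero C X Y"] by simp

text \<open>Every arrow into or out of \<open>Z\<close> equals its composite with the identity of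
  \<open>Z\<close>, so a single equation replaces both uniqueness statements.\<close>

lemma is_zero_iff: "is_zero C Z \<longleftrightarrow> Z \<in> Obj C \<and> Ident C Z = Zero C Z Z"
proof (intro iffI conjI)
  assume "is_zero C Z"
  then have Z: "Z \<in> Obj C" and "\<exists>!f. f \<in> Hom C Z Z" by (auto simp: is_zero_def)
  then show "Z \<in> Obj C" "Ident C Z = Zero C Z Z" by (auto dest!: ex1E[where P="\<lambda>f. f \<in> Hom C Z Z"])
next
  assume Z: "Z \<in> Obj C \<and> Ident C Z = Zero C Z Z"
  have 1: "f = Zero C X Z" if "f \<in> Hom C X Z" for f X
  proof -
    have "f = Ident C Z \<cdot> f" using that by simp
    also have "\<dots> = Zero C X Z" using Z that by (metis Hom_iff Zero_comp)
    finally show ?thesis .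
  qed
  have 2: "f = Zero C Z X" if "f \<in> Hom C Z X" for f X
  proof -
    have "f = f \<cdot> Ident C Z" using that by simp
    also have "\<dots> = Zero C Z X" using Z that by (metis Hom_iff comp_Zero)
    finally show ?thesis .
  qed
  show "is_zero C Z" unfolding is_zero_def
    using Z 1 2 by (metis Hom_iff Zero_simps)
qed

lemma to_zero: "is_zero C Z \<Longrightarrow> f \<in> Arr C \<Longrightarrow> Cod C f = Z \<Longrightarrow> f = Zero C (Dom C f) Z"
  using comp_Ident_left[of f Z] by (auto simp: is_zero_iff)

lemma from_zero: "is_zero C Z \<Longrightarrow> f \<in> Arr C \<Longrightarrow> Dom C f = Z \<Longrightarrow> f = Zero C Z (Cod C f)"
  using comp_Ident_right[of f Z] by (auto simp: is_zero_iff)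

text \<open>Pointwise form of \<open>perp\<close>. It passes through retracts, biproducts and
  triangles one object at a time.\<close>

definition orth :: "'o \<Rightarrow> 'o \<Rightarrow> bool" where
  "orth X Y \<longleftrightarrow> (\<forall>f \<in> Arr C. Dom C f = X \<and> Cod C f = Y \<longrightarrow> f = Zero C X Y)"

lemma orthD: "orth X Y \<Longrightarrow> f \<in> Arr C \<Longrightarrow> Dom C f = X \<Longrightarrow> Cod C f = Y \<Longrightarrow> f = Zero C X Y"
  by (simp add: orth_def)

lemma perp_iff:
  assumes "D \<subseteq> Obj C" "E \<subseteq> Obj C"
  shows "perp C D E \<longleftrightarrow> (\<forall>X \<in> D. \<forall>Y \<in> E. orth X Y)"
proof -
  have "Hom C X Y = {Zero C X Y} \<longleftrightarrow> orth X Y" if "X \<in> D" "Y \<in> E" for X Y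
  proof -
    have "X \<in> Obj C" "Y \<in> Obj C" using that assms by auto
    then have "Zero C X Y \<in> Hom C X Y" by simp
    then show ?thesis by (auto simp: orth_def Hom_def)
  qed
  then show ?thesis by (auto simp: perp_def)
qed

definition retract :: "'o \<Rightarrow> 'o \<Rightarrow> bool" where
  "retract X Y \<longleftrightarrow> (\<exists>i p. i \<in> Arr C \<and> p \<in> Arr C \<and> Dom C i = X \<and> Cod C i = Y \<and> Dom C p = Y \<and>
     Cod C p = X \<and> p \<cdot> i = Ident C X)"

lemma orth_retract_left:
  assumes "orth Y T" "retract X Y"
  shows "orth X T"
  unfolding orth_def
proof (intro ballI impI)
  fix f assume f: "f \<in> Arr C" "Dom C f = X \<and> Cod C f = T"
  obtain i p where ip: "i \<in> Arr C" "p \<in> Arr C" "Dom C i = X" "Cod C i = Y" "Dom C p = Y"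
     "Cod C p = X" "p \<cdot> i = Ident C X" using assms by (auto simp: retract_def)
  have "f \<cdot> p = Zero C Y T" using orthD[OF assms(1), of "f \<cdot> p"] f ip by simp
  then have "(f \<cdot> p) \<cdot> i = Zero C X T" using f ip by auto
  then show "f = Zero C X T" using f ip by (simp add: comp_assoc)
qed

lemma orth_retract_right:
  assumes "orth T Y" "retract X Y"
  shows "orth T X"
  unfolding orth_def
proof (intro ballI impI)
  fix f assume f: "f \<in> Arr C" "Dom C f = T \<and> Cod C f = X"
  obtain i p where ip: "i \<in> Arr C" "p \<in> Arr C" "Dom C i = X" "Cod C i = Y" "Dom C p = Y"
     "Cod C p = X" "p \<cdot> i = Ident C X" using assms by (auto simp: retract_def)
  have "i \<cdot> f = Zero C T Y" using orthD[OF assms(1), of "i \<cdot> f"] f ip by simp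
  then have "p \<cdot> (i \<cdot> f) = Zero C T X" using f ip by auto
  then show "f = Zero C T X" using f ip by (simp add: comp_assoc[symmetric])
qed

definition biproduct_data :: "'o \<Rightarrow> 'o \<Rightarrow> 'o \<Rightarrow> 'm \<Rightarrow> 'm \<Rightarrow> 'm \<Rightarrow> 'm \<Rightarrow> bool" where
  "biproduct_data X Y S i j p q \<longleftrightarrow> i \<in> Hom C X S \<and> j \<in> Hom C Y S \<and> p \<in> Hom C S X \<and> q \<in> Hom C S Y \<and>
     p \<cdot> i = Ident C X \<and> q \<cdot> j = Ident C Y \<and> q \<cdot> i = Zero C X Y \<and> p \<cdot> j = Zero C Y X \<and>
     Plus C (i \<cdot> p) (j \<cdot> q) = Ident C S"

lemma is_biproduct_iff: "is_biproduct C X Y S \<longleftrightarrow> S \<in> Obj C \<and> (\<exists>i j p q. biproduct_data X Y S i j p q)"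
  unfolding is_biproduct_def biproduct_data_def by blast

lemma biproduct_data_swap: "biproduct_data X Y S i j p q \<Longrightarrow> biproduct_data Y X S j i q p"
  unfolding biproduct_data_def by (auto simp: Plus_commute[of "i \<cdot> p" "j \<cdot> q"])

lemma orth_biproduct:
  assumes b: "biproduct_data X Y S i j p q"
  shows "orth X T \<Longrightarrow> orth Y T \<Longrightarrow> orth S T" "orth T X \<Longrightarrow> orth T Y \<Longrightarrow> orth T S"
proof -
  have ar: "i \<in> Arr C" "j \<in> Arr C" "p \<in> Arr C" "q \<in> Arr C" "Dom C i = X" "Cod C i = S" "Dom C j = Y"
    "Cod C j = S" "Dom C p = S" "Cod C p = X" "Dom C q = S" "Cod C q = Y"
    and id: "Ident C S = Plus C (i \<cdot> p) (j \<cdot> q)" using b by (auto simp: biproduct_data_def)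
  show "orth S T" if "orth X T" "orth Y T" unfolding orth_def
  proof (intro ballI impI)
    fix f assume f: "f \<in> Arr C" "Dom C f = S \<and> Cod C f = T"
    have 0: "f \<cdot> i = Zero C X T" "f \<cdot> j = Zero C Y T"
      using f ar orthD[OF that(1), of "f \<cdot> i"] orthD[OF that(2), of "f \<cdot> j"] by auto
    have T: "T \<in> Obj C" using f by auto
    have "f = f \<cdot> Ident C S" using f by simp
    also have "\<dots> = Plus C ((f \<cdot> i) \<cdot> p) ((f \<cdot> j) \<cdot> q)" unfolding id
      using f ar by (simp add: comp_Plus comp_assoc)
    also have "\<dots> = Plus C (Zero C S T) (Zero C S T)" unfolding 0 using ar T by simp
    finally show "f = Zero C S T" using T ar by (metis Plus_Zero(1) Zero_simps Obj_simps)
  qed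
  show "orth T S" if "orth T X" "orth T Y" unfolding orth_def
  proof (intro ballI impI)
    fix f assume f: "f \<in> Arr C" "Dom C f = T \<and> Cod C f = S"
    have 0: "p \<cdot> f = Zero C T X" "q \<cdot> f = Zero C T Y"
      using f ar orthD[OF that(1), of "p \<cdot> f"] orthD[OF that(2), of "q \<cdot> f"] by auto
    have T: "T \<in> Obj C" using f by auto
    have "f = Ident C S \<cdot> f" using f by simp
    also have "\<dots> = Plus C (i \<cdot> (p \<cdot> f)) (j \<cdot> (q \<cdot> f))" unfolding id
      using f ar by (simp add: Plus_comp comp_assoc)
    also have "\<dots> = Plus C (Zero C T S) (Zero C T S)" unfolding 0 using ar T by simp
    finally show "f = Zero C T S" using T ar by (metis Plus_Zero(1) Zero_simps Obj_simps)
  qed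
qed

text \<open>Cancelling \<open>f\<close> turns \<open>f \<cdot> r = 1 - s \<cdot> g\<close> into the
  two missing identities for \<open>r \<cdot> f\<close> and \<open>r \<cdot> s\<close>. Of
  \<open>f\<close> only this cancellation property is asked, so the lemma serves short exact
  sequences and distinguished triangles alike.\<close>

lemma split_biproduct_data:
  assumes f: "f \<in> Arr C" "g \<in> Arr C" "Dom C g = Cod C f" "g \<cdot> f = Zero C (Dom C f) (Cod C g)"
    and s: "s \<in> Arr C" "Dom C s = Cod C g" "Cod C s = Cod C f" "g \<cdot> s = Ident C (Cod C g)"
    and r: "r \<in> Arr C" "Dom C r = Cod C f" "Cod C r = Dom C f" "f \<cdot> r = Plus C (Ident C (Cod C f)) (Neg C (s \<cdot> g))"
    and mono: "\<And>z. z \<in> Arr C \<Longrightarrow> Cod C z = Dom C f \<Longrightarrow> f \<cdot> z = Zero C (Dom C z) (Cod C f) \<Longrightarrow> z = Zero C (Dom C z) (Dom C f)"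
  shows "biproduct_data (Dom C f) (Cod C g) (Cod C f) f s r g"
proof -
  let ?e = "Plus C (Ident C (Cod C f)) (Neg C (s \<cdot> g))"
  have zero: "z = z'" if "z \<in> Arr C" "Cod C z = Dom C f" "z' \<in> Arr C" "Dom C z' = Dom C z" "Cod C z' = Dom C f"
    "f \<cdot> z = f \<cdot> z'" for z z'
  proof (rule eq_if_diff_Zero)
    show "Plus C z (Neg C z') = Zero C (Dom C z) (Cod C z)"
      using mono[of "Plus C z (Neg C z')"] that f(1) by (simp add: comp_Plus comp_Neg)
  qed (use that in auto)
  have "r \<cdot> f = Ident C (Dom C f)"
  proof (rule zero)
    have "f \<cdot> (r \<cdot> f) = ?e \<cdot> f" using r f by (simp flip: comp_assoc)
    also have "\<dots> = f" using s f by (simp add: Plus_comp Neg_comp comp_assoc)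
    finally show "f \<cdot> (r \<cdot> f) = f \<cdot> Ident C (Dom C f)" using f by simp
  qed (use f r in auto)
  moreover have "r \<cdot> s = Zero C (Cod C g) (Dom C f)"
  proof (rule zero)
    have "f \<cdot> (r \<cdot> s) = ?e \<cdot> s" using r f s by (simp flip: comp_assoc)
    also have "\<dots> = Zero C (Cod C g) (Cod C f)" using f s by (simp add: Plus_comp Neg_comp comp_assoc)
    finally show "f \<cdot> (r \<cdot> s) = f \<cdot> Zero C (Cod C g) (Dom C f)" using f by simp
  qed (use f r s in auto)
  moreover have "Plus C (f \<cdot> r) (s \<cdot> g) = Ident C (Cod C f)"
    unfolding r(4) using f s by (simp add: Plus_assoc)
  ultimately show ?thesis
    using f s r by (auto simp: biproduct_data_def)
qed

end

section \<open>Full subcategories\<close>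

lemma full_sub_simps [simp]:
  "Obj (full_sub C D) = D" "Arr (full_sub C D) = {f \<in> Arr C. Dom C f \<in> D \<and> Cod C f \<in> D}"
  "Dom (full_sub C D) = Dom C" "Cod (full_sub C D) = Cod C" "Ident (full_sub C D) = Ident C"
  "Comp (full_sub C D) = Comp C"
  by (simp_all add: full_sub_def)

lemma full_sub_precat_simps [simp]:
  "Plus (full_sub C D) = Plus C" "Zero (full_sub C D) = Zero C"
  by (simp_all add: full_sub_def)

lemma Hom_group_full_sub:
  "X \<in> D \<Longrightarrow> Y \<in> D \<Longrightarrow> Hom_group (full_sub C D) X Y = Hom_group C X Y"
  by (auto simp: Hom_group_def Hom_def)

lemma (in category) is_isomorphism_full_sub:
  "is_isomorphism (full_sub C D) f \<longleftrightarrow> is_isomorphism C f \<and> Dom C f \<in> D \<and> Cod C f \<in> D"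
  by (auto simp: is_isomorphism_def)

lemma (in preadditive_category) orth_zero:
  assumes "is_zero C Z" shows "orth X Z" "orth Z X"
  unfolding orth_def by (metis to_zero[OF assms], metis from_zero[OF assms])

lemma (in preadditive_category) preadditive_full_sub:
  "D \<subseteq> Obj C \<Longrightarrow> preadditive_category (full_sub C D)"
  by (intro preadditive_category.intro category.intro preadditive_category_axioms.intro)
    (auto simp: Hom_group_full_sub comp_assoc comp_Plus Plus_comp intro: Hom_comm_group)

lemma (in preadditive_category) is_zero_full_sub:
  assumes "D \<subseteq> Obj C"
  shows "is_zero (full_sub C D) Z \<longleftrightarrow> Z \<in> D \<and> is_zero C Z"
proof -
  interpret S: preadditive_category "full_sub C D" using assms by (rule preadditive_full_sub)
  show ?thesis using assms by (auto simp: is_zero_iff S.is_zero_iff)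
qed

lemma (in preadditive_category) is_biproduct_full_sub:
  assumes "X \<in> D" "Y \<in> D"
  shows "is_biproduct (full_sub C D) X Y S \<longleftrightarrow> S \<in> D \<and> (\<exists>i j p q. biproduct_data X Y S i j p q)"
proof -
  have "Hom (full_sub C D) X' Y' = Hom C X' Y'" if "X' \<in> D" "Y' \<in> D" for X' Y'
    using that by (auto simp: Hom_def)
  then show ?thesis unfolding is_biproduct_def biproduct_data_def using assms
    by (simp cong: conj_cong del: Hom_iff) blast
qed

lemma (in additive_category) additive_subI:
  assumes "D \<subseteq> Obj C" "\<exists>Z \<in> D. is_zero C Z"
    "\<And>X Y S i j p q. X \<in> D \<Longrightarrow> Y \<in> D \<Longrightarrow> biproduct_data X Y S i j p q \<Longrightarrow> S \<in> D"
  shows "additive_sub C D"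
proof -
  interpret S: preadditive_category "full_sub C D" using assms(1) by (rule preadditive_full_sub)
  have "additive_category (full_sub C D)"
  proof
    show "\<exists>Z. is_zero (full_sub C D) Z" using assms(1,2) by (auto simp: is_zero_full_sub)
    fix X Y assume "X \<in> Obj (full_sub C D)" "Y \<in> Obj (full_sub C D)"
    then have XY: "X \<in> D" "Y \<in> D" by simp_all
    then have "\<exists>S. is_biproduct C X Y S" using ex_biproduct[of X Y] assms(1) by blast
    then obtain S i j p q where "biproduct_data X Y S i j p q"
      unfolding is_biproduct_iff by blast
    then show "\<exists>S. is_biproduct (full_sub C D) X Y S"
      using assms(3)[OF XY] is_biproduct_full_sub[OF XY] by blast
  qed
  then show ?thesis using assms(1) by (simp add: additive_sub_def)
qed

lemma (in preadditive_category) additive_sub_zero: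
  assumes "additive_sub C D"
  shows "\<exists>Z \<in> D. is_zero C Z"
proof -
  interpret S: additive_category "full_sub C D" using assms by (simp add: additive_sub_def)
  show ?thesis using S.ex_zero assms by (auto simp: additive_sub_def is_zero_full_sub)
qed

section \<open>Semi-simple abelian categories\<close>

context preadditive_category
begin

lemma is_mono_iff:
  "is_mono C f \<longleftrightarrow> f \<in> Arr C \<and>
    (\<forall>z \<in> Arr C. Cod C z = Dom C f \<and> f \<cdot> z = Zero C (Dom C z) (Cod C f) \<longrightarrow> z = Zero C (Dom C z) (Dom C f))"
proof (intro iffI conjI ballI impI)
  assume m: "is_mono C f"
  then show f: "f \<in> Arr C" by (simp add: is_mono_def)
  fix z assume z: "z \<in> Arr C" "Cod C z = Dom C f \<and> f \<cdot> z = Zero C (Dom C z) (Cod C f)"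
  have "f \<cdot> Zero C (Dom C z) (Dom C f) = Zero C (Dom C z) (Cod C f)" using f z by simp
  then show "z = Zero C (Dom C z) (Dom C f)" using m z f unfolding is_mono_def by simp
next
  assume A: "f \<in> Arr C \<and> (\<forall>z \<in> Arr C. Cod C z = Dom C f \<and> f \<cdot> z = Zero C (Dom C z) (Cod C f) \<longrightarrow> z = Zero C (Dom C z) (Dom C f))"
  show "is_mono C f" unfolding is_mono_def
  proof (intro conjI ballI impI)
    fix g h assume g: "g \<in> Arr C" and h: "h \<in> Arr C"
      and e: "Dom C g = Dom C h \<and> Cod C g = Dom C f \<and> Cod C h = Dom C f \<and> f \<cdot> g = f \<cdot> h"
    show "g = h"
    proof (rule eq_if_diff_Zero)
      have "f \<cdot> Plus C g (Neg C h) = Zero C (Dom C g) (Cod C f)" using A g h e by (simp add: comp_Plus comp_Neg)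
      then show "Plus C g (Neg C h) = Zero C (Dom C g) (Cod C g)" using A[THEN conjunct2, THEN bspec, of "Plus C g (Neg C h)"] g h e by simp
    qed (use g h e in auto)
  qed (use A in simp)
qed

lemma is_kernelD:
  assumes "is_kernel C f k" "z \<in> Arr C" "Cod C z = Dom C f" "f \<cdot> z = Zero C (Dom C z) (Cod C f)"
  shows "\<exists>!u. u \<in> Hom C (Dom C z) (Dom C k) \<and> k \<cdot> u = z"
    "\<exists>u. u \<in> Arr C \<and> Dom C u = Dom C z \<and> Cod C u = Dom C k \<and> k \<cdot> u = z"
proof -
  show 1: "\<exists>!u. u \<in> Hom C (Dom C z) (Dom C k) \<and> k \<cdot> u = z"
    using assms unfolding is_kernel_def by simp
  then show "\<exists>u. u \<in> Arr C \<and> Dom C u = Dom C z \<and> Cod C u = Dom C k \<and> k \<cdot> u = z" by auto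
qed

lemma is_cokernelD:
  assumes "is_cokernel C f k" "z \<in> Arr C" "Dom C z = Cod C f" "z \<cdot> f = Zero C (Dom C f) (Cod C z)"
  shows "\<exists>!u. u \<in> Hom C (Cod C k) (Cod C z) \<and> u \<cdot> k = z"
    "\<exists>u. u \<in> Arr C \<and> Dom C u = Cod C k \<and> Cod C u = Cod C z \<and> u \<cdot> k = z"
proof -
  show 1: "\<exists>!u. u \<in> Hom C (Cod C k) (Cod C z) \<and> u \<cdot> k = z"
    using assms unfolding is_cokernel_def by simp
  then show "\<exists>u. u \<in> Arr C \<and> Dom C u = Cod C k \<and> Cod C u = Cod C z \<and> u \<cdot> k = z" by auto
qed

text \<open>A kernel is the kernel of its own cokernel: \<open>g\<close> factors through
  \<open>e\<close>, so whatever \<open>e\<close> kills is killed by \<open>g\<close> and lifts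
  through \<open>k\<close>.\<close>

lemma kernel_of_cokernel:
  assumes "is_kernel C g k" "is_cokernel C k e"
  shows "short_exact C k e"
proof -
  have k: "k \<in> Arr C" "g \<in> Arr C" "Cod C k = Dom C g" "g \<cdot> k = Zero C (Dom C k) (Cod C g)"
    using assms by (auto simp: is_kernel_def)
  have e: "e \<in> Arr C" "Dom C e = Dom C g" "e \<cdot> k = Zero C (Dom C k) (Cod C e)"
    using assms k by (auto simp: is_cokernel_def)
  obtain x where x: "x \<in> Arr C" "Dom C x = Cod C e" "Cod C x = Cod C g" "x \<cdot> e = g"
    using is_cokernelD(2)[OF assms(2), of g] k by auto
  have "\<exists>!u. u \<in> Hom C (Dom C z) (Dom C k) \<and> k \<cdot> u = z"
    if z: "z \<in> Arr C" "Cod C z = Dom C e" "e \<cdot> z = Zero C (Dom C z) (Cod C e)" for z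
  proof -
    have "x \<cdot> (e \<cdot> z) = Zero C (Dom C z) (Cod C g)" using z x k by simp
    then have "g \<cdot> z = Zero C (Dom C z) (Cod C g)" using comp_assoc[of z e x] x e z by simp
    then show ?thesis using assms(1) z e unfolding is_kernel_def by simp
  qed
  then have "is_kernel C e k" using k e by (simp add: is_kernel_def)
  then show ?thesis using assms(2) by (simp add: short_exact_def)
qed

lemma kernel_mono:
  assumes "is_kernel C g k" shows "is_mono C k"
  unfolding is_mono_iff
proof (intro conjI ballI impI)
  show k: "k \<in> Arr C" using assms by (simp add: is_kernel_def)
  have g: "g \<in> Arr C" "Cod C k = Dom C g" using assms by (auto simp: is_kernel_def)
  fix z assume z: "z \<in> Arr C" "Cod C z = Dom C k \<and> k \<cdot> z = Zero C (Dom C z) (Cod C k)"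
  have "\<exists>!u. u \<in> Hom C (Dom C z) (Dom C k) \<and> k \<cdot> u = Zero C (Dom C z) (Dom C g)"
    using is_kernelD(1)[OF assms, of "Zero C (Dom C z) (Dom C g)"] z g by simp
  moreover have "z \<in> Hom C (Dom C z) (Dom C k) \<and> k \<cdot> z = Zero C (Dom C z) (Dom C g)" using z g by simp
  moreover have "Zero C (Dom C z) (Dom C k) \<in> Hom C (Dom C z) (Dom C k) \<and>
    k \<cdot> Zero C (Dom C z) (Dom C k) = Zero C (Dom C z) (Dom C g)" using z k g by simp
  ultimately show "z = Zero C (Dom C z) (Dom C k)" by blast
qed

lemma short_exact_section_biproduct:
  assumes se: "short_exact C f g" and s: "s \<in> Hom C (Cod C g) (Dom C g)" "g \<cdot> s = Ident C (Cod C g)"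
  obtains r where "biproduct_data (Dom C f) (Cod C g) (Cod C f) f s r g"
proof -
  have k: "is_kernel C g f" using se by (simp add: short_exact_def)
  have f: "f \<in> Arr C" "g \<in> Arr C" "Dom C g = Cod C f" "g \<cdot> f = Zero C (Dom C f) (Cod C g)"
    using k by (auto simp: is_kernel_def)
  let ?e = "Plus C (Ident C (Cod C f)) (Neg C (s \<cdot> g))"
  have "g \<cdot> (s \<cdot> g) = g" using comp_assoc[of g s g] f s by simp
  then have "g \<cdot> ?e = Zero C (Cod C f) (Cod C g)" using f s by (simp add: comp_Plus comp_Neg)
  then obtain r where r: "r \<in> Arr C" "Dom C r = Cod C f" "Cod C r = Dom C f" "f \<cdot> r = ?e"
    using is_kernelD(2)[OF k, of ?e] f s by auto
  have "biproduct_data (Dom C f) (Cod C g) (Cod C f) f s r g"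
    by (rule split_biproduct_data) (use f s r kernel_mono[OF k] in \<open>auto simp: is_mono_iff\<close>)
  then show ?thesis by (rule that)
qed

lemma biproduct_data_full_sub:
  assumes "D \<subseteq> Obj C"
  shows "preadditive_category.biproduct_data (full_sub C D) X Y S i j p q \<longleftrightarrow>
    X \<in> D \<and> Y \<in> D \<and> S \<in> D \<and> biproduct_data X Y S i j p q"
proof -
  interpret S: preadditive_category "full_sub C D" using assms by (rule preadditive_full_sub)
  show ?thesis unfolding S.biproduct_data_def biproduct_data_def by auto
qed

end

text \<open>The factorisation through the image, with kernel and cokernel split off as direct
  summands. In this form semi-simplicity survives the passage to the triangulated category, where
  split sequences become triangles.\<close>

lemma (in semisimple_abelian_category) semisimple_factor:
  assumes f: "f \<in> Arr C"
  obtains k e m q r s r' s' where "biproduct_data (Dom C k) (Dom C m) (Dom C f) k s r e"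
    "biproduct_data (Dom C m) (Cod C q) (Cod C f) m s' r' q" "m \<cdot> e = f"
proof -
  obtain k where k: "is_kernel C f k" using ex_kernel f by blast
  then have ka: "k \<in> Arr C" "Cod C k = Dom C f" "f \<cdot> k = Zero C (Dom C k) (Cod C f)" by (auto simp: is_kernel_def)
  obtain e where e: "is_cokernel C k e" using ex_cokernel ka by blast
  then have ea: "e \<in> Arr C" "Dom C e = Cod C k" "e \<cdot> k = Zero C (Dom C k) (Cod C e)" by (auto simp: is_cokernel_def)
  have se: "short_exact C k e" by (rule kernel_of_cokernel[OF k e])
  obtain s where s: "s \<in> Hom C (Cod C e) (Dom C e)" "e \<cdot> s = Ident C (Cod C e)"
    using short_exact_split[OF se] by blast
  obtain r where b: "biproduct_data (Dom C k) (Cod C e) (Cod C k) k s r e"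
    by (rule short_exact_section_biproduct[OF se s])
  obtain m where m: "m \<in> Arr C" "Dom C m = Cod C e" "Cod C m = Cod C f" "m \<cdot> e = f"
    using is_cokernelD(2)[OF e, of f] f ka by auto
  \<comment> \<open>The section \<open>s\<close> of \<open>e\<close> lifts an arrow killed by
    \<open>m\<close> to one killed by \<open>f\<close>; that one factors through \<open>k\<close>
    and so dies under \<open>e\<close>.\<close>
  have mono: "is_mono C m" unfolding is_mono_iff
  proof (intro conjI ballI impI m(1))
    fix z assume z: "z \<in> Arr C" "Cod C z = Dom C m \<and> m \<cdot> z = Zero C (Dom C z) (Cod C m)"
    have es: "e \<cdot> (s \<cdot> z) = z" using comp_assoc[of z s e] z ea s m(2) by simp
    have "f \<cdot> (s \<cdot> z) = Zero C (Dom C z) (Cod C f)"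
      using comp_assoc[of "s \<cdot> z" e m] z ea s m es ka by simp
    then obtain y where y: "y \<in> Arr C" "Dom C y = Dom C z" "Cod C y = Dom C k" "k \<cdot> y = s \<cdot> z"
      using is_kernelD(2)[OF k, of "s \<cdot> z"] z s ea ka m by auto
    have "z = (e \<cdot> k) \<cdot> y" using comp_assoc[of y k e] y ea(1,2) ka(1,2) es by simp
    then show "z = Zero C (Dom C z) (Dom C m)" unfolding ea(3) using y ea m by simp
  qed
  obtain x where x: "is_kernel C x m" using mono_normal mono by blast
  obtain q where q: "is_cokernel C m q" using ex_cokernel m by blast
  have se': "short_exact C m q" by (rule kernel_of_cokernel[OF x q])
  obtain s' where s': "s' \<in> Hom C (Cod C q) (Dom C q)" "q \<cdot> s' = Ident C (Cod C q)"
    using short_exact_split[OF se'] by blast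
  obtain r' where b': "biproduct_data (Dom C m) (Cod C q) (Cod C m) m s' r' q"
    by (rule short_exact_section_biproduct[OF se' s'])
  show ?thesis using that[of k m s r e q s' r'] b b' m ka by simp
qed

context preadditive_category
begin

lemma biproduct_data_kernel:
  assumes "biproduct_data X Y S i j p q"
  shows "is_kernel C q i"
proof -
  have a: "i \<in> Arr C" "j \<in> Arr C" "p \<in> Arr C" "q \<in> Arr C" "Dom C i = X" "Cod C i = S" "Dom C j = Y"
    "Cod C j = S" "Dom C p = S" "Cod C p = X" "Dom C q = S" "Cod C q = Y"
    "p \<cdot> i = Ident C X" "q \<cdot> i = Zero C X Y" "Plus C (i \<cdot> p) (j \<cdot> q) = Ident C S"
    using assms by (auto simp: biproduct_data_def)
  have "\<exists>!u. u \<in> Hom C (Dom C z) (Dom C i) \<and> i \<cdot> u = z"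
    if z: "z \<in> Arr C" "Cod C z = S" "q \<cdot> z = Zero C (Dom C z) Y" for z
  proof (rule ex1I[of _ "p \<cdot> z"])
    have "z = Plus C (i \<cdot> p) (j \<cdot> q) \<cdot> z" using a z by simp
    also have "\<dots> = Plus C (i \<cdot> (p \<cdot> z)) (j \<cdot> (q \<cdot> z))" using a(1-12) z(1,2) by (simp add: Plus_comp comp_assoc)
    also have "\<dots> = i \<cdot> (p \<cdot> z)" unfolding z(3) using a(1-12) z(1,2) by simp
    finally show "p \<cdot> z \<in> Hom C (Dom C z) (Dom C i) \<and> i \<cdot> (p \<cdot> z) = z" using a z by simp
    fix u assume "u \<in> Hom C (Dom C z) (Dom C i) \<and> i \<cdot> u = z"
    then show "u = p \<cdot> z" using a comp_assoc[of u i p] by auto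
  qed
  then show ?thesis using a by (simp add: is_kernel_def)
qed

lemma biproduct_data_cokernel:
  assumes "biproduct_data X Y S i j p q"
  shows "is_cokernel C i q"
proof -
  have a: "i \<in> Arr C" "j \<in> Arr C" "p \<in> Arr C" "q \<in> Arr C" "Dom C i = X" "Cod C i = S" "Dom C j = Y"
    "Cod C j = S" "Dom C p = S" "Cod C p = X" "Dom C q = S" "Cod C q = Y"
    "q \<cdot> j = Ident C Y" "q \<cdot> i = Zero C X Y" "Plus C (i \<cdot> p) (j \<cdot> q) = Ident C S"
    using assms by (auto simp: biproduct_data_def)
  have "\<exists>!u. u \<in> Hom C (Cod C q) (Cod C z) \<and> u \<cdot> q = z"
    if z: "z \<in> Arr C" "Dom C z = S" "z \<cdot> i = Zero C X (Cod C z)" for z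
  proof (rule ex1I[of _ "z \<cdot> j"])
    have "z = z \<cdot> Plus C (i \<cdot> p) (j \<cdot> q)" using a z by simp
    also have "\<dots> = Plus C ((z \<cdot> i) \<cdot> p) ((z \<cdot> j) \<cdot> q)" using a(1-12) z(1,2) by (simp add: comp_Plus comp_assoc)
    also have "\<dots> = (z \<cdot> j) \<cdot> q" unfolding z(3) using a(1-12) z(1,2) by simp
    finally show "z \<cdot> j \<in> Hom C (Cod C q) (Cod C z) \<and> (z \<cdot> j) \<cdot> q = z" using a z by simp
    fix u assume "u \<in> Hom C (Cod C q) (Cod C z) \<and> u \<cdot> q = z"
    then show "u = z \<cdot> j" using a comp_assoc[of j q u] by auto
  qed
  then show ?thesis using a by (simp add: is_cokernel_def)
qed

lemma is_epi_zero:
  assumes "is_epi C f" "v \<in> Arr C" "Dom C v = Cod C f" "v \<cdot> f = Zero C (Dom C f) (Cod C v)"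
  shows "v = Zero C (Cod C f) (Cod C v)"
proof -
  have f: "f \<in> Arr C" using assms by (simp add: is_epi_def)
  have "Zero C (Cod C f) (Cod C v) \<cdot> f = Zero C (Dom C f) (Cod C v)" using f assms by simp
  then show ?thesis using assms f unfolding is_epi_def by simp
qed

lemma is_kernel_precomp_iso:
  assumes "is_kernel C f k" "inverse_pair u u'" "Cod C u = Dom C k"
  shows "is_kernel C f (k \<cdot> u)"
proof -
  have k: "f \<in> Arr C" "k \<in> Arr C" "Cod C k = Dom C f" "f \<cdot> k = Zero C (Dom C k) (Cod C f)"
    using assms by (auto simp: is_kernel_def)
  have u: "u \<in> Arr C" "u' \<in> Arr C" "Dom C u' = Dom C k" "Cod C u' = Dom C u" "u' \<cdot> u = Ident C (Dom C u)"
    "u \<cdot> u' = Ident C (Dom C k)" "Cod C u = Dom C k" using assms by (auto simp: inverse_pair_def)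
  have ku: "k \<cdot> u \<in> Arr C" "Dom C (k \<cdot> u) = Dom C u" "Cod C (k \<cdot> u) = Dom C f" using k u by simp_all
  have 0: "f \<cdot> (k \<cdot> u) = Zero C (Dom C u) (Cod C f)" using comp_assoc[of u k f] k u by simp
  have "\<exists>!v. v \<in> Hom C (Dom C z) (Dom C u) \<and> (k \<cdot> u) \<cdot> v = z"
    if z: "z \<in> Arr C" "Cod C z = Dom C f" "f \<cdot> z = Zero C (Dom C z) (Cod C f)" for z
  proof -
    have ex: "\<exists>!v. v \<in> Hom C (Dom C z) (Dom C k) \<and> k \<cdot> v = z" using assms(1) z unfolding is_kernel_def by simp
    then obtain v where v: "v \<in> Hom C (Dom C z) (Dom C k)" "k \<cdot> v = z" by blast
    have kuv: "(k \<cdot> u) \<cdot> y = k \<cdot> (u \<cdot> y)" if "y \<in> Arr C" "Cod C y = Dom C u" for y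
      using that k u by (simp add: comp_assoc)
    have uuv: "u \<cdot> (u' \<cdot> v) = v" using comp_assoc[of v u' u] v u by simp
    show ?thesis
    proof (rule ex1I[of _ "u' \<cdot> v"])
      show "u' \<cdot> v \<in> Hom C (Dom C z) (Dom C u) \<and> (k \<cdot> u) \<cdot> (u' \<cdot> v) = z"
        using kuv[of "u' \<cdot> v"] uuv u v by simp
      fix y assume y: "y \<in> Hom C (Dom C z) (Dom C u) \<and> (k \<cdot> u) \<cdot> y = z"
      then have "u \<cdot> y \<in> Hom C (Dom C z) (Dom C k) \<and> k \<cdot> (u \<cdot> y) = z" using kuv[of y] u by simp
      then have "u \<cdot> y = v" using ex v by blast
      then show "y = u' \<cdot> v" using comp_assoc[of y u u'] u y by auto
    qed
  qed
  then show ?thesis using k ku 0 by (simp add: is_kernel_def)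
qed

lemma is_cokernel_postcomp_iso:
  assumes "is_cokernel C f k" "inverse_pair u u'" "Dom C u = Cod C k"
  shows "is_cokernel C f (u \<cdot> k)"
proof -
  have k: "f \<in> Arr C" "k \<in> Arr C" "Dom C k = Cod C f" "k \<cdot> f = Zero C (Dom C f) (Cod C k)"
    using assms by (auto simp: is_cokernel_def)
  have u: "u \<in> Arr C" "u' \<in> Arr C" "Dom C u' = Cod C u" "Cod C u' = Cod C k" "u' \<cdot> u = Ident C (Cod C k)"
    "u \<cdot> u' = Ident C (Cod C u)" "Dom C u = Cod C k" using assms by (auto simp: inverse_pair_def)
  have ku: "u \<cdot> k \<in> Arr C" "Dom C (u \<cdot> k) = Cod C f" "Cod C (u \<cdot> k) = Cod C u" using k u by simp_all
  have 0: "(u \<cdot> k) \<cdot> f = Zero C (Dom C f) (Cod C u)" using comp_assoc[of f k u] k u by simp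
  have "\<exists>!v. v \<in> Hom C (Cod C u) (Cod C z) \<and> v \<cdot> (u \<cdot> k) = z"
    if z: "z \<in> Arr C" "Dom C z = Cod C f" "z \<cdot> f = Zero C (Dom C f) (Cod C z)" for z
  proof -
    have ex: "\<exists>!v. v \<in> Hom C (Cod C k) (Cod C z) \<and> v \<cdot> k = z" using assms(1) z unfolding is_cokernel_def by simp
    then obtain v where v: "v \<in> Hom C (Cod C k) (Cod C z)" "v \<cdot> k = z" by blast
    have kuv: "y \<cdot> (u \<cdot> k) = (y \<cdot> u) \<cdot> k" if "y \<in> Arr C" "Dom C y = Cod C u" for y
      using that k u by (simp add: comp_assoc)
    have uuv: "(v \<cdot> u') \<cdot> u = v" using comp_assoc[of u u' v] v u by simp
    show ?thesis
    proof (rule ex1I[of _ "v \<cdot> u'"])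
      show "v \<cdot> u' \<in> Hom C (Cod C u) (Cod C z) \<and> (v \<cdot> u') \<cdot> (u \<cdot> k) = z"
        using kuv[of "v \<cdot> u'"] uuv u v by simp
      fix y assume y: "y \<in> Hom C (Cod C u) (Cod C z) \<and> y \<cdot> (u \<cdot> k) = z"
      then have "y \<cdot> u \<in> Hom C (Cod C k) (Cod C z) \<and> (y \<cdot> u) \<cdot> k = z" using kuv[of y] u by simp
      then have "y \<cdot> u = v" using ex v by blast
      then show "y = v \<cdot> u'" using comp_assoc[of u' u y] u y by auto
    qed
  qed
  then show ?thesis using k ku 0 by (simp add: is_cokernel_def)
qed

lemma is_kernel_postcomp_mono:
  assumes "is_kernel C e k" "is_mono C m" "Dom C m = Cod C e"
  shows "is_kernel C (m \<cdot> e) k"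
proof -
  have k: "e \<in> Arr C" "k \<in> Arr C" "Cod C k = Dom C e" "e \<cdot> k = Zero C (Dom C k) (Cod C e)"
    using assms by (auto simp: is_kernel_def)
  have m: "m \<in> Arr C" using assms by (simp add: is_mono_def)
  have 0: "(m \<cdot> e) \<cdot> k = Zero C (Dom C k) (Cod C m)" using comp_assoc[of k e m] k m assms(3) by simp
  have "\<exists>!u. u \<in> Hom C (Dom C z) (Dom C k) \<and> k \<cdot> u = z"
    if z: "z \<in> Arr C" "Cod C z = Dom C e" "(m \<cdot> e) \<cdot> z = Zero C (Dom C z) (Cod C m)" for z
  proof -
    have "m \<cdot> (e \<cdot> z) = Zero C (Dom C z) (Cod C m)" using comp_assoc[of z e m] k m assms(3) z by simp
    then have "e \<cdot> z = Zero C (Dom C z) (Cod C e)"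
      using assms(2)[unfolded is_mono_iff, THEN conjunct2, THEN bspec, of "e \<cdot> z"] assms(3) k z by simp
    then show ?thesis using assms(1) z unfolding is_kernel_def by simp
  qed
  then show ?thesis using k m 0 assms(3) by (simp add: is_kernel_def)
qed

end

text \<open>Converse of \<open>semisimple_factor\<close>. For a monomorphism \<open>k\<close>
  vanishes, so \<open>e\<close> is invertible and \<open>f\<close> is, up to isomorphism, the kernel
  \<open>m\<close> of \<open>q\<close>. For an epimorphism \<open>q\<close> vanishes, so
  \<open>m\<close> is invertible and \<open>s \<cdot> r'\<close> is a section of \<open>f\<close>;
  applied to the second map of a short exact sequence this gives the splitting.\<close>

lemma (in additive_category) semisimpleI:
  assumes fac: "\<And>f. f \<in> Arr C \<Longrightarrow> \<exists>k e m q r s r' s'. biproduct_data (Dom C k) (Dom C m) (Dom C f) k s r e \<and>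
    biproduct_data (Dom C m) (Cod C q) (Cod C f) m s' r' q \<and> m \<cdot> e = f"
  shows "semisimple_abelian_category C"
proof -
  have main: "\<exists>k q. is_kernel C f k \<and> is_cokernel C f q \<and> (is_mono C f \<longrightarrow> is_kernel C q f) \<and>
      (is_epi C f \<longrightarrow> is_cokernel C k f \<and> (\<exists>s \<in> Hom C (Cod C f) (Dom C f). f \<cdot> s = Ident C (Cod C f)))"
    if f: "f \<in> Arr C" for f
  proof -
    obtain k e m q r s r' s' where b: "biproduct_data (Dom C k) (Dom C m) (Dom C f) k s r e"
      "biproduct_data (Dom C m) (Cod C q) (Cod C f) m s' r' q" and me: "m \<cdot> e = f" using fac[OF f] by blast
    have a: "k \<in> Arr C" "s \<in> Arr C" "r \<in> Arr C" "e \<in> Arr C" "Cod C k = Dom C f" "Dom C s = Dom C m" "Cod C s = Dom C f"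
      "Dom C r = Dom C f" "Cod C r = Dom C k" "Dom C e = Dom C f" "Cod C e = Dom C m"
      "m \<in> Arr C" "s' \<in> Arr C" "r' \<in> Arr C" "q \<in> Arr C" "Cod C m = Cod C f" "Dom C s' = Cod C q" "Cod C s' = Cod C f"
      "Dom C r' = Cod C f" "Cod C r' = Dom C m" "Dom C q = Cod C f"
      and eq: "r \<cdot> k = Ident C (Dom C k)" "e \<cdot> s = Ident C (Dom C m)" "Plus C (k \<cdot> r) (s \<cdot> e) = Ident C (Dom C f)"
      "e \<cdot> k = Zero C (Dom C k) (Dom C m)" "q \<cdot> m = Zero C (Dom C m) (Cod C q)"
      "r' \<cdot> m = Ident C (Dom C m)" "q \<cdot> s' = Ident C (Cod C q)" "Plus C (m \<cdot> r') (s' \<cdot> q) = Ident C (Cod C f)"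
      using b by (auto simp: biproduct_data_def)
    have mm: "is_mono C m" by (rule kernel_mono[OF biproduct_data_kernel[OF b(2)]])
    have k: "is_kernel C f k" using is_kernel_postcomp_mono[OF biproduct_data_kernel[OF b(1)] mm] a me by simp
    have q: "is_cokernel C f q"
    proof -
      have "\<exists>!u. u \<in> Hom C (Cod C q) (Cod C z) \<and> u \<cdot> q = z"
        if z: "z \<in> Arr C" "Dom C z = Cod C f" "z \<cdot> f = Zero C (Dom C f) (Cod C z)" for z
      proof -
        have "(z \<cdot> m) \<cdot> e = Zero C (Dom C f) (Cod C z)" using z a me by (simp add: comp_assoc)
        then have "((z \<cdot> m) \<cdot> e) \<cdot> s = Zero C (Dom C m) (Cod C z)" using z a by simp
        then have "z \<cdot> m = Zero C (Dom C m) (Cod C z)" using comp_assoc[of s e "z \<cdot> m"] z a eq by simp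
        then show ?thesis using biproduct_data_cokernel[OF b(2)] z a unfolding is_cokernel_def by simp
      qed
      moreover have "q \<cdot> f = Zero C (Dom C f) (Cod C q)" using comp_assoc[of e m q] a eq me by simp
      ultimately show ?thesis using f a by (simp add: is_cokernel_def)
    qed
    have 1: "is_kernel C q f" if m: "is_mono C f"
    proof -
      have o: "Dom C k \<in> Obj C" using a by simp
      have "f \<cdot> k = Zero C (Dom C k) (Cod C f)" using k by (simp add: is_kernel_def)
      then have k0: "k = Zero C (Dom C k) (Dom C f)" using m a unfolding is_mono_iff by blast
      have "k \<cdot> r = Zero C (Dom C f) (Dom C f)" using a o f by (subst k0) simp
      then have se: "s \<cdot> e = Ident C (Dom C f)" using eq(3) a by simp
      then have "inverse_pair e s" using a eq by (simp add: inverse_pair_def)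
      then show ?thesis using is_kernel_precomp_iso[OF biproduct_data_kernel[OF b(2)], of e s] a me by simp
    qed
    have 2: "is_cokernel C k f \<and> (\<exists>s \<in> Hom C (Cod C f) (Dom C f). f \<cdot> s = Ident C (Cod C f))" if m: "is_epi C f"
    proof -
      have o: "Cod C q \<in> Obj C" using a by simp
      have "q \<cdot> f = Zero C (Dom C f) (Cod C q)" using q by (simp add: is_cokernel_def)
      then have q0: "q = Zero C (Cod C f) (Cod C q)" using is_epi_zero[OF m] a by simp
      have "s' \<cdot> q = Zero C (Cod C f) (Cod C f)" using a o f by (subst q0) simp
      then have mr: "m \<cdot> r' = Ident C (Cod C f)" using eq(8) a by simp
      then have "inverse_pair m r'" using a eq by (simp add: inverse_pair_def)
      then have "is_cokernel C k f" using is_cokernel_postcomp_iso[OF biproduct_data_cokernel[OF b(1)], of m r'] a me by simp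
      moreover have "f \<cdot> (s \<cdot> r') = Ident C (Cod C f)"
      proof -
        have "f \<cdot> (s \<cdot> r') = m \<cdot> ((e \<cdot> s) \<cdot> r')" unfolding me[symmetric] using a by (simp add: comp_assoc)
        then show ?thesis using eq a mr by simp
      qed
      ultimately show ?thesis using a by (intro conjI bexI[of _ "s \<cdot> r'"]) auto
    qed
    show ?thesis using k q 1 2 by blast
  qed
  have epi: "is_epi C g" if se: "short_exact C f g" for f g
    unfolding is_epi_def
  proof (intro conjI ballI impI)
    have c: "is_cokernel C f g" using se by (simp add: short_exact_def)
    then show g: "g \<in> Arr C" by (simp add: is_cokernel_def)
    have f: "f \<in> Arr C" "Dom C g = Cod C f" "g \<cdot> f = Zero C (Dom C f) (Cod C g)" using c by (auto simp: is_cokernel_def)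
    fix u v assume u: "u \<in> Arr C" and v: "v \<in> Arr C"
      and e: "Cod C u = Cod C v \<and> Dom C u = Cod C g \<and> Dom C v = Cod C g \<and> u \<cdot> g = v \<cdot> g"
    have "(u \<cdot> g) \<cdot> f = Zero C (Dom C f) (Cod C (u \<cdot> g))" using comp_assoc[of f g u] f g u v e by simp
    then have "\<exists>!x. x \<in> Hom C (Cod C g) (Cod C (u \<cdot> g)) \<and> x \<cdot> g = u \<cdot> g"
      using is_cokernelD(1)[OF c, of "u \<cdot> g"] u v e g f by simp
    moreover have "u \<in> Hom C (Cod C g) (Cod C (u \<cdot> g)) \<and> u \<cdot> g = u \<cdot> g" using u v e g by simp
    moreover have "v \<in> Hom C (Cod C g) (Cod C (u \<cdot> g)) \<and> v \<cdot> g = u \<cdot> g" using u v e g by simp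
    ultimately show "u = v" by blast
  qed
  show ?thesis
  proof
    show "\<exists>k. is_kernel C f k" "\<exists>e. is_cokernel C f e" if "f \<in> Arr C" for f using main[OF that] by blast+
    show "\<exists>g. is_kernel C g f" if "is_mono C f" for f using main[of f] that by (auto simp: is_mono_def)
    show "\<exists>g. is_cokernel C g f" if e: "is_epi C f" for f
    proof -
      have "f \<in> Arr C" using e by (simp add: is_epi_def)
      then show ?thesis using main[of f] e by blast
    qed
    show "\<exists>s \<in> Hom C (Cod C g) (Dom C g). g \<cdot> s = Ident C (Cod C g)" if se: "short_exact C f g" for f g
    proof -
      have "g \<in> Arr C" using se by (simp add: short_exact_def is_kernel_def)
      then show ?thesis using main[of g] epi[OF se] by blast
    qed
  qed
qed

section \<open>Distinguished triangles and extensions\<close>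

context triangulated_category
begin

section \<open>The shift functor, rotation and signs\<close>

lemma ShO_Obj [simp]: "X \<in> Obj C \<Longrightarrow> ShO C n X \<in> Obj C"
  and ShM_Ident [simp]: "X \<in> Obj C \<Longrightarrow> ShM C n (Ident C X) = Ident C (ShO C n X)"
  using shift_functor[of n] by (auto simp: additive_functor_def is_functor_def)

lemma ShM_simps [simp]:
  assumes "f \<in> Arr C"
  shows "ShM C n f \<in> Arr C" "Dom C (ShM C n f) = ShO C n (Dom C f)"
    "Cod C (ShM C n f) = ShO C n (Cod C f)"
  using shift_functor[of n] assms by (auto simp: additive_functor_def is_functor_def)

lemma ShM_comp:
  assumes "f \<in> Arr C" "g \<in> Arr C" "Dom C g = Cod C f"
  shows "ShM C n (g \<cdot> f) = ShM C n g \<cdot> ShM C n f"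
  using shift_functor[of n] assms by (auto simp: additive_functor_def is_functor_def)

lemma ShM_Plus:
  assumes "f \<in> Arr C" "g \<in> Arr C" "Dom C g = Dom C f" "Cod C g = Cod C f"
  shows "ShM C n (Plus C f g) = Plus C (ShM C n f) (ShM C n g)"
  using shift_functor[of n] assms by (auto simp: additive_functor_def)

lemma ShM_Zero [simp]:
  assumes "X \<in> Obj C" "Y \<in> Obj C"
  shows "ShM C n (Zero C X Y) = Zero C (ShO C n X) (ShO C n Y)"
  using idem_Zero[of "ShM C n (Zero C X Y)"] ShM_Plus[of "Zero C X Y" "Zero C X Y" n] assms by simp

lemma ShM_Neg [simp]:
  assumes "f \<in> Arr C"
  shows "ShM C n (Neg C f) = Neg C (ShM C n f)"
  using assms ShM_Plus[of "Neg C f" f n] by (intro eq_Neg_iff) auto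

lemma ShO_ShO [simp]: "X \<in> Obj C \<Longrightarrow> ShO C m (ShO C n X) = ShO C (m + n) X"
  by (simp add: ShO_add)

lemma ShM_ShM [simp]: "f \<in> Arr C \<Longrightarrow> ShM C m (ShM C n f) = ShM C (m + n) f"
  by (simp add: ShM_add)

declare ShO_0 [simp] ShM_0 [simp]

lemma orth_shift:
  assumes "X \<in> Obj C" "Y \<in> Obj C" "orth X Y"
  shows "orth (ShO C n X) (ShO C n Y)"
  unfolding orth_def
proof (intro ballI impI)
  fix f assume f: "f \<in> Arr C" "Dom C f = ShO C n X \<and> Cod C f = ShO C n Y"
  then have "ShM C (-n) f = Zero C X Y"
    using assms by (intro orthD) auto
  then have "ShM C n (ShM C (-n) f) = Zero C (ShO C n X) (ShO C n Y)" using assms by simp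
  then show "f = Zero C (ShO C n X) (ShO C n Y)" using f by simp
qed

lemma orth_shift_iff:
  assumes "X \<in> Obj C" "Y \<in> Obj C"
  shows "orth (ShO C n X) Y \<longleftrightarrow> orth X (ShO C (-n) Y)"
  using orth_shift[of "ShO C n X" Y "-n"] orth_shift[of X "ShO C (-n) Y" n] assms by auto

lemma inverse_pair_shift: "inverse_pair u v \<Longrightarrow> inverse_pair (ShM C n u) (ShM C n v)"
  by (auto simp: inverse_pair_def ShM_comp[symmetric])

lemma Tri_simps:
  assumes "(f, g, h) \<in> Tri C"
  shows "f \<in> Arr C" "g \<in> Arr C" "h \<in> Arr C" "Dom C g = Cod C f" "Dom C h = Cod C g"
    "Cod C h = ShO C 1 (Dom C f)"
  using Tri_triangle[OF assms] by (auto simp: is_triangle_def)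

lemma Tri_transport:
  assumes "(f, g, h) \<in> Tri C" "inverse_pair u u'" "inverse_pair v v'" "inverse_pair w w'"
    "Dom C u = Dom C f" "Dom C v = Cod C f" "Dom C w = Cod C g"
  shows "((v \<cdot> f) \<cdot> u', (w \<cdot> g) \<cdot> v', (ShM C 1 u \<cdot> h) \<cdot> w') \<in> Tri C"
proof -
  note T = Tri_simps[OF assms(1)]
  note U = inverse_pair_shift[OF assms(2), of 1]
  show ?thesis
    by (rule Tri_iso[OF assms(1), where u=u and v=v and w=w])
       (use assms T U in \<open>auto simp: is_isomorphism_iff is_triangle_def inverse_pair_def comp_assoc\<close>)
qed

lemma Tri_rot: "(f, g, h) \<in> Tri C \<Longrightarrow> (g, h, Neg C (ShM C 1 f)) \<in> Tri C"
  using Tri_rotate Tri_triangle by blast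

lemma Tri_rot_inv:
  assumes "(f, g, h) \<in> Tri C"
  shows "(Neg C (ShM C (-1) h), f, g) \<in> Tri C"
proof -
  note T = Tri_simps[OF assms]
  have "is_triangle C (Neg C (ShM C (-1) h)) f g" using T by (auto simp: is_triangle_def)
  then show ?thesis using Tri_rotate[of "Neg C (ShM C (-1) h)" f g] assms T by simp
qed

lemma inverse_pair_Neg_Ident: "X \<in> Obj C \<Longrightarrow> inverse_pair (Neg C (Ident C X)) (Neg C (Ident C X))"
  by (auto simp: inverse_pair_def comp_Neg Neg_comp)

text \<open>Conjugation by -1 on one of the three objects changes the signs of exactly the two
  arrows that meet there.\<close>

lemma Tri_Neg:
  assumes "(f, g, h) \<in> Tri C"
  shows "(Neg C f, Neg C g, h) \<in> Tri C" "(f, Neg C g, Neg C h) \<in> Tri C" "(Neg C f, g, Neg C h) \<in> Tri C"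
proof -
  note T = Tri_simps[OF assms]
  have o: "Dom C f \<in> Obj C" "Cod C f \<in> Obj C" "Cod C g \<in> Obj C" using T by auto
  show "(Neg C f, Neg C g, h) \<in> Tri C"
    using Tri_transport[OF assms inverse_pair_Ident[OF o(1)] inverse_pair_Neg_Ident[OF o(2)] inverse_pair_Ident[OF o(3)]]
      T by (simp add: comp_Neg Neg_comp)
  show "(f, Neg C g, Neg C h) \<in> Tri C"
    using Tri_transport[OF assms inverse_pair_Ident[OF o(1)] inverse_pair_Ident[OF o(2)] inverse_pair_Neg_Ident[OF o(3)]]
      T by (simp add: comp_Neg Neg_comp)
  show "(Neg C f, g, Neg C h) \<in> Tri C"
    using Tri_transport[OF assms inverse_pair_Neg_Ident[OF o(1)] inverse_pair_Ident[OF o(2)] inverse_pair_Ident[OF o(3)]]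
      T by (simp add: comp_Neg Neg_comp)
qed

text \<open>Forgetting the third arrow makes shift and rotation free of signs, and lifting arguments
  only mention the first two arrows.\<close>

definition seq :: "'m \<Rightarrow> 'm \<Rightarrow> bool" where
  "seq f g \<longleftrightarrow> (\<exists>h. (f, g, h) \<in> Tri C)"

lemma seqI: "(f, g, h) \<in> Tri C \<Longrightarrow> seq f g"
  by (auto simp: seq_def)

lemma seq_simps:
  assumes "seq f g"
  shows "f \<in> Arr C" "g \<in> Arr C" "Dom C g = Cod C f"
  using assms Tri_simps by (auto simp: seq_def)

text \<open>Three rotations amount to the shift with a sign on each arrow; \<open>Tri_Neg\<close>
  removes the signs of the first two.\<close>

lemma seq_shift_1: "seq f g \<Longrightarrow> seq (ShM C 1 f) (ShM C 1 g)"
proof -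
  assume "seq f g"
  then obtain h where h: "(f, g, h) \<in> Tri C" by (auto simp: seq_def)
  have "(Neg C (ShM C 1 f), Neg C (ShM C 1 g), Neg C (ShM C 1 h)) \<in> Tri C"
    by (intro Tri_rot h)
  from Tri_Neg(1)[OF this] show ?thesis using Tri_simps[OF h] by (auto simp: seq_def)
qed

lemma seq_shift_neg: "seq f g \<Longrightarrow> seq (ShM C (-1) f) (ShM C (-1) g)"
proof -
  assume "seq f g"
  then obtain h where h: "(f, g, h) \<in> Tri C" by (auto simp: seq_def)
  have "(Neg C (ShM C (-1) f), Neg C (ShM C (-1) g), Neg C (ShM C (-1) h)) \<in> Tri C"
    by (intro Tri_rot_inv h)
  from Tri_Neg(1)[OF this] show ?thesis using Tri_simps[OF h] by (auto simp: seq_def)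
qed

lemma seq_shift:
  assumes "seq f g"
  shows "seq (ShM C n f) (ShM C n g)"
proof (induction n rule: int_induct[where k=0])
  case base
  then show ?case using assms seq_simps[OF assms] by simp
next
  case (step1 i)
  then show ?case using seq_shift_1[of "ShM C i f" "ShM C i g"] seq_simps[OF assms]
    by (simp add: add.commute)
next
  case (step2 i)
  then show ?case using seq_shift_neg[of "ShM C i f" "ShM C i g"] seq_simps[OF assms]
    by (simp add: add.commute)
qed

lemma seq_comp:
  assumes "seq f g"
  shows "g \<cdot> f = Zero C (Dom C f) (Cod C g)"
proof -
  obtain h where h: "(f, g, h) \<in> Tri C" using assms by (auto simp: seq_def)
  note T = Tri_simps[OF h]
  obtain Z where Z: "is_zero C Z" using ex_zero by auto
  then have Zo: "Z \<in> Obj C" by (simp add: is_zero_iff)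
  have X: "Dom C f \<in> Obj C" using T by simp
  from Tri_morphism[OF Tri_Id[OF X Z] h, of "Ident C (Dom C f)" f] T Zo X
  obtain w where "w \<in> Hom C Z (Cod C g)" "w \<cdot> Zero C (Dom C f) Z = g \<cdot> f" by auto
  then show ?thesis using X Zo by auto
qed

text \<open>With \<open>U\<close> the domain of \<open>u\<close>, the square from
  \<open>U \<rightarrow> 0\<close> to \<open>g\<close> extends to a morphism of rotated triangles.
  Its third component, shifted back, is the lift; the signs of the two rotations cancel.\<close>

lemma lift:
  assumes "seq f g" "u \<in> Arr C" "Cod C u = Cod C f" "g \<cdot> u = Zero C (Dom C u) (Cod C g)"
  obtains v where "v \<in> Arr C" "Dom C v = Dom C u" "Cod C v = Dom C f" "f \<cdot> v = u"
proof -
  obtain h where h: "(f, g, h) \<in> Tri C" using assms by (auto simp: seq_def)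
  note T = Tri_simps[OF h]
  obtain Z where Z: "is_zero C Z" using ex_zero by auto
  then have Zo: "Z \<in> Obj C" by (simp add: is_zero_iff)
  have X: "Dom C u \<in> Obj C" using assms by simp
  note R = Tri_rot[OF Tri_Id[OF X Z]]
  from Tri_morphism[OF R Tri_rot[OF h], of u "Zero C Z (Cod C g)"] T Zo X assms
  obtain w where w: "w \<in> Arr C" "Dom C w = ShO C 1 (Dom C u)" "Cod C w = ShO C 1 (Dom C f)"
    "Neg C (ShM C 1 u) = Neg C (ShM C 1 f \<cdot> w)" by (auto simp: comp_Neg Neg_comp)
  have "ShM C 1 u = Neg C (Neg C (ShM C 1 u))" using assms(2) by simp
  also have "\<dots> = ShM C 1 f \<cdot> w" unfolding w(4) using w(1-3) T(1) by simp
  finally have "ShM C (-1) (ShM C 1 u) = ShM C (-1) (ShM C 1 f \<cdot> w)" by (rule arg_cong)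
  then have "u = f \<cdot> ShM C (-1) w" using T(1) assms(2) w(1-3) by (simp add: ShM_comp)
  then show ?thesis using w(1-3) T(1) assms(2) by (intro that[of "ShM C (-1) w"]) simp_all
qed

lemma colift:
  assumes "seq f g" "u \<in> Arr C" "Dom C u = Cod C f" "u \<cdot> f = Zero C (Dom C f) (Cod C u)"
  obtains v where "v \<in> Arr C" "Dom C v = Cod C g" "Cod C v = Cod C u" "v \<cdot> g = u"
proof -
  obtain h where h: "(f, g, h) \<in> Tri C" using assms by (auto simp: seq_def)
  note T = Tri_simps[OF h]
  obtain Z where Z: "is_zero C Z" using ex_zero by auto
  then have Zo: "Z \<in> Obj C" by (simp add: is_zero_iff)
  have X: "Cod C u \<in> Obj C" "Dom C f \<in> Obj C" using assms T by simp_all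
  let ?z = "Neg C (ShM C (-1) (Zero C Z (ShO C 1 (Cod C u))))"
  have R: "(?z, Ident C (Cod C u), Zero C (Cod C u) Z) \<in> Tri C"
    by (rule Tri_rot_inv[OF Tri_Id[OF X(1) Z]])
  have z: "?z = Zero C (ShO C (-1) Z) (Cod C u)" using X Zo by simp
  have "\<exists>w \<in> Hom C (Cod C g) (Cod C (Ident C (Cod C u))). w \<cdot> g = Ident C (Cod C u) \<cdot> u \<and>
      ShM C 1 (Zero C (Dom C f) (ShO C (-1) Z)) \<cdot> h = Zero C (Cod C u) Z \<cdot> w"
    by (rule Tri_morphism[OF h R]) (unfold z, use T(1,4) Zo X assms(2-4) in simp_all)
  then obtain w where w: "w \<in> Arr C" "Dom C w = Cod C g" "Cod C w = Cod C u" "w \<cdot> g = u"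
    using X assms(2) by auto
  then show ?thesis by (rule that)
qed

text \<open>Continuation of a distinguished triangle one step to either side, with the sign dropped.\<close>

lemma seq_next:
  assumes "(f, g, h) \<in> Tri C"
  shows "seq f g" "seq g h" "seq h (ShM C 1 f)" "seq (ShM C (-1) h) f" "seq (ShM C (-1) g) (ShM C (-1) h)"
proof -
  note T = Tri_simps[OF assms]
  show "seq f g" "seq g h" using assms Tri_rot by (auto simp: seq_def)
  then show "seq (ShM C (-1) g) (ShM C (-1) h)" by (intro seq_shift)
  show "seq h (ShM C 1 f)"
    using Tri_Neg(2)[OF Tri_rot[OF Tri_rot[OF assms]]] T by (auto simp: seq_def)
  show "seq (ShM C (-1) h) f"
    using Tri_Neg(3)[OF Tri_rot_inv[OF assms]] T by (auto simp: seq_def)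
qed

text \<open>An arrow killed by \<open>f\<close> factors through the preceding object of the
  triangle, \<open>(Cod g)[-1]\<close>, where orthogonality leaves only zero.\<close>

lemma lift_unique:
  assumes "seq f g" "orth T (ShO C (-1) (Cod C g))" "v \<in> Arr C" "Dom C v = T" "Cod C v = Dom C f"
    "f \<cdot> v = Zero C T (Cod C f)"
  shows "v = Zero C T (Dom C f)"
proof -
  obtain h where h: "(f, g, h) \<in> Tri C" using assms by (auto simp: seq_def)
  note S = Tri_simps[OF h]
  obtain x where x: "x \<in> Arr C" "Dom C x = T" "Cod C x = ShO C (-1) (Cod C g)" "ShM C (-1) h \<cdot> x = v"
    using lift[OF seq_next(4)[OF h], of v] assms S by auto
  then have x0: "x = Zero C T (ShO C (-1) (Cod C g))" using assms(2) by (intro orthD) auto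
  have "T \<in> Obj C" using x by auto
  then show ?thesis using S x(4) unfolding x0 by auto
qed

lemma colift_unique:
  assumes "seq f g" "orth (ShO C 1 (Dom C f)) T" "v \<in> Arr C" "Dom C v = Cod C g" "Cod C v = T"
    "v \<cdot> g = Zero C (Cod C f) T"
  shows "v = Zero C (Cod C g) T"
proof -
  obtain h where h: "(f, g, h) \<in> Tri C" using assms by (auto simp: seq_def)
  note S = Tri_simps[OF h]
  obtain x where x: "x \<in> Arr C" "Dom C x = ShO C 1 (Dom C f)" "Cod C x = T" "x \<cdot> h = v"
    using colift[OF seq_next(2)[OF h], of v] assms S by auto
  then have x0: "x = Zero C (ShO C 1 (Dom C f)) T" using assms(2) by (intro orthD) auto
  have "T \<in> Obj C" using x by auto
  then show ?thesis using S x(4) unfolding x0 by auto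
qed

lemma lift_unique_eq:
  assumes "seq f g" "orth T (ShO C (-1) (Cod C g))" "v \<in> Arr C" "Dom C v = T" "Cod C v = Dom C f"
    "v' \<in> Arr C" "Dom C v' = T" "Cod C v' = Dom C f" "f \<cdot> v = f \<cdot> v'"
  shows "v = v'"
proof (rule eq_if_diff_Zero)
  note S = seq_simps[OF assms(1)]
  have "f \<cdot> Plus C v (Neg C v') = Zero C T (Cod C f)"
    using assms S by (simp add: comp_Plus comp_Neg)
  then show "Plus C v (Neg C v') = Zero C (Dom C v) (Cod C v)"
    using lift_unique[OF assms(1,2), of "Plus C v (Neg C v')"] assms by simp
qed (use assms in auto)

lemma colift_unique_eq:
  assumes "seq f g" "orth (ShO C 1 (Dom C f)) T" "v \<in> Arr C" "Dom C v = Cod C g" "Cod C v = T"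
    "v' \<in> Arr C" "Dom C v' = Cod C g" "Cod C v' = T" "v \<cdot> g = v' \<cdot> g"
  shows "v = v'"
proof (rule eq_if_diff_Zero)
  note S = seq_simps[OF assms(1)]
  have "Plus C v (Neg C v') \<cdot> g = Zero C (Cod C f) T"
    using assms S by (simp add: Plus_comp Neg_comp)
  then show "Plus C v (Neg C v') = Zero C (Dom C v) (Cod C v)"
    using colift_unique[OF assms(1,2), of "Plus C v (Neg C v')"] assms by simp
qed (use assms in auto)

section \<open>Extensions as a relation between objects\<close>

definition ext :: "'o \<Rightarrow> 'o \<Rightarrow> 'o \<Rightarrow> bool" where
  "ext X Y Z \<longleftrightarrow> (\<exists>f g. seq f g \<and> Dom C f = X \<and> Cod C f = Y \<and> Cod C g = Z)"

lemma extI: "seq f g \<Longrightarrow> Dom C f = X \<Longrightarrow> Cod C f = Y \<Longrightarrow> Cod C g = Z \<Longrightarrow> ext X Y Z"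
  by (auto simp: ext_def)

lemma ext_Obj:
  assumes "ext X Y Z"
  shows "X \<in> Obj C" "Y \<in> Obj C" "Z \<in> Obj C"
  using assms seq_simps by (auto simp: ext_def)

lemma ext_shift:
  assumes "ext X Y Z"
  shows "ext (ShO C n X) (ShO C n Y) (ShO C n Z)"
proof -
  obtain f g where "seq f g" "Dom C f = X" "Cod C f = Y" "Cod C g = Z"
    using assms by (auto simp: ext_def)
  then show ?thesis using seq_simps[of f g] by (intro extI[OF seq_shift[of f g n]]) auto
qed

lemma ext_rot:
  assumes "ext X Y Z"
  shows "ext Y Z (ShO C 1 X)" "ext (ShO C (-1) Z) X Y"
    "ext Z (ShO C 1 X) (ShO C 1 Y)" "ext (ShO C (-1) Y) (ShO C (-1) Z) X"
proof -
  obtain f g h where h: "(f, g, h) \<in> Tri C" "Dom C f = X" "Cod C f = Y" "Cod C g = Z"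
    using assms by (auto simp: ext_def seq_def)
  note S = Tri_simps[OF h(1)] h
  show "ext Y Z (ShO C 1 X)" using S by (intro extI[OF seq_next(2)[OF h(1)]]) auto
  show "ext (ShO C (-1) Z) X Y" using S by (intro extI[OF seq_next(4)[OF h(1)]]) auto
  show "ext Z (ShO C 1 X) (ShO C 1 Y)" using S by (intro extI[OF seq_next(3)[OF h(1)]]) auto
  show "ext (ShO C (-1) Y) (ShO C (-1) Z) X" using S by (intro extI[OF seq_next(5)[OF h(1)]]) auto
qed

lemma orth_ext:
  assumes "ext X Y Z"
  shows "orth X T \<Longrightarrow> orth Z T \<Longrightarrow> orth Y T" "orth T X \<Longrightarrow> orth T Z \<Longrightarrow> orth T Y"
proof -
  obtain f g where fg: "seq f g" "Dom C f = X" "Cod C f = Y" "Cod C g = Z"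
    using assms by (auto simp: ext_def)
  note S = seq_simps[OF fg(1)]
  show "orth Y T" if o: "orth X T" "orth Z T" unfolding orth_def
  proof (intro ballI impI)
    fix u assume u: "u \<in> Arr C" "Dom C u = Y \<and> Cod C u = T"
    then have "u \<cdot> f = Zero C X T" using o S fg by (intro orthD) auto
    then obtain v where v: "v \<in> Arr C" "Dom C v = Z" "Cod C v = T" "v \<cdot> g = u"
      using colift[OF fg(1), of u] u fg by auto
    then have v0: "v = Zero C Z T" using o by (intro orthD) auto
    have "T \<in> Obj C" using u by auto
    then show "u = Zero C Y T" using S fg v(4) unfolding v0 by auto
  qed
  show "orth T Y" if o: "orth T X" "orth T Z" unfolding orth_def
  proof (intro ballI impI)
    fix u assume u: "u \<in> Arr C" "Dom C u = T \<and> Cod C u = Y"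
    then have "g \<cdot> u = Zero C T Z" using o S fg by (intro orthD) auto
    then obtain v where v: "v \<in> Arr C" "Dom C v = T" "Cod C v = X" "f \<cdot> v = u"
      using lift[OF fg(1), of u] u fg by auto
    then have v0: "v = Zero C T X" using o by (intro orthD) auto
    have "T \<in> Obj C" using u by auto
    then show "u = Zero C T Y" using S fg v(4) unfolding v0 by auto
  qed
qed

definition isomorphic :: "'o \<Rightarrow> 'o \<Rightarrow> bool" where
  "isomorphic X Y \<longleftrightarrow> (\<exists>u v. inverse_pair u v \<and> Dom C u = X \<and> Cod C u = Y)"

lemma isoI: "inverse_pair u v \<Longrightarrow> Dom C u = X \<Longrightarrow> Cod C u = Y \<Longrightarrow> isomorphic X Y"
  by (auto simp: isomorphic_def)

lemma iso_refl: "X \<in> Obj C \<Longrightarrow> isomorphic X X"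
  using isoI[OF inverse_pair_Ident[of X]] by simp

lemma iso_shift: "isomorphic X Y \<Longrightarrow> isomorphic (ShO C n X) (ShO C n Y)"
proof -
  assume "isomorphic X Y"
  then obtain u v where u: "inverse_pair u v" "Dom C u = X" "Cod C u = Y" by (auto simp: isomorphic_def)
  then have "u \<in> Arr C" by (simp add: inverse_pair_def)
  then show ?thesis using u by (intro isoI[OF inverse_pair_shift[OF u(1)]]) simp_all
qed

lemma iso_zero: "is_zero C X \<Longrightarrow> is_zero C Y \<Longrightarrow> isomorphic X Y"
  unfolding isomorphic_def
  by (rule exI[of _ "Zero C X Y"], rule exI[of _ "Zero C Y X"]) (auto simp: is_zero_iff inverse_pair_def)

lemma iso_closed_iff: "iso_closed C D \<longleftrightarrow> (\<forall>X Y. isomorphic X Y \<and> X \<in> D \<longrightarrow> Y \<in> D)"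
  by (auto simp: iso_closed_def is_isomorphism_iff isomorphic_def)

lemma retract_closed_iff: "D \<subseteq> Obj C \<Longrightarrow> retract_closed C D \<longleftrightarrow> (\<forall>X Y. retract X Y \<and> Y \<in> D \<longrightarrow> X \<in> D)"
proof -
  assume D: "D \<subseteq> Obj C"
  show ?thesis
  proof
    assume r: "retract_closed C D"
    show "\<forall>X Y. retract X Y \<and> Y \<in> D \<longrightarrow> X \<in> D"
    proof (intro allI impI)
      fix X Y assume "retract X Y \<and> Y \<in> D"
      then obtain i p where "i \<in> Hom C X Y" "p \<in> Hom C Y X" "p \<cdot> i = Ident C X" "Y \<in> D" "X \<in> Obj C"
        by (auto simp: retract_def)
      then show "X \<in> D" using r unfolding retract_closed_def by blast
    qed
  next
    assume "\<forall>X Y. retract X Y \<and> Y \<in> D \<longrightarrow> X \<in> D"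
    then show "retract_closed C D" unfolding retract_closed_def retract_def by fastforce
  qed
qed

lemma ext_iso:
  assumes "ext X Y Z" "isomorphic X X'" "isomorphic Y Y'" "isomorphic Z Z'"
  shows "ext X' Y' Z'"
proof -
  obtain f g h where h: "(f, g, h) \<in> Tri C" "Dom C f = X" "Cod C f = Y" "Cod C g = Z"
    using assms by (auto simp: ext_def seq_def)
  obtain u u' where u: "inverse_pair u u'" "Dom C u = X" "Cod C u = X'" using assms(2) by (auto simp: isomorphic_def)
  obtain v v' where v: "inverse_pair v v'" "Dom C v = Y" "Cod C v = Y'" using assms(3) by (auto simp: isomorphic_def)
  obtain w w' where w: "inverse_pair w w'" "Dom C w = Z" "Cod C w = Z'" using assms(4) by (auto simp: isomorphic_def)
  have "seq ((v \<cdot> f) \<cdot> u') ((w \<cdot> g) \<cdot> v')"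
    using Tri_transport[OF h(1) u(1) v(1) w(1)] h u v w by (auto simp: seq_def)
  then show ?thesis
    by (rule extI) (use Tri_simps[OF h(1)] h u v w in \<open>auto simp: inverse_pair_def\<close>)
qed

lemma ext_octahedron:
  assumes "ext a X b" "ext X Y c"
  obtains W where "ext a Y W" "ext b W c"
proof -
  obtain f f1 f2 where f: "(f, f1, f2) \<in> Tri C" "Dom C f = a" "Cod C f = X" "Cod C f1 = b"
    using assms by (auto simp: ext_def seq_def)
  obtain g g1 g2 where g: "(g, g1, g2) \<in> Tri C" "Dom C g = X" "Cod C g = Y" "Cod C g1 = c"
    using assms by (auto simp: ext_def seq_def)
  note S = Tri_simps[OF f(1)] Tri_simps[OF g(1)]
  obtain h1 h2 where h: "(g \<cdot> f, h1, h2) \<in> Tri C" using Tri_extend[of "g \<cdot> f"] S f g by auto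
  obtain p q r where "p \<in> Hom C (Cod C f1) (Cod C h1)" "q \<in> Hom C (Cod C h1) (Cod C g1)" "(p, q, r) \<in> Tri C"
    using Tri_octahedron[OF _ f(1) g(1) h] f g by auto
  then have "ext b (Cod C h1) c" using f g by (intro extI[of p q]) (auto simp: seq_def)
  moreover have "ext a Y (Cod C h1)" using f g S h by (intro extI[of "g \<cdot> f" h1]) (auto simp: seq_def)
  ultimately show ?thesis using that by blast
qed

text \<open>The octahedron over the rotated triangles
  \<open>Y \<rightarrow> W \<rightarrow> a[1]\<close> and
  \<open>W \<rightarrow> c \<rightarrow> b[1]\<close> yields an object \<open>D\<close>, and
  \<open>X = D[-1]\<close>.\<close>

lemma ext_octahedron':
  assumes "ext a Y W" "ext b W c"
  obtains X where "ext a X b" "ext X Y c"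
proof -
  obtain D where D: "ext Y c D" "ext (ShO C 1 a) D (ShO C 1 b)"
    using ext_octahedron[OF ext_rot(1)[OF assms(1)] ext_rot(1)[OF assms(2)]] by blast
  have 1: "ext a (ShO C (-1) D) b"
    using ext_shift[OF D(2), of "-1"] ext_Obj[OF assms(1)] ext_Obj[OF assms(2)] by simp
  have 2: "ext (ShO C (-1) D) Y c" using ext_rot(2)[OF D(1)] .
  from that[OF 1 2] show ?thesis .
qed

section \<open>Products of classes and envelopes\<close>

definition star :: "'o set \<Rightarrow> 'o set \<Rightarrow> 'o set" where
  "star D E = {Y. \<exists>X \<in> D. \<exists>Z \<in> E. ext X Y Z}"

lemma star_assoc: "star (star A B) D = star A (star B D)"
proof (intro equalityI subsetI)
  fix Y assume "Y \<in> star (star A B) D"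
  then obtain X a b c where X: "ext a X b" "ext X Y c" "a \<in> A" "b \<in> B" "c \<in> D" by (auto simp: star_def)
  obtain W where "ext a Y W" "ext b W c" by (rule ext_octahedron[OF X(1,2)])
  then show "Y \<in> star A (star B D)" using X(3-5) by (auto simp: star_def)
next
  fix Y assume "Y \<in> star A (star B D)"
  then obtain W a b c where W: "ext a Y W" "ext b W c" "a \<in> A" "b \<in> B" "c \<in> D" by (auto simp: star_def)
  obtain X where "ext a X b" "ext X Y c" by (rule ext_octahedron'[OF W(1,2)])
  then show "Y \<in> star (star A B) D" using W(3-5) by (auto simp: star_def)
qed

lemma star_mono: "A \<subseteq> A' \<Longrightarrow> B \<subseteq> B' \<Longrightarrow> star A B \<subseteq> star A' B'"
  by (auto simp: star_def)

lemma ext_stable_iff: "ext_stable C D \<longleftrightarrow> (\<forall>X Y Z. ext X Y Z \<and> X \<in> D \<and> Z \<in> D \<longrightarrow> Y \<in> D)"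
  unfolding ext_stable_def ext_def seq_def by blast

lemma ext_stableD: "ext_stable C D \<Longrightarrow> ext X Y Z \<Longrightarrow> X \<in> D \<Longrightarrow> Z \<in> D \<Longrightarrow> Y \<in> D"
  unfolding ext_stable_iff by meson

lemma ext_stable_star: "ext_stable C D \<longleftrightarrow> star D D \<subseteq> D"
  by (auto simp: ext_stable_iff star_def)

lemma envelope_induct [consumes 2, case_names base ext]:
  assumes "X \<in> envelope C D" "D \<subseteq> Obj C"
    "\<And>X. X \<in> D \<Longrightarrow> P X" "\<And>X Y Z. ext X Y Z \<Longrightarrow> P X \<Longrightarrow> P Z \<Longrightarrow> P Y"
  shows "P X"
proof -
  have "ext_stable C {X \<in> Obj C. P X}" using assms(4) ext_Obj(2) by (fastforce simp: ext_stable_iff)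
  moreover have "D \<subseteq> {X \<in> Obj C. P X}" using assms(2,3) by auto
  ultimately have "{X \<in> Obj C. P X} \<in> {E. E \<subseteq> Obj C \<and> ext_stable C E \<and> D \<subseteq> E}" by simp
  then have "envelope C D \<subseteq> {X \<in> Obj C. P X}" unfolding envelope_def by (rule Inter_lower)
  then show ?thesis using assms(1) by auto
qed

lemma envelope_base: "D \<subseteq> envelope C D"
  by (auto simp: envelope_def)

lemma envelope_ext:
  assumes "ext X Y Z" "X \<in> envelope C D" "Z \<in> envelope C D"
  shows "Y \<in> envelope C D"
  unfolding envelope_def
proof (rule InterI)
  fix E assume E: "E \<in> {E. E \<subseteq> Obj C \<and> ext_stable C E \<and> D \<subseteq> E}"
  then have "X \<in> E" "Z \<in> E" using assms(2,3) unfolding envelope_def by (meson InterD)+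
  then show "Y \<in> E" using E ext_stableD[OF _ assms(1)] by simp
qed

lemma envelope_star: "star (envelope C D) (envelope C D) \<subseteq> envelope C D"
  using envelope_ext by (auto simp: star_def)

lemma envelope_least: "D \<subseteq> E \<Longrightarrow> E \<subseteq> Obj C \<Longrightarrow> ext_stable C E \<Longrightarrow> envelope C D \<subseteq> E"
  unfolding envelope_def by (rule Inter_lower) simp

lemma envelope_Obj: "D \<subseteq> Obj C \<Longrightarrow> envelope C D \<subseteq> Obj C"
  by (rule envelope_least) (use ext_Obj(2) in \<open>auto simp: ext_stable_iff\<close>)

lemma envelope_mono: "D \<subseteq> E \<Longrightarrow> envelope C D \<subseteq> envelope C E"
  unfolding envelope_def by (rule Inter_anti_mono) auto

lemma seq_Ident:
  assumes "X \<in> Obj C" "is_zero C Z"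
  shows "seq (Ident C X) (Zero C X Z)" "seq (Zero C Z X) (Ident C X)"
proof -
  have Z: "Z \<in> Obj C" "is_zero C (ShO C 1 Z)" using assms by (auto simp: is_zero_iff simp flip: ShM_Ident)
  note R = Tri_Id[OF assms(1) Z(2)]
  show "seq (Ident C X) (Zero C X Z)" using Tri_Id[OF assms] by (auto simp: seq_def)
  show "seq (Zero C Z X) (Ident C X)" using seq_next(4)[OF R] Z assms by simp
qed

lemma ext_zero:
  assumes "X \<in> Obj C" "is_zero C Z"
  shows "ext X X Z" "ext Z X X"
  using extI[OF seq_Ident(1)[OF assms]] extI[OF seq_Ident(2)[OF assms]] assms
  by (simp_all add: is_zero_iff)

lemma ext_of_iso:
  assumes "isomorphic X Y" "is_zero C Z"
  shows "ext X Y Z"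
proof -
  have o: "X \<in> Obj C" "Z \<in> Obj C" using assms by (auto simp: isomorphic_def inverse_pair_def is_zero_iff)
  show ?thesis using ext_iso[OF ext_zero(1)[OF o(1) assms(2)] iso_refl[OF o(1)] assms(1) iso_refl[OF o(2)]] .
qed

text \<open>Closure under isomorphism is not built into envelopes, and the generating classes are
  not assumed to have it. It follows once \<open>D\<close> contains a zero object, since an
  isomorphism is an extension by zero.\<close>

lemma envelope_iso:
  assumes "X \<in> envelope C D" "isomorphic X Y" "D \<subseteq> Obj C" "\<exists>Z \<in> D. is_zero C Z"
  shows "Y \<in> envelope C D"
proof -
  obtain Z where Z: "Z \<in> D" "is_zero C Z" using assms(4) by blast
  then have "Z \<in> envelope C D" using envelope_base by blast
  then show ?thesis by (rule envelope_ext[OF ext_of_iso[OF assms(2) Z(2)] assms(1)])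
qed

text \<open>Some triangle \<open>(x, q, y)\<close> ends in \<open>q\<close>. As \<open>q\<close> has
  the section \<open>j\<close>, the connecting map \<open>y\<close> is zero, so \<open>x\<close>
  cancels on the left. Now \<open>x\<close> and \<open>i\<close> factor through each other, and the
  resulting isomorphism carries the triangle over to \<open>i\<close>.\<close>

lemma biproduct_data_seq:
  assumes "biproduct_data X Y S i j p q"
  shows "seq i q"
proof -
  have ar: "i \<in> Arr C" "j \<in> Arr C" "p \<in> Arr C" "q \<in> Arr C" "Dom C i = X" "Cod C i = S" "Dom C j = Y"
    "Cod C j = S" "Dom C p = S" "Cod C p = X" "Dom C q = S" "Cod C q = Y"
    and id: "Plus C (i \<cdot> p) (j \<cdot> q) = Ident C S" "p \<cdot> i = Ident C X" "q \<cdot> j = Ident C Y"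
    "q \<cdot> i = Zero C X Y" "p \<cdot> j = Zero C Y X"
    using assms by (auto simp: biproduct_data_def)
  obtain y0 z0 where "(q, y0, z0) \<in> Tri C" using Tri_extend[OF ar(4)] by blast
  from Tri_rot_inv[OF this] obtain x y where T: "(x, q, y) \<in> Tri C" by blast
  note S = Tri_simps[OF T]
  have o: "X \<in> Obj C" "Y \<in> Obj C" "S \<in> Obj C" using ar by auto
  have "y \<cdot> q = Zero C S (ShO C 1 (Dom C x))" using seq_comp[OF seq_next(2)[OF T]] ar S by simp
  then have "(y \<cdot> q) \<cdot> j = Zero C Y (ShO C 1 (Dom C x))" using S ar by simp
  then have y0: "y = Zero C Y (ShO C 1 (Dom C x))" using S ar id by (simp add: comp_assoc)
  have mono: "z = Zero C (Dom C z) (Dom C x)"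
    if z: "z \<in> Arr C" "Cod C z = Dom C x" "x \<cdot> z = Zero C (Dom C z) S" for z
  proof -
    obtain v where "v \<in> Arr C" "Dom C v = Dom C z" "Cod C v = ShO C (-1) Y" "ShM C (-1) y \<cdot> v = z"
      using lift[OF seq_next(4)[OF T], of z] z S ar by auto
    then show ?thesis unfolding y0 using S ar o by auto
  qed
  obtain c where c: "c \<in> Arr C" "Dom C c = X" "Cod C c = Dom C x" "x \<cdot> c = i"
    using lift[OF seqI[OF T], of i] id ar S by auto
  have qx: "q \<cdot> x = Zero C (Dom C x) Y" using seq_comp[OF seqI[OF T]] ar by simp
  have x: "x = i \<cdot> (p \<cdot> x)"
  proof -
    have "x = Plus C (i \<cdot> p) (j \<cdot> q) \<cdot> x" using id S ar by simp
    also have "\<dots> = Plus C (i \<cdot> (p \<cdot> x)) (j \<cdot> (q \<cdot> x))" using S ar by (simp add: Plus_comp comp_assoc)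
    also have "\<dots> = i \<cdot> (p \<cdot> x)" unfolding qx using S ar by simp
    finally show ?thesis .
  qed
  have 1: "(p \<cdot> x) \<cdot> c = Ident C X" using c S ar id by (simp add: comp_assoc)
  have 2: "c \<cdot> (p \<cdot> x) = Ident C (Dom C x)"
  proof (rule eq_if_diff_Zero)
    have "x \<cdot> (c \<cdot> (p \<cdot> x)) = x" using x c S ar by (simp flip: comp_assoc)
    then have "x \<cdot> Plus C (c \<cdot> (p \<cdot> x)) (Neg C (Ident C (Dom C x))) = Zero C (Dom C x) S"
      using S ar c by (simp add: comp_Plus comp_Neg)
    then show "Plus C (c \<cdot> (p \<cdot> x)) (Neg C (Ident C (Dom C x))) =
        Zero C (Dom C (c \<cdot> (p \<cdot> x))) (Cod C (c \<cdot> (p \<cdot> x)))"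
      using S ar c mono[of "Plus C (c \<cdot> (p \<cdot> x)) (Neg C (Ident C (Dom C x)))"] by simp
  qed (use S ar c in auto)
  have inv: "inverse_pair (p \<cdot> x) c" using 1 2 c S ar by (auto simp: inverse_pair_def)
  have "x \<cdot> c = i" by (rule c)
  then have "(i, q, ShM C 1 (p \<cdot> x) \<cdot> y) \<in> Tri C"
    using Tri_transport[OF T inv inverse_pair_Ident[OF o(3)] inverse_pair_Ident[OF o(2)]] S ar o by simp
  then show ?thesis by (rule seqI)
qed

lemma seq_split_section:
  assumes "seq f g" "s \<in> Arr C" "Dom C s = Cod C g" "Cod C s = Cod C f" "g \<cdot> s = Ident C (Cod C g)"
    "\<And>z. z \<in> Arr C \<Longrightarrow> Cod C z = Dom C f \<Longrightarrow> f \<cdot> z = Zero C (Dom C z) (Cod C f) \<Longrightarrow> z = Zero C (Dom C z) (Dom C f)"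
  obtains r where "biproduct_data (Dom C f) (Cod C g) (Cod C f) f s r g"
proof -
  note S = seq_simps[OF assms(1)]
  let ?e = "Plus C (Ident C (Cod C f)) (Neg C (s \<cdot> g))"
  have gf: "g \<cdot> f = Zero C (Dom C f) (Cod C g)" by (rule seq_comp[OF assms(1)])
  have "g \<cdot> ?e = Plus C g (Neg C ((g \<cdot> s) \<cdot> g))"
    using S assms(2-4) by (simp add: comp_Plus comp_Neg comp_assoc)
  also have "\<dots> = Zero C (Cod C f) (Cod C g)" using S unfolding assms(5) by simp
  finally obtain r where r: "r \<in> Arr C" "Dom C r = Cod C f" "Cod C r = Dom C f" "f \<cdot> r = ?e"
    using lift[OF assms(1), of ?e] S assms by auto
  have "biproduct_data (Dom C f) (Cod C g) (Cod C f) f s r g"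
    by (rule split_biproduct_data) (use S assms(2-6) r gf in auto)
  then show ?thesis by (rule that)
qed

text \<open>Orthogonality kills the connecting map. Then the identity of \<open>Cod g\<close> lifts
  to a section, and \<open>f\<close> cancels on the left because anything it kills factors through
  the shifted connecting map.\<close>

lemma seq_split:
  assumes "seq f g" "orth (Cod C g) (ShO C 1 (Dom C f))"
  obtains r s where "biproduct_data (Dom C f) (Cod C g) (Cod C f) f s r g"
proof -
  obtain h where h: "(f, g, h) \<in> Tri C" using assms by (auto simp: seq_def)
  note S = Tri_simps[OF h]
  have h0: "h = Zero C (Cod C g) (ShO C 1 (Dom C f))" using assms S by (intro orthD) auto
  obtain s where s: "s \<in> Arr C" "Dom C s = Cod C g" "Cod C s = Cod C f" "g \<cdot> s = Ident C (Cod C g)"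
    using lift[OF seq_next(2)[OF h], of "Ident C (Cod C g)"] S h0 by auto
  have mono: "z = Zero C (Dom C z) (Dom C f)"
    if z: "z \<in> Arr C" "Cod C z = Dom C f" "f \<cdot> z = Zero C (Dom C z) (Cod C f)" for z
  proof -
    obtain v where "v \<in> Arr C" "Dom C v = Dom C z" "Cod C v = ShO C (-1) (Cod C g)" "ShM C (-1) h \<cdot> v = z"
      using lift[OF seq_next(4)[OF h], of z] z S by auto
    then show ?thesis unfolding h0 using S by auto
  qed
  obtain r where "biproduct_data (Dom C f) (Cod C g) (Cod C f) f s r g"
    using seq_split_section[OF assms(1) s mono] by blast
  then show ?thesis by (rule that)
qed

lemma biproduct_data_retract:
  assumes "biproduct_data X Y S i j p q"
  shows "retract X S" "retract Y S"
  using assms by (auto simp: biproduct_data_def retract_def)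

text \<open>The elementary move behind all sorting: a split triangle may be read with its outer
  terms exchanged.\<close>

lemma ext_split_swap:
  assumes "ext X Y Z" "orth Z (ShO C 1 X)"
  shows "ext Z Y X"
proof -
  obtain f g where fg: "seq f g" "Dom C f = X" "Cod C f = Y" "Cod C g = Z"
    using assms by (auto simp: ext_def)
  obtain r s where b: "biproduct_data X Z Y f s r g" using seq_split[OF fg(1)] fg assms by metis
  from biproduct_data_seq[OF biproduct_data_swap[OF b]] show ?thesis
    using b by (intro extI[of s r]) (auto simp: biproduct_data_def)
qed

end

section \<open>Torsion pairs\<close>

context triangulated_category
begin

lemma shift_class_iff:
  "D \<subseteq> Obj C \<Longrightarrow> X \<in> shift_class C D n \<longleftrightarrow> X \<in> Obj C \<and> ShO C (-n) X \<in> D"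
  unfolding shift_class_def by (auto simp: subset_iff image_iff intro!: bexI[of _ "ShO C (-n) X"])

lemma shift_class_Obj: "D \<subseteq> Obj C \<Longrightarrow> shift_class C D n \<subseteq> Obj C"
  by (auto simp: shift_class_iff)

lemma retract_shift: "retract X Y \<Longrightarrow> retract (ShO C k X) (ShO C k Y)"
  unfolding retract_def
proof (elim exE conjE)
  fix i q assume "i \<in> Arr C" "q \<in> Arr C" "Dom C i = X" "Cod C i = Y" "Dom C q = Y" "Cod C q = X" "q \<cdot> i = Ident C X"
  then show "\<exists>i p. i \<in> Arr C \<and> p \<in> Arr C \<and> Dom C i = ShO C k X \<and> Cod C i = ShO C k Y \<and>
      Dom C p = ShO C k Y \<and> Cod C p = ShO C k X \<and> p \<cdot> i = Ident C (ShO C k X)"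
    by (intro exI[of _ "ShM C k i"] exI[of _ "ShM C k q"]) (auto simp flip: ShM_comp)
qed

text \<open>Each class is required to be the full orthogonal of the other. Membership can then be
  tested by \<open>orth\<close>, and closure under extensions, retracts and biproducts comes for
  free.\<close>

definition torsion_pair :: "'o set \<Rightarrow> 'o set \<Rightarrow> bool" where
  "torsion_pair D E \<longleftrightarrow> D = {X \<in> Obj C. \<forall>Y \<in> E. orth X Y} \<and> E = {Y \<in> Obj C. \<forall>X \<in> D. orth X Y} \<and>
     (\<forall>X \<in> Obj C. \<exists>a b. seq a b \<and> Cod C a = X \<and> Dom C a \<in> D \<and> Cod C b \<in> E)"

lemma torsion_pairD:
  assumes "torsion_pair D E"
  shows "X \<in> D \<longleftrightarrow> X \<in> Obj C \<and> (\<forall>Y \<in> E. orth X Y)" "X \<in> E \<longleftrightarrow> X \<in> Obj C \<and> (\<forall>Y \<in> D. orth Y X)"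
    "X \<in> Obj C \<Longrightarrow> \<exists>a b. seq a b \<and> Cod C a = X \<and> Dom C a \<in> D \<and> Cod C b \<in> E"
proof -
  note tp = assms[unfolded torsion_pair_def]
  show "X \<in> D \<longleftrightarrow> X \<in> Obj C \<and> (\<forall>Y \<in> E. orth X Y)" by (subst tp[THEN conjunct1]) simp
  show "X \<in> E \<longleftrightarrow> X \<in> Obj C \<and> (\<forall>Y \<in> D. orth Y X)" by (subst tp[THEN conjunct2, THEN conjunct1]) simp
  show "\<exists>a b. seq a b \<and> Cod C a = X \<and> Dom C a \<in> D \<and> Cod C b \<in> E" if "X \<in> Obj C"
    by (rule tp[THEN conjunct2, THEN conjunct2, THEN bspec, OF that])
qed

text \<open>If \<open>b\<close> vanishes, the identity lifts through \<open>a\<close>. This is the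
  standard way below to place an object in a class closed under retracts.\<close>

lemma retract_trans_zero_right:
  assumes "seq a b" "b = Zero C (Cod C a) (Cod C b)"
  shows "retract (Cod C a) (Dom C a)"
proof -
  note S = seq_simps[OF assms(1)]
  have "b \<cdot> Ident C (Cod C a) = Zero C (Cod C a) (Cod C b)" using S assms(2) by simp
  then obtain s where "s \<in> Arr C" "Dom C s = Cod C a" "Cod C s = Dom C a" "a \<cdot> s = Ident C (Cod C a)"
    using lift[OF assms(1), of "Ident C (Cod C a)"] S by auto
  then show ?thesis using S unfolding retract_def by blast
qed

lemma retract_trans_zero_left:
  assumes "seq a b" "a = Zero C (Dom C a) (Cod C a)"
  shows "retract (Cod C a) (Cod C b)"
proof -
  note S = seq_simps[OF assms(1)]
  have "Ident C (Cod C a) \<cdot> a = Zero C (Dom C a) (Cod C a)" using S assms(2) by simp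
  then obtain s where "s \<in> Arr C" "Dom C s = Cod C b" "Cod C s = Cod C a" "s \<cdot> b = Ident C (Cod C a)"
    using colift[OF assms(1), of "Ident C (Cod C a)"] S by auto
  then show ?thesis using S unfolding retract_def by (intro exI[of _ b] exI[of _ s]) simp
qed

text \<open>An object orthogonal to \<open>E\<close> has zero map to the right term of its
  decomposition, hence is a retract of the left term; dually for \<open>E\<close>.\<close>

lemma torsion_pair_retractI:
  assumes D: "D \<subseteq> Obj C" "\<And>X Y. retract X Y \<Longrightarrow> Y \<in> D \<Longrightarrow> X \<in> D"
    and E: "E \<subseteq> Obj C" "\<And>X Y. retract X Y \<Longrightarrow> Y \<in> E \<Longrightarrow> X \<in> E"
    and DE: "\<And>X Y. X \<in> D \<Longrightarrow> Y \<in> E \<Longrightarrow> orth X Y"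
    and dec: "\<And>X. X \<in> Obj C \<Longrightarrow> \<exists>a b. seq a b \<and> Cod C a = X \<and> Dom C a \<in> D \<and> Cod C b \<in> E"
  shows "torsion_pair D E"
proof -
  have 1: "X \<in> D" if X: "X \<in> Obj C" "\<forall>Y \<in> E. orth X Y" for X
  proof -
    obtain a b where ab: "seq a b" "Cod C a = X" "Dom C a \<in> D" "Cod C b \<in> E" using dec X by blast
    have "b = Zero C (Cod C a) (Cod C b)" using ab X(2) seq_simps[OF ab(1)] by (intro orthD) auto
    from retract_trans_zero_right[OF ab(1) this] show ?thesis using ab D(2) by blast
  qed
  have 2: "X \<in> E" if X: "X \<in> Obj C" "\<forall>Y \<in> D. orth Y X" for X
  proof -
    obtain a b where ab: "seq a b" "Cod C a = X" "Dom C a \<in> D" "Cod C b \<in> E" using dec X by blast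
    have "a = Zero C (Dom C a) (Cod C a)" using ab X(2) seq_simps[OF ab(1)] by (intro orthD) auto
    from retract_trans_zero_left[OF ab(1) this] show ?thesis using ab E(2) by blast
  qed
  show ?thesis unfolding torsion_pair_def
  proof (intro conjI equalityI subsetI ballI dec)
    show "X \<in> {X \<in> Obj C. \<forall>Y \<in> E. orth X Y}" if "X \<in> D" for X using that D(1) DE by auto
    show "X \<in> {X \<in> Obj C. \<forall>Y \<in> D. orth Y X}" if "X \<in> E" for X using that E(1) DE by auto
  qed (use 1 2 in blast)+
qed

text \<open>If \<open>D \<perp> E\<close> is also orthogonal after shifting \<open>D\<close> by one, closure under isomorphism suffices: the
  error term of a truncation then vanishes.\<close>

lemma torsion_pair_isoI:
  assumes D: "D \<subseteq> Obj C" "\<And>X Y. isomorphic X Y \<Longrightarrow> X \<in> D \<Longrightarrow> Y \<in> D"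
    and E: "E \<subseteq> Obj C" "\<And>X Y. isomorphic X Y \<Longrightarrow> X \<in> E \<Longrightarrow> Y \<in> E"
    and DE: "\<And>X Y. X \<in> D \<Longrightarrow> Y \<in> E \<Longrightarrow> orth X Y" "\<And>X Y. X \<in> D \<Longrightarrow> Y \<in> E \<Longrightarrow> orth (ShO C 1 X) Y"
    and dec: "\<And>X. X \<in> Obj C \<Longrightarrow> \<exists>a b. seq a b \<and> Cod C a = X \<and> Dom C a \<in> D \<and> Cod C b \<in> E"
  shows "torsion_pair D E"
proof -
  have 1: "X \<in> D" if X: "X \<in> Obj C" "\<forall>Y \<in> E. orth X Y" for X
  proof -
    obtain a b where ab: "seq a b" "Cod C a = X" "Dom C a \<in> D" "Cod C b \<in> E" using dec X by blast
    note S = seq_simps[OF ab(1)]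
    have b: "b = Zero C X (Cod C b)" using ab X(2) S by (intro orthD) auto
    have "Ident C (Cod C b) = Zero C (Cod C b) (Cod C b)"
      by (rule colift_unique[OF ab(1) DE(2)]) (use ab S X in \<open>auto, metis b\<close>)
    then have Z: "is_zero C (Cod C b)" using S by (simp add: is_zero_iff)
    have "b \<cdot> Ident C X = Zero C X (Cod C b)" using S ab b by simp
    then obtain s where s: "s \<in> Arr C" "Dom C s = X" "Cod C s = Dom C a" "a \<cdot> s = Ident C X"
      using lift[OF ab(1), of "Ident C X"] S X ab by auto
    have "s \<cdot> a = Ident C (Dom C a)"
    proof (rule lift_unique_eq[OF ab(1)])
      have "is_zero C (ShO C (-1) (Cod C b))" using Z by (auto simp: is_zero_iff simp flip: ShM_Ident)
      then show "orth (Dom C a) (ShO C (-1) (Cod C b))" by (rule orth_zero)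
    qed (use S s ab X in \<open>auto simp flip: comp_assoc\<close>)
    then have "isomorphic (Dom C a) X" using s S ab by (intro isoI[of a s]) (auto simp: inverse_pair_def)
    then show ?thesis using ab D(2) by blast
  qed
  have 2: "X \<in> E" if X: "X \<in> Obj C" "\<forall>Y \<in> D. orth Y X" for X
  proof -
    obtain a b where ab: "seq a b" "Cod C a = X" "Dom C a \<in> D" "Cod C b \<in> E" using dec X by blast
    note S = seq_simps[OF ab(1)]
    have o: "Cod C b \<in> Obj C" "Dom C a \<in> Obj C" using S by auto
    have a: "a = Zero C (Dom C a) X" using ab X(2) S by (intro orthD) auto
    have "orth (Dom C a) (ShO C (-1) (Cod C b))"
      using DE(2)[OF ab(3,4)] orth_shift_iff[OF o(2,1), of 1] by simp
    then have "Ident C (Dom C a) = Zero C (Dom C a) (Dom C a)"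
      by (rule lift_unique[OF ab(1)]) (use ab S X in \<open>auto, metis a\<close>)
    then have Z: "is_zero C (Dom C a)" using S by (simp add: is_zero_iff)
    have "Ident C X \<cdot> a = Zero C (Dom C a) X" using S ab a by simp
    then obtain s where s: "s \<in> Arr C" "Dom C s = Cod C b" "Cod C s = X" "s \<cdot> b = Ident C X"
      using colift[OF ab(1), of "Ident C X"] S X ab by auto
    have "b \<cdot> s = Ident C (Cod C b)"
    proof (rule colift_unique_eq[OF ab(1)])
      have "is_zero C (ShO C 1 (Dom C a))" using Z by (auto simp: is_zero_iff simp flip: ShM_Ident)
      then show "orth (ShO C 1 (Dom C a)) (Cod C b)" by (rule orth_zero)
    qed (use S s ab X in \<open>auto simp: comp_assoc\<close>)
    then have "isomorphic (Cod C b) X" using s S ab by (intro isoI[of s b]) (auto simp: inverse_pair_def)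
    then show ?thesis using ab E(2) by blast
  qed
  show ?thesis unfolding torsion_pair_def
  proof (intro conjI equalityI subsetI ballI dec)
    show "X \<in> {X \<in> Obj C. \<forall>Y \<in> E. orth X Y}" if "X \<in> D" for X using that D(1) DE by auto
    show "X \<in> {X \<in> Obj C. \<forall>Y \<in> D. orth Y X}" if "X \<in> E" for X using that E(1) DE by auto
  qed (use 1 2 in blast)+
qed

lemma torsion_pair_shift:
  assumes "torsion_pair D E"
  shows "torsion_pair (shift_class C D n) (shift_class C E n)"
proof -
  note TP = torsion_pairD[OF assms]
  have o: "D \<subseteq> Obj C" "E \<subseteq> Obj C" using TP(1,2) by auto
  have rO: "X \<in> Obj C" if "retract X Y" for X Y using that by (auto simp: retract_def)
  have rD: "X \<in> D" if "retract X Y" "Y \<in> D" for X Y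
    using that TP(1) rO orth_retract_left by meson
  have rE: "X \<in> E" if "retract X Y" "Y \<in> E" for X Y
    using that TP(2) rO orth_retract_right by meson
  show ?thesis
  proof (rule torsion_pair_retractI)
    show "shift_class C D n \<subseteq> Obj C" "shift_class C E n \<subseteq> Obj C" using o shift_class_Obj by auto
    show "X \<in> shift_class C D n" if "retract X Y" "Y \<in> shift_class C D n" for X Y
      using that rD[OF retract_shift] rO o by (simp add: shift_class_iff)
    show "X \<in> shift_class C E n" if "retract X Y" "Y \<in> shift_class C E n" for X Y
      using that rE[OF retract_shift] rO o by (simp add: shift_class_iff)
    show "orth X Y" if "X \<in> shift_class C D n" "Y \<in> shift_class C E n" for X Y
    proof -
      have XY: "X \<in> Obj C" "Y \<in> Obj C" "ShO C (-n) X \<in> D" "ShO C (-n) Y \<in> E"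
        using that o by (simp_all add: shift_class_iff)
      then have "orth (ShO C (-n) X) (ShO C (-n) Y)" using TP(1) by blast
      then show ?thesis using XY orth_shift_iff[of X "ShO C (-n) Y" "-n"] by simp
    qed
    show "\<exists>a b. seq a b \<and> Cod C a = X \<and> Dom C a \<in> shift_class C D n \<and> Cod C b \<in> shift_class C E n"
      if X: "X \<in> Obj C" for X
    proof -
      obtain a b where ab: "seq a b" "Cod C a = ShO C (-n) X" "Dom C a \<in> D" "Cod C b \<in> E"
        using TP(3)[of "ShO C (-n) X"] X by auto
      note S = seq_simps[OF ab(1)]
      show ?thesis using seq_shift[OF ab(1), of n] ab S X o
        by (intro exI[of _ "ShM C n a"] exI[of _ "ShM C n b"]) (simp add: shift_class_iff)
    qed
  qed
qed

text \<open>The common behaviour of t-structures and weight structures, in spite of their opposite shift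
  conventions.\<close>

definition torsion_tower :: "(int \<Rightarrow> 'o set) \<Rightarrow> (int \<Rightarrow> 'o set) \<Rightarrow> bool" where
  "torsion_tower L R \<longleftrightarrow> (\<forall>n. torsion_pair (L n) (R (n + 1)) \<and> L n \<subseteq> L (n + 1) \<and> R (n + 1) \<subseteq> R n)"

lemma torsion_tower_Obj:
  assumes "torsion_tower L R"
  shows "L n \<subseteq> Obj C" "R n \<subseteq> Obj C"
proof -
  have "torsion_pair (L n) (R (n + 1))" "torsion_pair (L (n - 1)) (R (n - 1 + 1))"
    using assms by (simp_all only: torsion_tower_def)
  then show "L n \<subseteq> Obj C" "R n \<subseteq> Obj C" using torsion_pairD(1)[of "L n"] torsion_pairD(2)[of _ "R n"] by auto
qed

lemma torsion_tower_iff: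
  assumes "torsion_tower L R"
  shows "X \<in> L n \<longleftrightarrow> X \<in> Obj C \<and> (\<forall>Y \<in> R (n + 1). orth X Y)"
    "X \<in> R n \<longleftrightarrow> X \<in> Obj C \<and> (\<forall>Y \<in> L (n - 1). orth Y X)"
proof -
  have "torsion_pair (L n) (R (n + 1))" "torsion_pair (L (n - 1)) (R (n - 1 + 1))"
    using assms by (simp_all only: torsion_tower_def)
  then show "X \<in> L n \<longleftrightarrow> X \<in> Obj C \<and> (\<forall>Y \<in> R (n + 1). orth X Y)"
    "X \<in> R n \<longleftrightarrow> X \<in> Obj C \<and> (\<forall>Y \<in> L (n - 1). orth Y X)"
    using torsion_pairD(1)[of "L n" "R (n + 1)" X] torsion_pairD(2)[of "L (n - 1)" "R n" X] by simp_all
qed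

lemma torsion_tower_dec:
  assumes "torsion_tower L R" "X \<in> Obj C"
  obtains a b where "seq a b" "Cod C a = X" "Dom C a \<in> L n" "Cod C b \<in> R (n + 1)"
proof -
  have "torsion_pair (L n) (R (n + 1))" using assms by (simp only: torsion_tower_def)
  from torsion_pairD(3)[OF this assms(2)] show ?thesis using that by blast
qed

lemma torsion_tower_mono:
  assumes "torsion_tower L R" "m \<le> n"
  shows "L m \<subseteq> L n" "R n \<subseteq> R m"
proof -
  have s: "L n \<subseteq> L (n + 1)" "R (n + 1) \<subseteq> R n" for n using assms by (simp_all only: torsion_tower_def)
  from assms(2) have "L m \<subseteq> L n \<and> R n \<subseteq> R m"
    by (induction n rule: int_ge_induct) (use s in blast)+
  then show "L m \<subseteq> L n" "R n \<subseteq> R m" by auto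
qed

lemma torsion_tower_orth:
  assumes "torsion_tower L R" "X \<in> L m" "Y \<in> R n" "m < n"
  shows "orth X Y"
proof -
  have "Y \<in> R (m + 1)" using torsion_tower_mono(2)[OF assms(1), of "m + 1" n] assms by auto
  then show ?thesis using torsion_tower_iff(1)[OF assms(1)] assms(2) by blast
qed

lemma torsion_tower_ext:
  assumes "torsion_tower L R" "ext X Y Z"
  shows "X \<in> L n \<Longrightarrow> Z \<in> L n \<Longrightarrow> Y \<in> L n" "X \<in> R n \<Longrightarrow> Z \<in> R n \<Longrightarrow> Y \<in> R n"
  using orth_ext[OF assms(2)] ext_Obj[OF assms(2)] unfolding torsion_tower_iff[OF assms(1)] by blast+

lemma torsion_tower_retract:
  assumes "torsion_tower L R" "retract X Y"
  shows "Y \<in> L n \<Longrightarrow> X \<in> L n" "Y \<in> R n \<Longrightarrow> X \<in> R n"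
proof -
  have "X \<in> Obj C" using assms(2) by (auto simp: retract_def)
  then show "Y \<in> L n \<Longrightarrow> X \<in> L n" "Y \<in> R n \<Longrightarrow> X \<in> R n"
    using orth_retract_left[OF _ assms(2)] orth_retract_right[OF _ assms(2)]
    unfolding torsion_tower_iff[OF assms(1)] by blast+
qed

lemma torsion_tower_biproduct:
  assumes "torsion_tower L R" "biproduct_data X Y S i j p q"
  shows "X \<in> L n \<Longrightarrow> Y \<in> L n \<Longrightarrow> S \<in> L n" "X \<in> R n \<Longrightarrow> Y \<in> R n \<Longrightarrow> S \<in> R n"
proof -
  have "S \<in> Obj C" using assms(2) by (auto simp: biproduct_data_def)
  then show "X \<in> L n \<Longrightarrow> Y \<in> L n \<Longrightarrow> S \<in> L n" "X \<in> R n \<Longrightarrow> Y \<in> R n \<Longrightarrow> S \<in> R n"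
    using orth_biproduct[OF assms(2)] unfolding torsion_tower_iff[OF assms(1)] by blast+
qed

lemma torsion_tower_zero:
  assumes "torsion_tower L R" "is_zero C Z"
  shows "Z \<in> L n" "Z \<in> R n"
  using orth_zero[OF assms(2)] assms(2) unfolding torsion_tower_iff[OF assms(1)]
  by (auto simp: is_zero_iff)

section \<open>t-structures and weight structures as torsion towers\<close>

lemma tle_iff: "t_structure C t \<Longrightarrow> X \<in> tle C t n \<longleftrightarrow> X \<in> Obj C \<and> ShO C n X \<in> fst t"
  and tge_iff: "t_structure C t \<Longrightarrow> X \<in> tge C t n \<longleftrightarrow> X \<in> Obj C \<and> ShO C n X \<in> snd t"
  by (simp_all add: tle_def tge_def t_structure_def shift_class_iff)

lemma wle_iff: "weight_structure C w \<Longrightarrow> X \<in> wle C w n \<longleftrightarrow> X \<in> Obj C \<and> ShO C (-n) X \<in> fst w"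
  and wge_iff: "weight_structure C w \<Longrightarrow> X \<in> wge C w n \<longleftrightarrow> X \<in> Obj C \<and> ShO C (-n) X \<in> snd w"
  by (simp_all add: wle_def wge_def weight_structure_def shift_class_iff)

lemma shift_class_add:
  assumes "D \<subseteq> Obj C" "m + n = k"
  shows "shift_class C (shift_class C D m) n = shift_class C D k"
  using assms(1) shift_class_Obj[OF assms(1), of m]
  by (auto simp: shift_class_iff assms(2)[symmetric] add.commute)

lemma shift_class_0: "D \<subseteq> Obj C \<Longrightarrow> shift_class C D 0 = D"
  by (force simp: shift_class_iff)

lemma shift_class_mono: "D \<subseteq> E \<Longrightarrow> shift_class C D n \<subseteq> shift_class C E n"
  by (auto simp: shift_class_def)

text \<open>For \<open>t\<close> closure under isomorphism is given, so
  \<open>torsion_pair_isoI\<close> applies; its second orthogonality condition comes from the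
  stability of the left class under [1].\<close>

lemma t_tower:
  assumes "t_structure C t"
  shows "torsion_tower (tle C t) (tge C t)"
proof -
  have o: "fst t \<subseteq> Obj C" "snd t \<subseteq> Obj C" using assms by (simp_all add: t_structure_def)
  have st: "tle C t 0 = fst t" "tle C t 1 = shift_class C (fst t) (-1)" "tge C t 0 = snd t"
    "tge C t 1 = shift_class C (snd t) (-1)"
    using o by (simp_all add: tle_def tge_def shift_class_0)
  have c: "isomorphic X Y \<Longrightarrow> X \<in> fst t \<Longrightarrow> Y \<in> fst t" "isomorphic X Y \<Longrightarrow> X \<in> snd t \<Longrightarrow> Y \<in> snd t" for X Y
    using assms by (auto simp: t_structure_def iso_closed_iff)
  have isoO: "isomorphic X Y \<Longrightarrow> Y \<in> Obj C" for X Y by (auto simp: isomorphic_def inverse_pair_def)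
  have p: "orth X Y" if "X \<in> fst t" "Y \<in> tge C t 1" for X Y
    using assms that o shift_class_Obj[OF o(2)] by (auto simp: t_structure_def st perp_iff)
  have le: "fst t \<subseteq> tle C t 1" "tge C t 1 \<subseteq> snd t" using assms by (simp_all add: t_structure_def st)
  have tp: "torsion_pair (fst t) (tge C t 1)"
  proof (rule torsion_pair_isoI)
    show "fst t \<subseteq> Obj C" "tge C t 1 \<subseteq> Obj C" using o shift_class_Obj by (auto simp: st)
    show "Y \<in> tge C t 1" if "isomorphic X Y" "X \<in> tge C t 1" for X Y
      using that c(2)[OF iso_shift[OF that(1)]] assms isoO by (simp add: tge_iff)
    show "orth (ShO C 1 X) Y" if XY: "X \<in> fst t" "Y \<in> tge C t 1" for X Y
    proof -
      have "ShO C 1 X \<in> fst t" using XY(1) le(1) assms by (auto simp: tle_iff subset_iff)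
      then show ?thesis using p XY(2) by blast
    qed
    show "\<exists>a b. seq a b \<and> Cod C a = X \<and> Dom C a \<in> fst t \<and> Cod C b \<in> tge C t 1" if "X \<in> Obj C" for X
      using assms that by (auto simp: t_structure_def st seq_def)
  qed (use c p in blast)+
  show ?thesis unfolding torsion_tower_def
  proof (intro allI conjI)
    fix n
    show "torsion_pair (tle C t n) (tge C t (n + 1))"
      using torsion_pair_shift[OF tp, of "-n"] shift_class_add[OF o(2), of "-1" "-n" "-(n + 1)"]
      by (simp add: tle_def tge_def)
    show "tle C t n \<subseteq> tle C t (n + 1)"
      using shift_class_mono[OF le(1), of "-n"] shift_class_add[OF o(1), of "-1" "-n" "-(n + 1)"]
      by (simp add: tle_def)
    show "tge C t (n + 1) \<subseteq> tge C t n"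
      using shift_class_mono[OF le(2), of "-n"] shift_class_add[OF o(2), of "-1" "-n" "-(n + 1)"]
      by (simp add: tge_def)
  qed
qed

text \<open>Here stability under [1] points the wrong way for the argument used for t-structures;
  closure under retracts takes its place.\<close>

lemma w_tower:
  assumes "weight_structure C w"
  shows "torsion_tower (wle C w) (wge C w)"
proof -
  have o: "fst w \<subseteq> Obj C" "snd w \<subseteq> Obj C" using assms by (simp_all add: weight_structure_def)
  have st: "wle C w 0 = fst w" "wge C w 0 = snd w"
    "wge C w 1 = shift_class C (snd w) 1"
    using o by (simp_all add: wle_def wge_def shift_class_0)
  have c: "retract X Y \<Longrightarrow> Y \<in> fst w \<Longrightarrow> X \<in> fst w" "retract X Y \<Longrightarrow> Y \<in> snd w \<Longrightarrow> X \<in> snd w" for X Y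
    using assms o by (auto simp: weight_structure_def retract_closed_iff)
  have rO: "X \<in> Obj C" if "retract X Y" for X Y using that by (auto simp: retract_def)
  have p: "orth X Y" if "X \<in> fst w" "Y \<in> wge C w 1" for X Y
    using assms that o shift_class_Obj[OF o(2)] by (auto simp: weight_structure_def st perp_iff)
  have le: "fst w \<subseteq> wle C w 1" "wge C w 1 \<subseteq> snd w" using assms by (simp_all add: weight_structure_def st)
  have tp: "torsion_pair (fst w) (wge C w 1)"
  proof (rule torsion_pair_retractI)
    show "fst w \<subseteq> Obj C" "wge C w 1 \<subseteq> Obj C" using o shift_class_Obj by (auto simp: st)
    show "X \<in> wge C w 1" if "retract X Y" "Y \<in> wge C w 1" for X Y
      using that c(2)[OF retract_shift[OF that(1)]] assms rO by (simp add: wge_iff)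
    show "\<exists>a b. seq a b \<and> Cod C a = X \<and> Dom C a \<in> fst w \<and> Cod C b \<in> wge C w 1" if X: "X \<in> Obj C" for X
    proof -
      obtain a b c where "weight_decomp C w 0 X a b c" using assms X unfolding weight_structure_def by meson
      then show ?thesis unfolding weight_decomp_def seq_def st(1) by auto
    qed
  qed (use c p in blast)+
  show ?thesis unfolding torsion_tower_def
  proof (intro allI conjI)
    fix n
    show "torsion_pair (wle C w n) (wge C w (n + 1))"
      using torsion_pair_shift[OF tp, of n] shift_class_add[OF o(2), of 1 n "n + 1"]
      by (simp add: wle_def wge_def)
    show "wle C w n \<subseteq> wle C w (n + 1)"
      using shift_class_mono[OF le(1), of n] shift_class_add[OF o(1), of 1 n "n + 1"]
      by (simp add: wle_def)
    show "wge C w (n + 1) \<subseteq> wge C w n"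
      using shift_class_mono[OF le(2), of n] shift_class_add[OF o(2), of 1 n "n + 1"]
      by (simp add: wge_def)
  qed
qed

end

section \<open>The heart of a t-structure\<close>

context triangulated_category
begin

lemma seq_Neg_left: "seq f g \<Longrightarrow> seq (Neg C f) g"
  using Tri_Neg(3) by (auto simp: seq_def)

lemma ex_seq: "f \<in> Arr C \<Longrightarrow> \<exists>g. seq f g"
  using Tri_extend by (auto simp: seq_def)

lemma seq_ext: "seq f g \<Longrightarrow> ext (Dom C f) (Cod C f) (Cod C g)"
  by (auto intro: extI)

lemma seq_octahedron:
  assumes "(f, f1, f2) \<in> Tri C" "(g, g1, g2) \<in> Tri C" "(g \<cdot> f, h1, h2) \<in> Tri C" "Dom C g = Cod C f"
  obtains a b where "(a, b, ShM C 1 f1 \<cdot> g2) \<in> Tri C" "Dom C a = Cod C f1" "Cod C a = Cod C h1"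
    "Cod C b = Cod C g1" "a \<cdot> f1 = h1 \<cdot> g" "h2 \<cdot> a = f2" "b \<cdot> h1 = g1" "g2 \<cdot> b = ShM C 1 f \<cdot> h2"
  using Tri_octahedron[OF assms(4,1,2,3)] by auto

end

locale t_category = triangulated_category C for C :: "('o, 'm, 'z) tricat_scheme" (structure) +
  fixes t :: "'o set \<times> 'o set"
  assumes t: "t_structure C t"
begin

abbreviation (input) "H \<equiv> heart C t"

lemmas tower = t_tower[OF t]
lemmas t_orth = torsion_tower_orth[OF tower]
lemmas t_dec = torsion_tower_dec[OF tower]

lemma tle_Obj: "X \<in> tle C t n \<Longrightarrow> X \<in> Obj C" and tge_Obj: "X \<in> tge C t n \<Longrightarrow> X \<in> Obj C"
  using torsion_tower_Obj[OF tower] by blast+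

lemma tle_mono: "X \<in> tle C t m \<Longrightarrow> m \<le> n \<Longrightarrow> X \<in> tle C t n"
  and tge_mono: "X \<in> tge C t m \<Longrightarrow> n \<le> m \<Longrightarrow> X \<in> tge C t n"
  using torsion_tower_mono[OF tower] by blast+

lemma tle_shift: "X \<in> Obj C \<Longrightarrow> ShO C k X \<in> tle C t n \<longleftrightarrow> X \<in> tle C t (n + k)"
  and tge_shift: "X \<in> Obj C \<Longrightarrow> ShO C k X \<in> tge C t n \<longleftrightarrow> X \<in> tge C t (n + k)"
  using t by (auto simp: tle_iff tge_iff)

text \<open>The last four rules come from rotation: [1] lowers the cohomological degree by one,
  whence the bounds \<open>n + 1\<close> and \<open>n - 1\<close>.\<close>

lemma t_ext:
  assumes "ext X Y Z"
  shows "X \<in> tle C t n \<Longrightarrow> Z \<in> tle C t n \<Longrightarrow> Y \<in> tle C t n"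
    "X \<in> tge C t n \<Longrightarrow> Z \<in> tge C t n \<Longrightarrow> Y \<in> tge C t n"
    "Y \<in> tle C t n \<Longrightarrow> X \<in> tle C t (n + 1) \<Longrightarrow> Z \<in> tle C t n"
    "Y \<in> tge C t n \<Longrightarrow> X \<in> tge C t (n + 1) \<Longrightarrow> Z \<in> tge C t n"
    "Y \<in> tle C t n \<Longrightarrow> Z \<in> tle C t (n - 1) \<Longrightarrow> X \<in> tle C t n"
    "Y \<in> tge C t n \<Longrightarrow> Z \<in> tge C t (n - 1) \<Longrightarrow> X \<in> tge C t n"
  using torsion_tower_ext[OF tower assms] torsion_tower_ext[OF tower ext_rot(1)[OF assms]]
    torsion_tower_ext[OF tower ext_rot(2)[OF assms]] ext_Obj[OF assms]
  by (simp_all add: tle_shift tge_shift)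

lemma heart_iff: "X \<in> H \<longleftrightarrow> X \<in> tle C t 0 \<and> X \<in> tge C t 0"
  by (simp add: heart_def)

lemma heart_Obj: "X \<in> H \<Longrightarrow> X \<in> Obj C"
  by (auto simp: heart_iff tle_Obj)

lemma heart_sub: "H \<subseteq> Obj C"
  using heart_Obj by blast

lemma heart_tle: "X \<in> H \<Longrightarrow> 0 \<le> n \<Longrightarrow> X \<in> tle C t n"
  and heart_tge: "X \<in> H \<Longrightarrow> n \<le> 0 \<Longrightarrow> X \<in> tge C t n"
  using tle_mono tge_mono by (auto simp: heart_iff)

lemma heart_ext: "ext X Y Z \<Longrightarrow> X \<in> H \<Longrightarrow> Z \<in> H \<Longrightarrow> Y \<in> H"
  using t_ext(1,2) by (auto simp: heart_iff)

lemma heart_retract: "retract X Y \<Longrightarrow> Y \<in> H \<Longrightarrow> X \<in> H"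
  using torsion_tower_retract[OF tower] by (auto simp: heart_iff)

lemma heart_zero: "is_zero C Z \<Longrightarrow> Z \<in> H"
  using torsion_tower_zero[OF tower] by (auto simp: heart_iff)

lemma heart_shift: "X \<in> Obj C \<Longrightarrow> ShO C k X \<in> H \<longleftrightarrow> X \<in> tle C t k \<and> X \<in> tge C t k"
  by (simp add: heart_iff tle_shift tge_shift)

text \<open>The obstruction to cancelling \<open>f\<close> lives in \<open>(Cod g)[-1]\<close>,
  which belongs to \<open>tge C t 1\<close> and receives nothing from
  \<open>tle C t 0\<close>.\<close>

lemma seq_mono_le:
  assumes "seq f g" "Dom C v \<in> tle C t 0" "Cod C g \<in> tge C t 0" "v \<in> Arr C" "Cod C v = Dom C f"
    "f \<cdot> v = Zero C (Dom C v) (Cod C f)"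
  shows "v = Zero C (Dom C v) (Dom C f)"
proof (rule lift_unique[OF assms(1)])
  show "orth (Dom C v) (ShO C (-1) (Cod C g))"
    by (rule t_orth[of _ 0 _ 1]) (use assms(2,3) tge_Obj in \<open>auto simp: tge_shift\<close>)
qed (use assms in auto)

lemma seq_epi_ge:
  assumes "seq f g" "Dom C f \<in> tle C t 0" "Cod C v \<in> tge C t 0" "v \<in> Arr C" "Dom C v = Cod C g"
    "v \<cdot> g = Zero C (Cod C f) (Cod C v)"
  shows "v = Zero C (Cod C g) (Cod C v)"
proof (rule colift_unique[OF assms(1)])
  show "orth (ShO C 1 (Dom C f)) (Cod C v)"
    by (rule t_orth[of _ "-1" _ 0]) (use assms(2,3) tle_Obj in \<open>auto simp: tle_shift\<close>)
qed (use assms in auto)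

lemma seq_mono_eq:
  assumes "seq f g" "Dom C v \<in> tle C t 0" "Cod C g \<in> tge C t 0" "v \<in> Arr C" "Cod C v = Dom C f"
    "v' \<in> Arr C" "Dom C v' = Dom C v" "Cod C v' = Dom C f" "f \<cdot> v = f \<cdot> v'"
  shows "v = v'"
proof (rule lift_unique_eq[OF assms(1)])
  show "orth (Dom C v) (ShO C (-1) (Cod C g))"
    by (rule t_orth[of _ 0 _ 1]) (use assms(2,3) tge_Obj in \<open>auto simp: tge_shift\<close>)
qed (use assms in auto)

lemma seq_epi_eq:
  assumes "seq f g" "Dom C f \<in> tle C t 0" "Cod C v \<in> tge C t 0" "v \<in> Arr C" "Dom C v = Cod C g"
    "v' \<in> Arr C" "Dom C v' = Cod C g" "Cod C v' = Cod C v" "v \<cdot> g = v' \<cdot> g"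
  shows "v = v'"
proof (rule colift_unique_eq[OF assms(1)])
  show "orth (ShO C 1 (Dom C f)) (Cod C v)"
    by (rule t_orth[of _ "-1" _ 0]) (use assms(2,3) tle_Obj in \<open>auto simp: tle_shift\<close>)
qed (use assms in auto)

lemma Ht_simps [simp]:
  "Obj (Ht C t) = H" "Arr (Ht C t) = {f \<in> Arr C. Dom C f \<in> H \<and> Cod C f \<in> H}"
  "Dom (Ht C t) = Dom C" "Cod (Ht C t) = Cod C" "Ident (Ht C t) = Ident C"
  "Comp (Ht C t) = Comp C" "Plus (Ht C t) = Plus C" "Zero (Ht C t) = Zero C"
  by (simp_all add: Ht_def)

text \<open>These triangles are the short exact sequences of the heart, by
  \<open>heart_seq_short_exact\<close> and \<open>short_exact_heart_seq\<close>. The triangle form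
  keeps the octahedral axiom and weight arguments within reach.\<close>

definition heart_seq :: "'m \<Rightarrow> 'm \<Rightarrow> bool" where
  "heart_seq f g \<longleftrightarrow> seq f g \<and> Dom C f \<in> H \<and> Cod C f \<in> H \<and> Cod C g \<in> H"

lemma heart_seq_simps:
  assumes "heart_seq f g"
  shows "seq f g" "f \<in> Arr C" "g \<in> Arr C" "Dom C g = Cod C f" "Dom C f \<in> H" "Cod C f \<in> H" "Cod C g \<in> H"
  using assms seq_simps by (auto simp: heart_seq_def)

lemma heart_seq_mono:
  assumes "heart_seq f g" "Dom C v \<in> H" "v \<in> Arr C" "Cod C v = Dom C f"
    "v' \<in> Arr C" "Dom C v' = Dom C v" "Cod C v' = Dom C f" "f \<cdot> v = f \<cdot> v'"
  shows "v = v'"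
  by (rule seq_mono_eq[of f g]) (use assms in \<open>auto simp: heart_seq_def heart_iff\<close>)

lemma heart_seq_epi:
  assumes "heart_seq f g" "Cod C v \<in> H" "v \<in> Arr C" "Dom C v = Cod C g"
    "v' \<in> Arr C" "Dom C v' = Cod C g" "Cod C v' = Cod C v" "v \<cdot> g = v' \<cdot> g"
  shows "v = v'"
  by (rule seq_epi_eq[of f g]) (use assms in \<open>auto simp: heart_seq_def heart_iff\<close>)

lemma heart_seq_kernel:
  assumes "heart_seq f g"
  shows "is_kernel (Ht C t) g f"
proof -
  note S = heart_seq_simps[OF assms]
  have "\<exists>!u. u \<in> Hom (Ht C t) (Dom C z) (Dom C f) \<and> f \<cdot> u = z"
    if z: "z \<in> Arr C" "Dom C z \<in> H" "Cod C z = Dom C g" "g \<cdot> z = Zero C (Dom C z) (Cod C g)" for z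
  proof -
    obtain v where v: "v \<in> Arr C" "Dom C v = Dom C z" "Cod C v = Dom C f" "f \<cdot> v = z"
      using lift[OF S(1), of z] z S by metis
    show ?thesis
    proof (rule ex1I[of _ v])
      show "v \<in> Hom (Ht C t) (Dom C z) (Dom C f) \<and> f \<cdot> v = z" using v S z by simp
      show "u = v" if "u \<in> Hom (Ht C t) (Dom C z) (Dom C f) \<and> f \<cdot> u = z" for u
        by (rule heart_seq_mono[OF assms]) (use that v z S in auto)
    qed
  qed
  then show ?thesis using S seq_comp[OF S(1)] by (simp add: is_kernel_def)
qed

lemma heart_seq_cokernel:
  assumes "heart_seq f g"
  shows "is_cokernel (Ht C t) f g"
proof -
  note S = heart_seq_simps[OF assms]
  have "\<exists>!u. u \<in> Hom (Ht C t) (Cod C g) (Cod C z) \<and> u \<cdot> g = z"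
    if z: "z \<in> Arr C" "Cod C z \<in> H" "Dom C z = Cod C f" "z \<cdot> f = Zero C (Dom C f) (Cod C z)" for z
  proof -
    obtain v where v: "v \<in> Arr C" "Dom C v = Cod C g" "Cod C v = Cod C z" "v \<cdot> g = z"
      using colift[OF S(1), of z] z S by metis
    show ?thesis
    proof (rule ex1I[of _ v])
      show "v \<in> Hom (Ht C t) (Cod C g) (Cod C z) \<and> v \<cdot> g = z" using v S z by simp
      show "u = v" if "u \<in> Hom (Ht C t) (Cod C g) (Cod C z) \<and> u \<cdot> g = z" for u
        by (rule heart_seq_epi[OF assms]) (use that v z S in auto)
    qed
  qed
  then show ?thesis using S seq_comp[OF S(1)] by (simp add: is_cokernel_def)
qed

lemma heart_seq_short_exact: "heart_seq f g \<Longrightarrow> short_exact (Ht C t) f g"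
  by (simp add: short_exact_def heart_seq_kernel heart_seq_cokernel)

text \<open>The cone \<open>S\<close> of \<open>f\<close> has cohomology only in degrees \<open>-1\<close> and \<open>0\<close>, namely the kernel and the cokernel
  of \<open>f\<close>; the octahedron over the truncation of \<open>S\<close> produces the image.\<close>

lemma heart_factor:
  assumes f: "f \<in> Arr C" "Dom C f \<in> H" "Cod C f \<in> H"
  obtains k e m q where "heart_seq k e" "heart_seq m q" "Cod C k = Dom C f" "Cod C e = Dom C m"
    "Cod C m = Cod C f" "m \<cdot> e = f"
proof -
  obtain g h where F: "(f, g, h) \<in> Tri C" using Tri_extend f by blast
  note SF = Tri_simps[OF F]
  have oM: "Dom C f \<in> Obj C" "Cod C f \<in> Obj C" "Cod C g \<in> Obj C" using SF by auto
  have e1: "ext (Dom C f) (Cod C f) (Cod C g)" using seq_ext[OF seqI[OF F]] .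
  have S: "Cod C g \<in> tle C t 0" "Cod C g \<in> tge C t (-1)"
    using t_ext(3,4)[OF e1] heart_tle heart_tge f by auto
  obtain \<beta> \<gamma> where bg: "seq \<beta> \<gamma>" "Cod C \<beta> = Cod C g" "Dom C \<beta> \<in> tle C t (-1)" "Cod C \<gamma> \<in> tge C t (-1 + 1)"
    using t_dec[OF oM(3)] by blast
  obtain \<delta> where B: "(\<beta>, \<gamma>, \<delta>) \<in> Tri C" using bg by (auto simp: seq_def)
  note SB = Tri_simps[OF B] bg
  have e2: "ext (Dom C \<beta>) (Cod C g) (Cod C \<gamma>)" using seq_ext[OF bg(1)] bg by simp
  have Q: "Cod C \<gamma> \<in> H" using t_ext(3)[OF e2, of 0] S bg(3,4) tle_mono[of _ "-1" 1] by (auto simp: heart_iff)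
  have Bg: "Dom C \<beta> \<in> tge C t (-1)" using t_ext(6)[OF e2, of "-1"] S heart_tge[OF Q] by simp
  let ?q = "\<gamma> \<cdot> g"
  have "?q \<in> Arr C" using SF SB by simp
  then obtain d1 d2 where D: "(?q, d1, d2) \<in> Tri C" using Tri_extend by blast
  note SD = Tri_simps[OF D]
  obtain a b where ab: "(a, b, ShM C 1 h \<cdot> Neg C (ShM C 1 \<beta>)) \<in> Tri C" "Dom C a = Cod C h" "Cod C a = Cod C d1"
    "Cod C b = Cod C \<delta>" "d2 \<cdot> a = Neg C (ShM C 1 f)"
    using seq_octahedron[OF Tri_rot[OF F] Tri_rot[OF B] D] SB SF by metis
  note SA = Tri_simps[OF ab(1)] ab(2-4)
  let ?I = "ShO C (-1) (Cod C d1)"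
  let ?e = "ShM C (-1) a" and ?m = "Neg C (ShM C (-1) d2)"
  have arr: "?e \<in> Arr C" "?m \<in> Arr C" "Dom C ?e = Dom C f" "Cod C ?e = ?I" "Dom C ?m = ?I" "Cod C ?m = Cod C f"
    using SA SD SB SF oM by auto
  have "ShM C (-1) d2 \<cdot> ShM C (-1) a = ShM C (-1) (Neg C (ShM C 1 f))"
    using SA SD SB SF by (simp add: ShM_comp[symmetric] ab(5) del: ShM_Neg)
  then have "ShM C (-1) d2 \<cdot> ShM C (-1) a = Neg C f" using f by simp
  then have me: "?m \<cdot> ?e = f" using arr f by (simp add: Neg_comp SA SD SB SF)
  have sm: "seq ?m ?q" by (rule seq_Neg_left[OF seq_next(4)[OF D]])
  let ?k = "ShM C (-1) (ShM C (-1) (ShM C 1 h \<cdot> Neg C (ShM C 1 \<beta>)))"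
  have sk: "seq ?k ?e" by (rule seq_shift[OF seq_next(4)[OF ab(1)]])
  have oB: "Dom C \<beta> \<in> Obj C" using SB by auto
  have Dk: "Dom C ?k = ShO C (-1) (Dom C \<beta>)" using SA SB SF oB by simp
  have Ck: "Cod C ?k = Dom C f" using SA SB SF oM by simp
  have K: "Dom C ?k \<in> H" unfolding Dk using bg(3) Bg oB by (simp add: heart_shift)
  have "ext (Dom C ?k) (Dom C f) ?I" using seq_ext[OF sk] Ck arr(4) by simp
  then have I1: "?I \<in> tle C t 0" using t_ext(3)[of "Dom C ?k" "Dom C f" ?I 0] heart_tle f K by auto
  have "ext ?I (Cod C f) (Cod C \<gamma>)" using seq_ext[OF sm] arr(5,6) SF SB by simp
  then have I2: "?I \<in> tge C t 0" using t_ext(6)[of ?I "Cod C f" "Cod C \<gamma>" 0] heart_tge f Q by auto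
  have I: "?I \<in> H" using I1 I2 by (simp add: heart_iff)
  show ?thesis
  proof (rule that[OF _ _ Ck _ arr(6) me])
    show "heart_seq ?k ?e" unfolding heart_seq_def Ck arr(4) using sk K I f by simp
    show "heart_seq ?m ?q" unfolding heart_seq_def arr(5,6) using sm I f Q SF SB by simp
  qed (simp add: arr)
qed

text \<open>The cone lives in degrees -1 and 0, and degree -1 is the kernel of \<open>f\<close>.
  Concretely, \<open>h \<cdot> \<beta>\<close> shifted back by one is an arrow of the heart killed
  by \<open>f\<close>, so it vanishes. Hence \<beta> factors through \<open>Cod f\<close>, is zero
  for degree reasons, and the cone is a retract of its truncation in degrees at least 0.\<close>

lemma mono_cone:
  assumes fg: "seq f g" "Dom C f \<in> H" "Cod C f \<in> H"
    and mono: "\<And>v. v \<in> Arr C \<Longrightarrow> Dom C v \<in> H \<Longrightarrow> Cod C v = Dom C f \<Longrightarrow> f \<cdot> v = Zero C (Dom C v) (Cod C f)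
      \<Longrightarrow> v = Zero C (Dom C v) (Dom C f)"
  shows "heart_seq f g"
proof -
  have f: "f \<in> Arr C" using seq_simps[OF fg(1)] by simp
  obtain h where F: "(f, g, h) \<in> Tri C" using fg by (auto simp: seq_def)
  note SF = Tri_simps[OF F]
  have oM: "Dom C f \<in> Obj C" "Cod C f \<in> Obj C" "Cod C g \<in> Obj C" using SF by auto
  have e1: "ext (Dom C f) (Cod C f) (Cod C g)" using seq_ext[OF seqI[OF F]] .
  have S: "Cod C g \<in> tle C t 0" "Cod C g \<in> tge C t (-1)"
    using t_ext(3,4)[OF e1] heart_tle heart_tge fg by auto
  obtain \<beta> \<gamma> where bg: "seq \<beta> \<gamma>" "Cod C \<beta> = Cod C g" "Dom C \<beta> \<in> tle C t (-1)" "Cod C \<gamma> \<in> tge C t (-1 + 1)"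
    using t_dec[OF oM(3)] by blast
  note SB = seq_simps[OF bg(1)] bg
  have e2: "ext (Dom C \<beta>) (Cod C g) (Cod C \<gamma>)" using seq_ext[OF bg(1)] bg by simp
  have "Cod C \<gamma> \<in> tge C t (-1 - 1)" using bg(4) tge_mono by fastforce
  then have Bg: "Dom C \<beta> \<in> tge C t (-1)" using t_ext(6)[OF e2, of "-1"] S by simp
  have oB: "Dom C \<beta> \<in> Obj C" using SB by auto
  let ?u = "ShM C (-1) (h \<cdot> \<beta>)"
  have fh: "ShM C 1 f \<cdot> h = Zero C (Cod C g) (ShO C 1 (Cod C f))" using seq_comp[OF seq_next(3)[OF F]] SF by simp
  have "f \<cdot> ?u = ShM C (-1) (ShM C 1 f) \<cdot> ?u" using f by simp
  also have "\<dots> = ShM C (-1) ((ShM C 1 f \<cdot> h) \<cdot> \<beta>)" using SF SB by (simp add: ShM_comp comp_assoc)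
  also have "\<dots> = Zero C (ShO C (-1) (Dom C \<beta>)) (Cod C f)" unfolding fh using SB SF oM oB by simp
  finally have "?u = Zero C (Dom C ?u) (Dom C f)" using SF SB oB oM bg(3) Bg
    by (intro mono) (auto simp: heart_shift)
  then have "ShM C 1 ?u = Zero C (Dom C \<beta>) (ShO C 1 (Dom C f))"
    using SF SB oB oM by (metis ShM_Zero ShM_simps(2) comp_simps(1,2) ShO_ShO ShO_0 ShO_Obj add.right_inverse)
  then have "h \<cdot> \<beta> = Zero C (Dom C \<beta>) (ShO C 1 (Dom C f))" using SF SB by simp
  then obtain v where v: "v \<in> Arr C" "Dom C v = Dom C \<beta>" "Cod C v = Cod C f" "g \<cdot> v = \<beta>"
    using lift[OF seq_next(2)[OF F], of \<beta>] SB SF by metis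
  have "v = Zero C (Dom C \<beta>) (Cod C f)"
  proof (rule orthD)
    show "orth (Dom C \<beta>) (Cod C f)" by (rule t_orth[of _ "-1" _ 0]) (use bg fg in \<open>auto simp: heart_iff\<close>)
  qed (use v in auto)
  then have "\<beta> = Zero C (Dom C \<beta>) (Cod C \<beta>)" using v(4) SF SB oB oM by simp
  from retract_trans_zero_left[OF bg(1) this] have "retract (Cod C g) (Cod C \<gamma>)" using bg by simp
  then have "Cod C g \<in> tge C t 0" using torsion_tower_retract(2)[OF tower, of "Cod C g" "Cod C \<gamma>" 0] bg(4) by simp
  then show ?thesis using S fg by (simp add: heart_seq_def heart_iff)
qed

section \<open>Short exact sequences of the heart and triangles\<close>

lemma seq_change_cod:
  assumes "seq f g" "inverse_pair w w'" "Dom C w = Cod C g"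
  shows "seq f (w \<cdot> g)"
proof -
  obtain h where F: "(f, g, h) \<in> Tri C" using assms by (auto simp: seq_def)
  note SF = Tri_simps[OF F]
  have o: "Dom C f \<in> Obj C" "Cod C f \<in> Obj C" using SF by auto
  show ?thesis using Tri_transport[OF F inverse_pair_Ident[OF o(1)] inverse_pair_Ident[OF o(2)] assms(2)] SF assms
    by (auto simp: seq_def inverse_pair_def)
qed

lemma seq_change_dom:
  assumes "seq f g" "inverse_pair u u'" "Cod C u' = Dom C f"
  shows "seq (f \<cdot> u') g"
proof -
  obtain h where F: "(f, g, h) \<in> Tri C" using assms by (auto simp: seq_def)
  note SF = Tri_simps[OF F]
  have o: "Cod C f \<in> Obj C" "Cod C g \<in> Obj C" using SF by auto
  show ?thesis using Tri_transport[OF F assms(2) inverse_pair_Ident[OF o(1)] inverse_pair_Ident[OF o(2)]] SF assms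
    by (auto simp: seq_def inverse_pair_def)
qed

lemma cokernel_unique:
  assumes "is_cokernel (Ht C t) f g" "is_cokernel (Ht C t) f g'"
  obtains w w' where "inverse_pair w w'" "Dom C w = Cod C g" "Cod C w = Cod C g'" "w \<cdot> g = g'"
proof -
  have a: "g \<in> Arr C" "g' \<in> Arr C" "Dom C g = Cod C f" "Dom C g' = Cod C f" "Cod C g \<in> H" "Cod C g' \<in> H" "Cod C f \<in> H"
    using assms by (auto simp: is_cokernel_def)
  obtain w where w: "w \<in> Arr C" "Dom C w = Cod C g" "Cod C w = Cod C g'" "w \<cdot> g = g'"
    using assms a unfolding is_cokernel_def by (simp, metis)
  obtain w' where w': "w' \<in> Arr C" "Dom C w' = Cod C g'" "Cod C w' = Cod C g" "w' \<cdot> g' = g"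
    using assms a unfolding is_cokernel_def by (simp, metis)
  have uniq: "u = Ident C (Cod C k)" if k: "is_cokernel (Ht C t) f k" "u \<in> Arr C" "Dom C u = Cod C k" "Cod C u = Cod C k" "u \<cdot> k = k" for u k
  proof -
    have "\<exists>!u. u \<in> Hom (Ht C t) (Cod C k) (Cod C k) \<and> u \<cdot> k = k"
      using k(1) unfolding is_cokernel_def by auto
    moreover have "Ident C (Cod C k) \<in> Hom (Ht C t) (Cod C k) (Cod C k) \<and> Ident C (Cod C k) \<cdot> k = k"
      using k(1) unfolding is_cokernel_def by auto
    moreover have "u \<in> Hom (Ht C t) (Cod C k) (Cod C k) \<and> u \<cdot> k = k"
      using k unfolding is_cokernel_def by auto
    ultimately show ?thesis by blast
  qed
  have "w' \<cdot> w = Ident C (Cod C g)" by (rule uniq[OF assms(1)]) (use w w' a in \<open>auto simp: comp_assoc\<close>)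
  moreover have "w \<cdot> w' = Ident C (Cod C g')" by (rule uniq[OF assms(2)]) (use w w' a in \<open>auto simp: comp_assoc\<close>)
  ultimately have "inverse_pair w w'" using w w' by (auto simp: inverse_pair_def)
  then show ?thesis using that w by blast
qed

text \<open>By \<open>mono_cone\<close> the cone of \<open>f\<close> lies in the heart, and the map
  to it is a cokernel of \<open>f\<close>. Uniqueness of cokernels transports the triangle to the
  given \<open>g\<close>.\<close>

lemma mono_cokernel_heart_seq:
  assumes c: "is_cokernel (Ht C t) f g"
    and mono: "\<And>v. v \<in> Arr C \<Longrightarrow> Dom C v \<in> H \<Longrightarrow> Cod C v = Dom C f \<Longrightarrow> f \<cdot> v = Zero C (Dom C v) (Cod C f)
      \<Longrightarrow> v = Zero C (Dom C v) (Dom C f)"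
  shows "heart_seq f g"
proof -
  have f: "f \<in> Arr C" "Dom C f \<in> H" "Cod C f \<in> H" "Cod C g \<in> H" using c by (auto simp: is_cokernel_def)
  obtain g' where g': "seq f g'" using ex_seq f by blast
  have "heart_seq f g'" by (rule mono_cone[OF g' f(2,3) mono])
  then obtain w w' where w: "inverse_pair w w'" "Dom C w = Cod C g'" "w \<cdot> g' = g"
    using cokernel_unique[OF heart_seq_cokernel c] by metis
  have "seq f g" using seq_change_cod[OF g' w(1,2)] w(3) by simp
  then show ?thesis using f by (simp add: heart_seq_def)
qed

lemma short_exact_heart_seq:
  assumes "short_exact (Ht C t) f g"
  shows "heart_seq f g"
proof (rule mono_cokernel_heart_seq)
  show "is_cokernel (Ht C t) f g" using assms by (simp add: short_exact_def)
  interpret K: preadditive_category "Ht C t" unfolding Ht_def by (rule preadditive_full_sub[OF heart_sub])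
  have "is_mono (Ht C t) f" using assms unfolding short_exact_def by (blast intro: K.kernel_mono)
  then show "v = Zero C (Dom C v) (Dom C f)"
    if "v \<in> Arr C" "Dom C v \<in> H" "Cod C v = Dom C f" "f \<cdot> v = Zero C (Dom C v) (Cod C f)" for v
    using that by (auto simp: K.is_mono_iff)
qed

text \<open>Induction on the number of possibly nonzero cohomologies. Truncation splits off the
  cohomology in degree 0, an object of the heart; the remaining part shifted by [-1] has smaller
  amplitude and returns to \<open>X\<close> through the stability of \<open>E\<close> under
  [1].\<close>

lemma tle_envelope:
  assumes "X \<in> tle C t 0" "X \<in> tge C t (- int n)" "ext_stable C E" "\<And>X. X \<in> E \<Longrightarrow> ShO C 1 X \<in> E" "H \<subseteq> E"
  shows "X \<in> E"
  using assms(1,2)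
proof (induction n arbitrary: X)
  case 0
  then show ?case using assms(5) by (auto simp: heart_iff)
next
  case (Suc n)
  have o: "X \<in> Obj C" using Suc tle_Obj by blast
  obtain a b where ab: "seq a b" "Cod C a = X" "Dom C a \<in> tle C t (-1)" "Cod C b \<in> tge C t (-1 + 1)"
    using t_dec[OF o] by blast
  have e: "ext (Dom C a) X (Cod C b)" using seq_ext[OF ab(1)] ab by simp
  have oa: "Dom C a \<in> Obj C" using ext_Obj[OF e] by simp
  have "Cod C b \<in> tle C t 0" using t_ext(3)[OF e, of 0] Suc.prems ab(3) tle_mono[of _ "-1" 1] by simp
  then have b: "Cod C b \<in> E" using assms(5) ab(4) by (auto simp: heart_iff)
  have "Cod C b \<in> tge C t (- int (Suc n) - 1)" using ab(4) tge_mono by fastforce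
  then have "Dom C a \<in> tge C t (- int (Suc n))" using t_ext(6)[OF e] Suc.prems by blast
  moreover have "- int (Suc n) = - int n - 1" by simp
  ultimately have "Dom C a \<in> tge C t (- int n - 1)" by (simp only:)
  then have "ShO C (-1) (Dom C a) \<in> E" using ab(3) oa by (intro Suc.IH) (simp_all add: tle_shift tge_shift)
  then have "Dom C a \<in> E" using assms(4)[of "ShO C (-1) (Dom C a)"] oa by simp
  then show ?case using ext_stableD[OF assms(3) e] b by blast
qed

lemma tge_envelope:
  assumes "X \<in> tge C t 0" "X \<in> tle C t (int n)" "ext_stable C E" "\<And>X. X \<in> E \<Longrightarrow> ShO C (-1) X \<in> E" "H \<subseteq> E"
  shows "X \<in> E"
  using assms(1,2)
proof (induction n arbitrary: X)
  case 0
  then show ?case using assms(5) by (auto simp: heart_iff)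
next
  case (Suc n)
  have o: "X \<in> Obj C" using Suc tle_Obj by blast
  obtain a b where ab: "seq a b" "Cod C a = X" "Dom C a \<in> tle C t 0" "Cod C b \<in> tge C t (0 + 1)"
    using t_dec[OF o] by blast
  have e: "ext (Dom C a) X (Cod C b)" using seq_ext[OF ab(1)] ab by simp
  have ob: "Cod C b \<in> Obj C" using ext_Obj[OF e] by simp
  have "Dom C a \<in> tge C t 0" using t_ext(6)[OF e, of 0] Suc.prems ab(4) tge_mono[of _ 1 "-1"] by simp
  then have a: "Dom C a \<in> E" using assms(5) ab(3) by (auto simp: heart_iff)
  have "Dom C a \<in> tle C t (int (Suc n) + 1)" using ab(3) tle_mono by fastforce
  then have "Cod C b \<in> tle C t (int (Suc n))" using t_ext(3)[OF e] Suc.prems by blast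
  then have "ShO C 1 (Cod C b) \<in> E" using ab(4) ob by (intro Suc.IH) (simp_all add: tle_shift tge_shift add.commute)
  then have "Cod C b \<in> E" using assms(4)[of "ShO C 1 (Cod C b)"] ob by simp
  then show ?case using ext_stableD[OF assms(3) e] a by blast
qed

end

section \<open>Transversal weight structures\<close>

context t_category
begin

lemma heart_seq_mono_zero:
  assumes "heart_seq f g" "Dom C v \<in> H" "v \<in> Arr C" "Cod C v = Dom C f" "f \<cdot> v = Zero C (Dom C v) (Cod C f)"
  shows "v = Zero C (Dom C v) (Dom C f)"
  by (rule seq_mono_le[of f g]) (use assms in \<open>auto simp: heart_seq_def heart_iff\<close>)

lemma heart_seq_epi_zero:
  assumes "heart_seq f g" "Cod C v \<in> H" "v \<in> Arr C" "Dom C v = Cod C g" "v \<cdot> g = Zero C (Cod C f) (Cod C v)"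
  shows "v = Zero C (Cod C g) (Cod C v)"
  by (rule seq_epi_ge[of f g]) (use assms in \<open>auto simp: heart_seq_def heart_iff\<close>)

lemma heart_seq_ext: "heart_seq f g \<Longrightarrow> ext (Dom C f) (Cod C f) (Cod C g)"
  by (simp add: heart_seq_def seq_ext)

lemma heart_factor_cokernel:
  assumes ke: "heart_seq k e" and mq: "heart_seq m q" and "Cod C e = Dom C m"
  shows "is_cokernel (Ht C t) (m \<cdot> e) q"
proof -
  note S = heart_seq_simps[OF ke] heart_seq_simps[OF mq] assms(3)
  have o: "Dom C e \<in> Obj C" "Cod C q \<in> Obj C" using S by auto
  have qm: "q \<cdot> m = Zero C (Dom C m) (Cod C q)" using seq_comp S by simp
  have 0: "q \<cdot> (m \<cdot> e) = Zero C (Dom C e) (Cod C q)"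
    using S o qm by (simp flip: comp_assoc)
  have univ: "\<exists>!u. u \<in> Hom (Ht C t) (Cod C q) (Cod C z) \<and> u \<cdot> q = z"
    if z: "z \<in> Arr C" "Cod C z \<in> H" "Dom C z = Cod C m" "z \<cdot> (m \<cdot> e) = Zero C (Dom C e) (Cod C z)" for z
  proof -
    have "(z \<cdot> m) \<cdot> e = Zero C (Dom C e) (Cod C z)" using z S by (simp add: comp_assoc)
    then have "z \<cdot> m = Zero C (Dom C m) (Cod C z)"
      using heart_seq_epi_zero[OF ke, of "z \<cdot> m"] z S by simp
    then show ?thesis using heart_seq_cokernel[OF mq] z S by (simp add: is_cokernel_def)
  qed
  show ?thesis unfolding is_cokernel_def using S 0 univ by simp
qed

lemma is_mono_Ht_zero:
  assumes "is_mono (Ht C t) f" "v \<in> Arr C" "Dom C v \<in> H" "Cod C v = Dom C f" "f \<cdot> v = Zero C (Dom C v) (Cod C f)"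
  shows "v = Zero C (Dom C v) (Dom C f)"
  using assms unfolding is_mono_def by (auto simp: heart_Obj)

lemma heart_seq_is_mono: "heart_seq f g \<Longrightarrow> is_mono (Ht C t) f"
  unfolding is_mono_def using heart_seq_simps[of f g] by (auto intro: heart_seq_mono)

text \<open>Condition (v') quantifies over all images, so the passage to (v) needs one to exist.
  Since \<open>Cod a\<close> lies in the heart, \<open>a \<cdot> p\<close> kills the part of
  negative degree and descends to the zeroth cohomology; the image is then taken in the
  heart.\<close>

lemma ex_image_H0:
  assumes a: "a \<in> Arr C" "Cod C a \<in> H"
  shows "\<exists>m. is_image_H0 C t a m"
proof -
  let ?X = "Cod C a"
  have X: "?X \<in> Obj C" "?X \<in> tle C t 0" "?X \<in> tge C t 0" using a by (auto simp: heart_iff)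
  have Y: "Dom C a \<in> Obj C" using a by simp
  obtain p b1 where p: "seq p b1" "Cod C p = Dom C a" "Dom C p \<in> tle C t 0" "Cod C b1 \<in> tge C t (0 + 1)"
    using t_dec[OF Y] by blast
  note SP = seq_simps[OF p(1)] p
  have oP: "Dom C p \<in> Obj C" using SP by simp
  obtain r q where r: "seq r q" "Cod C r = Dom C p" "Dom C r \<in> tle C t (-1)" "Cod C q \<in> tge C t (-1 + 1)"
    using t_dec[OF oP] by blast
  note SR = seq_simps[OF r(1)] r
  obtain Z where Z: "is_zero C Z" using ex_zero by blast
  have oZ: "Z \<in> Obj C" using Z by (simp add: is_zero_iff)
  \<comment> \<open>For an object of the heart both truncations are identities, completed to
    triangles by a zero object.\<close>
  have Hx: "is_H0 C t ?X (Ident C ?X) (Ident C ?X)"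
    unfolding is_H0_def using seq_Ident[OF X(1) Z] torsion_tower_zero[OF tower Z] X oZ
    unfolding seq_def by fastforce
  have Hy: "is_H0 C t (Dom C a) p q"
    unfolding is_H0_def using p r unfolding seq_def by force
  have ap: "a \<cdot> p \<in> Arr C" "Dom C (a \<cdot> p) = Dom C p" "Cod C (a \<cdot> p) = ?X" using a SP by simp_all
  have "orth (Dom C r) ?X" by (rule t_orth[of _ "-1" _ 0]) (use r X in auto)
  then have "(a \<cdot> p) \<cdot> r = Zero C (Dom C r) ?X"
    using ap SR by (intro orthD) auto
  then obtain h where h: "h \<in> Arr C" "Dom C h = Cod C q" "Cod C h = ?X" "h \<cdot> q = a \<cdot> p"
    using colift[OF r(1), of "a \<cdot> p"] ap SR by metis
  have "ext (Dom C r) (Dom C p) (Cod C q)" using seq_ext[OF r(1)] r by simp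
  then have "Cod C q \<in> tle C t 0" using t_ext(3)[of "Dom C r" _ _ 0] p(3) r(3) tle_mono[of _ "-1" 1] by auto
  then have q: "Cod C q \<in> H" using r by (simp add: heart_iff)
  have hm: "is_H0_map C t a p q (Ident C ?X) (Ident C ?X) h"
    unfolding is_H0_map_def using Hx Hy h ap X by auto
  obtain k e m q' where f: "heart_seq k e" "heart_seq m q'" "Cod C e = Dom C m" "m \<cdot> e = h"
    using heart_factor[of h] h q a by metis
  have "is_image (Ht C t) h m"
    unfolding is_image_def using heart_factor_cokernel[OF f(1-3)] f(4) heart_seq_kernel[OF f(2)] by auto
  then show ?thesis using hm unfolding is_image_H0_def by blast
qed

end

locale nice_category = t_category C t for C :: "('o, 'm, 'z) tricat_scheme" (structure) and t +
  fixes w :: "'o set \<times> 'o set"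
  assumes w: "weight_structure C w"
    and ex_nice: "X \<in> heart C t \<Longrightarrow> \<exists>a b c. nice_decomp C t w i X a b c"
begin

lemmas w_tow = w_tower[OF w]
lemmas w_orth = torsion_tower_orth[OF w_tow]
lemmas w_retract = torsion_tower_retract[OF w_tow]

lemma wle_mono: "X \<in> wle C w m \<Longrightarrow> m \<le> n \<Longrightarrow> X \<in> wle C w n"
  and wge_mono: "X \<in> wge C w m \<Longrightarrow> n \<le> m \<Longrightarrow> X \<in> wge C w n"
  using torsion_tower_mono[OF w_tow] by blast+

lemma wle_shift: "X \<in> Obj C \<Longrightarrow> ShO C k X \<in> wle C w n \<longleftrightarrow> X \<in> wle C w (n - k)"
  and wge_shift: "X \<in> Obj C \<Longrightarrow> ShO C k X \<in> wge C w n \<longleftrightarrow> X \<in> wge C w (n - k)"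
  using w by (auto simp: wle_iff wge_iff)

lemma w_ext:
  assumes "ext X Y Z"
  shows "Y \<in> wle C w n \<Longrightarrow> X \<in> wle C w (n - 1) \<Longrightarrow> Z \<in> wle C w n"
    "Y \<in> wge C w n \<Longrightarrow> X \<in> wge C w (n - 1) \<Longrightarrow> Z \<in> wge C w n"
    "Y \<in> wge C w n \<Longrightarrow> Z \<in> wge C w (n + 1) \<Longrightarrow> X \<in> wge C w n"
  using torsion_tower_ext[OF w_tow ext_rot(1)[OF assms]]
    torsion_tower_ext[OF w_tow ext_rot(2)[OF assms]] ext_Obj[OF assms]
  by (simp_all add: wle_shift wge_shift)

definition nice :: "int \<Rightarrow> 'm \<Rightarrow> 'm \<Rightarrow> bool" where
  "nice i a b \<longleftrightarrow> heart_seq a b \<and> Dom C a \<in> wle C w i \<and> Cod C b \<in> wge C w (i + 1)"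

lemma nice_iff: "(\<exists>c. nice_decomp C t w i X a b c) \<longleftrightarrow> nice i a b \<and> Cod C a = X"
  unfolding nice_def nice_decomp_def weight_decomp_def heart_seq_def seq_def by auto

lemma nice_simps:
  assumes "nice i a b"
  shows "heart_seq a b" "Dom C a \<in> wle C w i" "Cod C b \<in> wge C w (i + 1)"
  using assms by (simp_all add: nice_def)

lemma ex_nice':
  assumes "X \<in> H" obtains a b where "nice i a b" "Cod C a = X"
  using ex_nice[OF assms, of i] nice_iff by meson

lemma w_zero:
  assumes "X \<in> wle C w i" "Y \<in> wge C w j" "i < j" "f \<in> Arr C" "Dom C f = X" "Cod C f = Y"
  shows "f = Zero C X Y"
  using w_orth[OF assms(1-3)] assms(4-6) by (rule orthD)

text \<open>The map from the quotient to its own part of weight at least \<open>i + 1\<close>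
  vanishes after composition with the epimorphism \<open>g\<close>, hence vanishes; so the quotient
  is a retract of its part of weight at most \<open>i\<close>.\<close>

lemma quotient_wle:
  assumes fg: "heart_seq f g" "Cod C f \<in> wle C w i"
  shows "Cod C g \<in> wle C w i"
proof -
  note S = heart_seq_simps[OF fg(1)]
  obtain a b where ab: "nice i a b" "Cod C a = Cod C g" using ex_nice' S(7) by blast
  note N = heart_seq_simps[OF nice_simps(1)[OF ab(1)]] nice_simps[OF ab(1)]
  have "b \<cdot> g = Zero C (Cod C f) (Cod C b)"
    by (rule w_zero[OF fg(2) N(10)]) (use N S ab in auto)
  then have "b = Zero C (Cod C g) (Cod C b)"
    using heart_seq_epi_zero[OF fg(1), of b] N S ab by simp
  then have "retract (Cod C g) (Dom C a)" using retract_trans_zero_right[OF N(1)] ab by simp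
  then show ?thesis using w_retract(1) N by blast
qed

lemma sub_wge:
  assumes fg: "heart_seq f g" "Cod C f \<in> wge C w i"
  shows "Dom C f \<in> wge C w i"
proof -
  note S = heart_seq_simps[OF fg(1)]
  obtain a b where ab: "nice (i - 1) a b" "Cod C a = Dom C f" using ex_nice' S(5) by blast
  note N = heart_seq_simps[OF nice_simps(1)[OF ab(1)]] nice_simps[OF ab(1)]
  have "f \<cdot> a = Zero C (Dom C a) (Cod C f)"
    by (rule w_zero[OF N(9) fg(2)]) (use N S ab in auto)
  then have "a = Zero C (Dom C a) (Dom C f)"
    using heart_seq_mono_zero[OF fg(1), of a] N S ab by simp
  then have "retract (Dom C f) (Cod C b)" using retract_trans_zero_left[OF N(1)] ab by simp
  then show ?thesis using w_retract(2) N by fastforce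
qed

text \<open>Dividing \<open>Cod f\<close> by the part of weight at most \<open>i\<close> of its
  subobject gives an extension of \<open>Cod g\<close> by \<open>Cod b\<close>. By
  \<open>quotient_wle\<close> the object \<open>Cod g\<close> has weight at most \<open>i\<close>,
  while \<open>(Cod b)[1]\<close> has weight at least \<open>i + 2\<close>, so the extension splits.
  Thus \<open>Cod b\<close> becomes a quotient of \<open>Cod f\<close>, which has no nonzero arrow
  to it, and \<open>Cod b\<close> is zero.\<close>

lemma sub_wle:
  assumes fg: "heart_seq f g" "Cod C f \<in> wle C w i"
  shows "Dom C f \<in> wle C w i"
proof -
  note S = heart_seq_simps[OF fg(1)]
  obtain a b where ab: "nice i a b" "Cod C a = Dom C f" using ex_nice' S(5) by blast
  note N = heart_seq_simps[OF nice_simps(1)[OF ab(1)]] nice_simps[OF ab(1)] ab(2)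
  obtain c where T: "(a, b, c) \<in> Tri C" using N(1) by (auto simp: seq_def)
  obtain d where T': "(f, g, d) \<in> Tri C" using S(1) by (auto simp: seq_def)
  have "f \<cdot> a \<in> Arr C" using N S by simp
  then obtain h1 h2 where V: "(f \<cdot> a, h1, h2) \<in> Tri C" using Tri_extend by blast
  note SV = Tri_simps[OF V]
  have da: "Dom C f = Cod C a" using ab by simp
  obtain p p2 where P: "(p, p2, ShM C 1 b \<cdot> d) \<in> Tri C" "Dom C p = Cod C b" "Cod C p = Cod C h1" "Cod C p2 = Cod C g"
    using seq_octahedron[OF T T' V da] by metis
  note SP = Tri_simps[OF P(1)] P(2-4)
  have "Cod C p \<in> H" using heart_ext[OF seq_ext[OF seqI[OF P(1)]]] SP N S by simp
  then have hp: "heart_seq p p2" and hh: "heart_seq (f \<cdot> a) h1"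
    unfolding heart_seq_def using seqI[OF P(1)] seqI[OF V] SP N S SV by simp_all
  have oR: "Cod C b \<in> Obj C" using N by simp
  have "orth (Cod C p2) (ShO C 1 (Dom C p))"
    unfolding SP P(2,4)
  proof (rule w_orth[of _ i _ "i + 2"])
    show "Cod C g \<in> wle C w i" by (rule quotient_wle[OF fg])
    show "ShO C 1 (Cod C b) \<in> wge C w (i + 2)" using N oR by (simp add: wge_shift add.commute)
  qed simp
  then obtain r s where bp: "biproduct_data (Dom C p) (Cod C p2) (Cod C p) p s r p2"
    using seq_split[OF seqI[OF P(1)]] by metis
  then have r: "r \<in> Arr C" "Dom C r = Cod C h1" "Cod C r = Cod C b" "r \<cdot> p = Ident C (Cod C b)"
    using SP by (auto simp: biproduct_data_def)
  have "r \<cdot> h1 = Zero C (Cod C f) (Cod C b)"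
    by (rule w_zero[OF fg(2) N(10)]) (use r SV N S in auto)
  then have "r = Zero C (Cod C h1) (Cod C b)"
    using heart_seq_epi_zero[OF hh, of r] r N S by simp
  then have "Ident C (Cod C b) = Zero C (Cod C b) (Cod C b)" using r(4) SP SV oR by simp
  then have "b = Zero C (Cod C a) (Cod C b)"
    using to_zero[of "Cod C b" b] oR N by (simp add: is_zero_iff)
  then have "retract (Dom C f) (Dom C a)" using retract_trans_zero_right[OF N(1)] ab by simp
  then show ?thesis using w_retract(1) N by blast
qed

lemma heart_seq_split:
  assumes "heart_seq f g" "Cod C g \<in> wle C w i" "Dom C f \<in> wge C w i"
  obtains r s where "biproduct_data (Dom C f) (Cod C g) (Cod C f) f s r g"
proof -
  note S = heart_seq_simps[OF assms(1)]
  have "orth (Cod C g) (ShO C 1 (Dom C f))"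
    by (rule w_orth[OF assms(2), of _ "i + 1"]) (use assms(3) S in \<open>auto simp: wge_shift\<close>)
  then show ?thesis using that seq_split[OF S(1)] by metis
qed

section \<open>Objects pure of one weight\<close>

definition pure :: "int \<Rightarrow> 'o set" where
  "pure i = H \<inter> wle C w i \<inter> wge C w i"

lemma pure_sub: "pure i \<subseteq> H" "pure i \<subseteq> Obj C"
  using heart_Obj by (auto simp: pure_def)

lemma pure_retract: "retract X Y \<Longrightarrow> Y \<in> pure i \<Longrightarrow> X \<in> pure i"
  using heart_retract w_retract by (auto simp: pure_def)

text \<open>The two structures share the work: \<open>t\<close> excludes the shifts s < 0, where
  \<open>Y\<close> sits in degree -s > 0, and \<open>w\<close> excludes s > i - j, where
  \<open>Y\<close> has weight j + s > i.\<close>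

lemma pure_semi_orthogonal: "semi_orthogonal C pure"
  unfolding semi_orthogonal_def
proof (intro conjI allI impI)
  fix i
  obtain Z where Z: "is_zero C Z" using ex_zero by blast
  show "additive_sub C (pure i)"
  proof (rule additive_subI)
    show "\<exists>Z \<in> pure i. is_zero C Z" using Z heart_zero torsion_tower_zero[OF w_tow Z] by (auto simp: pure_def)
    show "S \<in> pure i" if "X \<in> pure i" "Y \<in> pure i" "biproduct_data X Y S a b p q" for X Y S a b p q
      using that torsion_tower_biproduct[OF w_tow that(3)] torsion_tower_biproduct[OF tower that(3)]
      by (auto simp: pure_def heart_iff)
  qed (use pure_sub in blast)
next
  fix i j s :: int
  assume s: "s < 0 \<or> s > i - j"
  show "perp C (pure i) (shift_class C (pure j) s)"
    unfolding perp_iff[OF pure_sub(2) shift_class_Obj[OF pure_sub(2)]]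
  proof (intro ballI)
    fix X Y assume X: "X \<in> pure i" and "Y \<in> shift_class C (pure j) s"
    then have Y: "Y \<in> Obj C" "ShO C (-s) Y \<in> pure j" by (simp_all add: shift_class_iff[OF pure_sub(2)])
    then have Y': "Y \<in> tge C t (-s)" "Y \<in> wge C w (j + s)"
      by (auto simp: pure_def heart_iff tge_shift wge_shift)
    show "orth X Y"
    proof (cases "s < 0")
      case True
      then show ?thesis using X Y' by (intro t_orth[of _ 0 _ "-s"]) (auto simp: pure_def heart_iff)
    next
      case False
      then show ?thesis using X Y' s by (intro w_orth[of _ i _ "j + s"]) (auto simp: pure_def)
    qed
  qed
qed

lemma pure_factor:
  assumes f: "f \<in> Arr C" "Dom C f \<in> pure i" "Cod C f \<in> pure j"
  obtains k e m q r s r' s' where "biproduct_data (Dom C k) (Dom C m) (Dom C f) k s r e"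
    "biproduct_data (Dom C m) (Cod C q) (Cod C f) m s' r' q" "m \<cdot> e = f"
    "Dom C k \<in> pure i" "Dom C m \<in> pure i" "Dom C m \<in> pure j" "Cod C q \<in> pure j"
proof -
  obtain k e m q where F: "heart_seq k e" "heart_seq m q" "Cod C k = Dom C f" "Cod C e = Dom C m"
    "Cod C m = Cod C f" "m \<cdot> e = f"
    using heart_factor[OF f(1)] f(2,3) pure_sub by blast
  obtain r s where b: "biproduct_data (Dom C k) (Cod C e) (Cod C k) k s r e"
    by (rule heart_seq_split[OF F(1), of i])
      (use quotient_wle[OF F(1), of i] sub_wge[OF F(1), of i] F(3) f(2) in \<open>auto simp: pure_def\<close>)
  obtain r' s' where b': "biproduct_data (Dom C m) (Cod C q) (Cod C m) m s' r' q"
    by (rule heart_seq_split[OF F(2), of j])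
      (use quotient_wle[OF F(2), of j] sub_wge[OF F(2), of j] F(5) f(3) in \<open>auto simp: pure_def\<close>)
  show ?thesis
    using that[of k m s r e q s' r'] b b' F biproduct_data_retract[OF b] biproduct_data_retract[OF b'] pure_retract f by auto
qed

text \<open>The image of an arrow lies in \<open>pure i\<close> and in \<open>pure j\<close>; for
  \<open>j < i\<close> such an object is orthogonal to itself, hence zero.\<close>

lemma pure_strongly_semi_orthogonal: "strongly_semi_orthogonal C pure"
  unfolding strongly_semi_orthogonal_def
proof (intro conjI allI impI pure_semi_orthogonal)
  fix i j :: int assume "j < i"
  have "orth X Y" if XY: "X \<in> pure i" "Y \<in> pure j" for X Y
    unfolding orth_def
  proof (intro ballI impI)
    fix f assume f: "f \<in> Arr C" "Dom C f = X \<and> Cod C f = Y"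
    obtain k e m q r s r' s' where F: "biproduct_data (Dom C k) (Dom C m) (Dom C f) k s r e"
      "biproduct_data (Dom C m) (Cod C q) (Cod C f) m s' r' q" "m \<cdot> e = f" "Dom C m \<in> pure i" "Dom C m \<in> pure j"
      by (rule pure_factor[OF f(1), of i j]) (use f XY in auto)
    have "orth (Dom C m) (Dom C m)"
      by (rule w_orth[of _ j _ i]) (use F(4,5) \<open>j < i\<close> in \<open>auto simp: pure_def\<close>)
    moreover have oI: "Dom C m \<in> Obj C" using F(4) pure_sub by blast
    ultimately have "is_zero C (Dom C m)"
      using orthD[of "Dom C m" "Dom C m" "Ident C (Dom C m)"] by (simp add: is_zero_iff)
    then have e: "e = Zero C X (Dom C m)" using to_zero[of "Dom C m" e] F(1) f by (auto simp: biproduct_data_def)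
    have "X \<in> Obj C" "m \<in> Arr C" "Cod C m = Y" using f F(2) by (auto simp: biproduct_data_def)
    then show "f = Zero C X Y" using F(3) unfolding e by simp
  qed
  then show "perp C (pure i) (pure j)" using perp_iff[OF pure_sub(2) pure_sub(2)] by blast
qed

text \<open>The left terms of nice decompositions of \<open>X\<close> for all \<open>i\<close> form
  the filtration. By the octahedral axiom the graded piece is at once the cone of two consecutive
  left terms and the fibre of two consecutive right terms, which bounds its weights on both
  sides.\<close>

lemma nice_filtration:
  assumes b: "bounded_weight_structure C w" and X: "X \<in> H"
  shows "\<exists>W. weight_filtration (Ht C t) pure X W"
proof -
  have "\<forall>i. \<exists>a b. nice i a b \<and> Cod C a = X" using ex_nice'[OF X] by metis
  then obtain a b where ab: "\<And>i. nice i (a i) (b i)" "\<And>i. Cod C (a i) = X" by metis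
  note N = nice_simps[OF ab(1)] heart_seq_simps[OF nice_simps(1)[OF ab(1)]] ab(2)
  obtain n where n: "X \<in> wle C w n" "X \<in> wge C w (-n)"
    using b heart_Obj[OF X] unfolding bounded_weight_structure_def by auto
  have o: "X \<in> Obj C" "Cod C (b i) \<in> Obj C" "Dom C (a i) \<in> Obj C" for i using N heart_Obj by auto
  have mono: "is_mono (Ht C t) (a i)" for i using heart_seq_is_mono N by blast
  \<comment> \<open>Once \<open>i\<close> reaches the weights of \<open>X\<close>, the map
    \<open>b i\<close> vanishes, so \<open>a i\<close> has a section; being cancellable in the
    heart, it is invertible.\<close>
  have iso: "is_isomorphism (Ht C t) (a i)" if i: "i \<ge> n" for i
  proof -
    have "b i = Zero C X (Cod C (b i))"
      by (rule w_zero[of _ i _ "i + 1"]) (use N i n wle_mono in auto)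
    then have "b i \<cdot> Ident C X = Zero C X (Cod C (b i))" using o N by simp
    then obtain s where s: "s \<in> Arr C" "Dom C s = X" "Cod C s = Dom C (a i)" "a i \<cdot> s = Ident C X"
      using lift[OF N(4)[of i], of "Ident C X"] N o by auto
    have "s \<cdot> a i = Ident C (Dom C (a i))"
      by (rule heart_seq_mono[OF N(1)[of i]]) (use s N o in \<open>auto simp flip: comp_assoc\<close>)
    then have "inverse_pair (a i) s" using s N by (auto simp: inverse_pair_def)
    then show ?thesis unfolding Ht_def is_isomorphism_full_sub using is_isomorphism_iff N X by auto
  qed
  have zero: "is_zero (Ht C t) (Dom C (a i))" if i: "i \<le> - n - 1" for i
  proof -
    have "a i = Zero C (Dom C (a i)) X"
      by (rule w_zero[of _ i _ "-n"]) (use N i n in auto)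
    then have "a i \<cdot> Ident C (Dom C (a i)) = Zero C (Dom C (a i)) X" using o N by simp
    then have "Ident C (Dom C (a i)) = Zero C (Dom C (a i)) (Dom C (a i))"
      using heart_seq_mono_zero[OF N(1)[of i], of "Ident C (Dom C (a i))"] N o by simp
    then show ?thesis unfolding Ht_def is_zero_full_sub[OF heart_sub] using N o by (simp add: is_zero_iff)
  qed
  have gr: "\<exists>u \<in> Hom (Ht C t) (Dom C (a (i - 1))) (Dom C (a i)). \<exists>q.
      a i \<cdot> u = a (i - 1) \<and> is_cokernel (Ht C t) u q \<and> Cod C q \<in> pure i" for i
  proof -
    have "b i \<cdot> a (i - 1) = Zero C (Dom C (a (i - 1))) (Cod C (b i))"
      by (rule w_zero[of _ "i - 1" _ "i + 1"]) (use N in auto)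
    then obtain u where u: "u \<in> Arr C" "Dom C u = Dom C (a (i - 1))" "Cod C u = Dom C (a i)" "a i \<cdot> u = a (i - 1)"
      using lift[OF N(4)[of i], of "a (i - 1)"] N by metis
    obtain u1 u2 where U: "(u, u1, u2) \<in> Tri C" using Tri_extend u(1) by blast
    obtain c where A: "(a i, b i, c) \<in> Tri C" using N(4)[of i] by (auto simp: seq_def)
    obtain c' where A': "(a i \<cdot> u, b (i - 1), c') \<in> Tri C" using N(4)[of "i - 1"] u by (auto simp: seq_def)
    have d: "Dom C (a i) = Cod C u" using u by simp
    obtain p p2 where P: "(p, p2, ShM C 1 u1 \<cdot> c) \<in> Tri C" "Dom C p = Cod C u1" "Cod C p = Cod C (b (i - 1))"
      "Cod C p2 = Cod C (b i)"
      using seq_octahedron[OF U A A' d] by metis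
    have e1: "ext (Dom C (a (i - 1))) (Dom C (a i)) (Cod C u1)" using seq_ext[OF seqI[OF U]] u by simp
    have e2: "ext (Cod C u1) (Cod C (b (i - 1))) (Cod C (b i))" using seq_ext[OF seqI[OF P(1)]] P by simp
    have "Cod C u1 \<in> tle C t 0" using t_ext(3)[OF e1, of 0] N heart_tle by simp
    moreover have "Cod C u1 \<in> tge C t 0" using t_ext(6)[OF e2, of 0] N heart_tge by simp
    ultimately have h: "Cod C u1 \<in> H" by (simp add: heart_iff)
    \<comment> \<open>In \<open>e1\<close> the term shifted by [1] has weight at most
      \<open>i - 1\<close>, in \<open>e2\<close> the term shifted by [-1] has weight at least
      \<open>i + 1\<close>; the shifts bring both bounds exactly to \<open>i\<close>.\<close>
    have "Cod C u1 \<in> wle C w i" using w_ext(1)[OF e1, of i] N by simp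
    moreover have "Cod C u1 \<in> wge C w i" using w_ext(3)[OF e2, of i] N(3)[of "i - 1"] N(3)[of i] by simp
    ultimately have pu: "Cod C u1 \<in> pure i" using h by (simp add: pure_def)
    have hs: "heart_seq u u1" unfolding heart_seq_def using seqI[OF U] u N h by simp
    show ?thesis using u N heart_seq_cokernel[OF hs] pu by (intro bexI[of _ u] exI[of _ u1]) auto
  qed
  show ?thesis unfolding weight_filtration_def
    by (intro exI[of _ a] conjI allI exI[of _ n] exI[of _ "- n - 1"] impI) (use mono iso zero gr N in auto)
qed

text \<open>Whatever weight decomposition is taken, the image is the left term \<open>l\<close> of a
  nice decomposition, as a subobject of \<open>X\<close>: \<open>l\<close> and \<open>m\<close>
  factor through each other. The nice triangle of \<open>l\<close> is then transported to
  \<open>m\<close>.\<close>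

lemma image_H0_nice:
  assumes X: "X \<in> H" and wd: "weight_decomp C w i X a b c" and im: "is_image_H0 C t a m"
  shows "extends_to_nice C t w i X m"
proof -
  have A: "seq a b" "Cod C a = X" "Dom C a \<in> wle C w i" "Cod C b \<in> wge C w (i + 1)"
    using wd by (auto simp: weight_decomp_def seq_def)
  note SA = seq_simps[OF A(1)] A
  obtain p q h where hm: "is_H0_map C t a p q (Ident C X) (Ident C X) h" and ih: "is_image (Ht C t) h m"
    using im A(2) unfolding is_image_H0_def by auto
  have hq: "is_H0 C t (Dom C a) p q" "h \<in> Arr C" "Dom C h = Cod C q" "Cod C h = X"
    using hm heart_Obj[OF X] unfolding is_H0_map_def by auto
  obtain b1 where b1: "seq p b1" "Cod C p = Dom C a" "Dom C p \<in> tle C t 0" "Cod C b1 \<in> tge C t 1"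
    using hq(1) unfolding is_H0_def seq_def by blast
  obtain r1 where r1: "seq r1 q" "Cod C r1 = Dom C p" "Dom C r1 \<in> tle C t (-1)" "Cod C q \<in> tge C t 0"
    using hq(1) unfolding is_H0_def seq_def by blast
  note SB = seq_simps[OF b1(1)] b1 seq_simps[OF r1(1)] r1
  have hqp: "h \<cdot> q = a \<cdot> p"
    using hm heart_Obj[OF X] SA SB unfolding is_H0_map_def by auto
  obtain e where e: "is_cokernel (Ht C t) h e" "is_kernel (Ht C t) e m"
    using ih unfolding is_image_def by blast
  have ea: "e \<in> Arr C" "Dom C e = X" "Cod C e \<in> H" "e \<cdot> h = Zero C (Cod C q) (Cod C e)"
    using e(1) hq unfolding is_cokernel_def by auto
  have ma: "m \<in> Arr C" "Dom C m \<in> H" "Cod C m = X" "e \<cdot> m = Zero C (Dom C m) (Cod C e)"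
    using e(2) ea unfolding is_kernel_def by auto
  obtain l b' where l: "nice i l b'" "Cod C l = X" using ex_nice'[OF X] by blast
  note N = nice_simps[OF l(1)] heart_seq_simps[OF nice_simps(1)[OF l(1)]] l(2)
  have o: "Cod C e \<in> Obj C" "Dom C l \<in> Obj C" "Cod C b' \<in> Obj C" using ea N heart_Obj by auto
  \<comment> \<open>For weight reasons \<open>l\<close> factors through \<open>a\<close>, and for
    degree reasons further through the truncation \<open>p\<close>. So \<open>l\<close> factors
    through \<open>h\<close>, dies in the cokernel \<open>e\<close>, and lifts to the image
    \<open>m\<close>.\<close>
  have "b \<cdot> l = Zero C (Dom C l) (Cod C b)"
    by (rule w_zero[OF N(2) A(4)]) (use N SA in auto)
  then obtain y where y: "y \<in> Arr C" "Dom C y = Dom C l" "Cod C y = Dom C a" "a \<cdot> y = l"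
    using lift[OF A(1), of l] N SA by metis
  have "orth (Dom C l) (Cod C b1)" by (rule t_orth[of _ 0 _ 1]) (use N b1 in \<open>auto simp: heart_iff\<close>)
  then have "b1 \<cdot> y = Zero C (Dom C l) (Cod C b1)" using y SB by (intro orthD) auto
  then obtain s where s: "s \<in> Arr C" "Dom C s = Dom C l" "Cod C s = Dom C p" "p \<cdot> s = y"
    using lift[OF b1(1), of y] y SB by metis
  have l_eq: "l = h \<cdot> (q \<cdot> s)"
  proof -
    have "l = (a \<cdot> p) \<cdot> s" using y s SA SB by (simp add: comp_assoc)
    then show ?thesis unfolding hqp[symmetric] using s SB hq by (simp add: comp_assoc)
  qed
  have "e \<cdot> (h \<cdot> (q \<cdot> s)) = Zero C (Dom C s) (Cod C e)"
    using comp_assoc[of "q \<cdot> s" h e] ea o hq SB s(1,3) by simp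
  then have el: "e \<cdot> l = Zero C (Dom C l) (Cod C e)" by (simp only: l_eq[symmetric] s(2))
  \<comment> \<open>The opposite inclusion: \<open>b'\<close> kills \<open>a\<close>, hence
    \<open>h\<close>, since \<open>q\<close> can be cancelled on the right against objects of the
    heart. So \<open>b'\<close> factors through the cokernel \<open>e\<close> and kills
    \<open>m\<close>.\<close>
  have "b' \<cdot> a = Zero C (Dom C a) (Cod C b')"
    by (rule w_zero[OF A(3) N(3)]) (use N SA in auto)
  then have "(b' \<cdot> a) \<cdot> p = Zero C (Dom C p) (Cod C b')" using o SB by simp
  then have "(b' \<cdot> h) \<cdot> q = Zero C (Dom C p) (Cod C b')" using hqp N hq SA SB by (simp add: comp_assoc)
  then have "b' \<cdot> h = Zero C (Cod C q) (Cod C b')"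
    using seq_epi_ge[OF r1(1), of "b' \<cdot> h"] N hq SB tle_mono[OF r1(3), of 0] heart_tge by simp
  then obtain x where x: "x \<in> Arr C" "Dom C x = Cod C e" "Cod C x = Cod C b'" "x \<cdot> e = b'"
    using e(1) N hq unfolding is_cokernel_def by (simp, metis)
  have "b' \<cdot> m = Zero C (Dom C m) (Cod C b')"
    using comp_assoc[of m e x] x ma ea o by simp
  then obtain v' where v': "v' \<in> Arr C" "Dom C v' = Dom C m" "Cod C v' = Dom C l" "l \<cdot> v' = m"
    using lift[OF N(4), of m] ma N by metis
  obtain v where v: "v \<in> Arr C" "Dom C v = Dom C l" "Cod C v = Dom C m" "m \<cdot> v = l"
    using e(2) el N ea unfolding is_kernel_def by (simp, metis)
  have 1: "v' \<cdot> v = Ident C (Dom C l)"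
    by (rule heart_seq_mono[OF N(1)]) (use v v' N o in \<open>auto simp flip: comp_assoc\<close>)
  have "\<exists>!u. u \<in> Hom (Ht C t) (Dom C m) (Dom C m) \<and> m \<cdot> u = m"
    using e(2) unfolding is_kernel_def by auto
  moreover have "v \<cdot> v' \<in> Hom (Ht C t) (Dom C m) (Dom C m) \<and> m \<cdot> (v \<cdot> v') = m"
    using v v' ma by (simp flip: comp_assoc)
  moreover have "Ident C (Dom C m) \<in> Hom (Ht C t) (Dom C m) (Dom C m) \<and> m \<cdot> Ident C (Dom C m) = m"
    using ma by simp
  ultimately have 2: "v \<cdot> v' = Ident C (Dom C m)" by blast
  have inv: "inverse_pair v v'" using 1 2 v v' by (auto simp: inverse_pair_def)
  have "seq (l \<cdot> v') b'" by (rule seq_change_dom[OF N(4) inv v'(3)])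
  then have sm: "seq m b'" using v' by simp
  have "retract (Dom C m) (Dom C l)" using v v' 2 unfolding retract_def by blast
  then have "Dom C m \<in> wle C w i" using w_retract(1) N by blast
  then have "nice i m b'" using sm ma X N by (simp add: nice_def heart_seq_def)
  then show ?thesis unfolding extends_to_nice_def using nice_iff ma(3) by blast
qed

section \<open>Functoriality and exactness of nice decompositions\<close>

lemma nice_map:
  assumes ab: "nice i a b" and cd: "nice i c d" and f: "f \<in> Arr C" "Dom C f = Cod C a" "Cod C f = Cod C c"
  shows "\<exists>l. l \<in> Arr C \<and> Dom C l = Dom C a \<and> Cod C l = Dom C c \<and> c \<cdot> l = f \<cdot> a"
    "\<exists>r. r \<in> Arr C \<and> Dom C r = Cod C b \<and> Cod C r = Cod C d \<and> r \<cdot> b = d \<cdot> f"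
proof -
  note N = nice_simps[OF ab] heart_seq_simps[OF nice_simps(1)[OF ab]]
  note M = nice_simps[OF cd] heart_seq_simps[OF nice_simps(1)[OF cd]]
  have "d \<cdot> (f \<cdot> a) = Zero C (Dom C a) (Cod C d)"
    by (rule w_zero[OF N(2) M(3)]) (use N M f in auto)
  then show "\<exists>l. l \<in> Arr C \<and> Dom C l = Dom C a \<and> Cod C l = Dom C c \<and> c \<cdot> l = f \<cdot> a"
    using lift[OF M(4), of "f \<cdot> a"] N M f by (metis comp_simps)
  have "(d \<cdot> f) \<cdot> a = Zero C (Dom C a) (Cod C d)"
    by (rule w_zero[OF N(2) M(3)]) (use N M f in auto)
  then show "\<exists>r. r \<in> Arr C \<and> Dom C r = Cod C b \<and> Cod C r = Cod C d \<and> r \<cdot> b = d \<cdot> f"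
    using colift[OF N(4), of "d \<cdot> f"] N M f by (metis comp_simps)
qed

text \<open>Orthogonality provides comparison arrows in both directions; their composites are
  identities because the left arrows cancel as monomorphisms of the heart and the right ones as
  epimorphisms.\<close>

lemma nice_unique:
  assumes ab: "nice i a b" and cd: "nice i c d" and e: "Cod C a = Cod C c"
  shows "\<exists>v v'. inverse_pair v v' \<and> Dom C v = Dom C a \<and> Cod C v = Dom C c \<and> c \<cdot> v = a"
    "\<exists>v v'. inverse_pair v v' \<and> Dom C v = Cod C b \<and> Cod C v = Cod C d \<and> v \<cdot> b = d"
proof -
  note N = nice_simps[OF ab] heart_seq_simps[OF nice_simps(1)[OF ab]]
  note M = nice_simps[OF cd] heart_seq_simps[OF nice_simps(1)[OF cd]]
  let ?X = "Cod C a"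
  have o: "?X \<in> Obj C" using N by simp
  obtain l where l: "l \<in> Arr C" "Dom C l = Dom C a" "Cod C l = Dom C c" "c \<cdot> l = a"
    using nice_map(1)[OF ab cd, of "Ident C ?X"] N M e o by auto
  obtain l' where l': "l' \<in> Arr C" "Dom C l' = Dom C c" "Cod C l' = Dom C a" "a \<cdot> l' = c"
    using nice_map(1)[OF cd ab, of "Ident C ?X"] N M e o by auto
  have "l' \<cdot> l = Ident C (Dom C a)"
    by (rule heart_seq_mono[OF N(1)]) (use l l' N o in \<open>auto simp flip: comp_assoc\<close>)
  moreover have "l \<cdot> l' = Ident C (Dom C c)"
    by (rule heart_seq_mono[OF M(1)]) (use l l' M o in \<open>auto simp flip: comp_assoc\<close>)
  ultimately have "inverse_pair l l'" using l l' by (simp add: inverse_pair_def)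
  then show "\<exists>v v'. inverse_pair v v' \<and> Dom C v = Dom C a \<and> Cod C v = Dom C c \<and> c \<cdot> v = a"
    using l by blast
  obtain r where r: "r \<in> Arr C" "Dom C r = Cod C b" "Cod C r = Cod C d" "r \<cdot> b = d"
    using nice_map(2)[OF ab cd, of "Ident C ?X"] N M e o by auto
  obtain r' where r': "r' \<in> Arr C" "Dom C r' = Cod C d" "Cod C r' = Cod C b" "r' \<cdot> d = b"
    using nice_map(2)[OF cd ab, of "Ident C ?X"] N M e o by auto
  have "r' \<cdot> r = Ident C (Cod C b)"
    by (rule heart_seq_epi[OF N(1)]) (use r r' N o in \<open>auto simp: comp_assoc\<close>)
  moreover have "r \<cdot> r' = Ident C (Cod C d)"
    by (rule heart_seq_epi[OF M(1)]) (use r r' M o in \<open>auto simp: comp_assoc\<close>)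
  ultimately have "inverse_pair r r'" using r r' by (simp add: inverse_pair_def)
  then show "\<exists>v v'. inverse_pair v v' \<and> Dom C v = Cod C b \<and> Cod C v = Cod C d \<and> v \<cdot> b = d"
    using r by blast
qed

text \<open>The \<open>3 \<times> 3\<close> diagram with rows \<open>L X \<rightarrow> L Y \<rightarrow> Q\<close>, \<open>X \<rightarrow> Y \<rightarrow> Z\<close>, \<open>R X \<rightarrow> R Y \<rightarrow> S\<close>. The kernel of
  \<open>Q \<rightarrow> Z\<close> is a subobject of \<open>Q\<close>, so it has weights at most \<open>i\<close>, while it also embeds into \<open>R X\<close>; hence
  \<open>Q \<rightarrow> Z \<rightarrow> S\<close> is a nice decomposition.\<close>

lemma nice_cokernel:
  assumes fg: "heart_seq f g"
    and X: "nice i a b" "Cod C a = Dom C f"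
    and Y: "nice i a' b'" "Cod C a' = Cod C f"
    and l: "l \<in> Arr C" "Dom C l = Dom C a" "Cod C l = Dom C a'" "a' \<cdot> l = f \<cdot> a"
    and r: "r \<in> Arr C" "Dom C r = Cod C b" "Cod C r = Cod C b'" "r \<cdot> b = b' \<cdot> f"
  obtains s \<phi> \<sigma> s' where "heart_seq l s" "heart_seq r s'" "nice i \<phi> \<sigma>" "Cod C \<phi> = Cod C g"
    "Dom C \<phi> = Cod C s" "Cod C \<sigma> = Cod C s'" "\<phi> \<cdot> s = g \<cdot> a'" "s' \<cdot> b' = \<sigma> \<cdot> g"
proof -
  note F = heart_seq_simps[OF fg]
  note N = nice_simps[OF X(1)] heart_seq_simps[OF nice_simps(1)[OF X(1)]] X(2)
  note M = nice_simps[OF Y(1)] heart_seq_simps[OF nice_simps(1)[OF Y(1)]] Y(2)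
  have lH: "Dom C l \<in> H" "Cod C l \<in> H" using l N M by auto
  obtain s s2 where L: "(l, s, s2) \<in> Tri C" using Tri_extend l by blast
  note SL = Tri_simps[OF L]
  have hl: "heart_seq l s"
  proof (rule mono_cone[OF seqI[OF L] lH])
    fix v assume v: "v \<in> Arr C" "Dom C v \<in> H" "Cod C v = Dom C l" "l \<cdot> v = Zero C (Dom C v) (Cod C l)"
    have ov: "Dom C v \<in> Obj C" using v by simp
    have "(f \<cdot> a) \<cdot> v = Zero C (Dom C v) (Cod C f)"
      using comp_assoc[of v l a'] l v M ov by simp
    then have "f \<cdot> (a \<cdot> v) = Zero C (Dom C (a \<cdot> v)) (Cod C f)" using l v N F by (simp add: comp_assoc)
    then have "a \<cdot> v = Zero C (Dom C v) (Cod C a)"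
      using heart_seq_mono_zero[OF fg, of "a \<cdot> v"] v l N F by simp
    then show "v = Zero C (Dom C v) (Dom C l)"
      using heart_seq_mono_zero[OF N(1), of v] v l by simp
  qed
  note HL = heart_seq_simps[OF hl]
  have Qw: "Cod C s \<in> wle C w i" by (rule quotient_wle[OF hl]) (use l M in simp)
  obtain c where A: "(a, b, c) \<in> Tri C" using N(4) by (auto simp: seq_def)
  obtain c' where A': "(a', b', c') \<in> Tri C" using M(4) by (auto simp: seq_def)
  obtain g2 where G: "(f, g, g2) \<in> Tri C" using F(1) by (auto simp: seq_def)
  have "a' \<cdot> l \<in> Arr C" using l(1,3) M by (intro comp_simps) auto
  then obtain h1 h2 where V: "(a' \<cdot> l, h1, h2) \<in> Tri C" using Tri_extend by blast
  then have V': "(f \<cdot> a, h1, h2) \<in> Tri C" using l by simp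
  note SV = Tri_simps[OF V]
  obtain p p2 where P: "(p, p2, ShM C 1 s \<cdot> c') \<in> Tri C" "Dom C p = Cod C s" "Cod C p = Cod C h1"
    "Cod C p2 = Cod C b'" "p \<cdot> s = h1 \<cdot> a'" "p2 \<cdot> h1 = b'"
    using seq_octahedron[OF L A' V] l by metis
  obtain u u2 where U: "(u, u2, ShM C 1 b \<cdot> g2) \<in> Tri C" "Dom C u = Cod C b" "Cod C u = Cod C h1"
    "Cod C u2 = Cod C g" "u \<cdot> b = h1 \<cdot> f" "u2 \<cdot> h1 = g"
    using seq_octahedron[OF A G V'] N by metis
  note SP = Tri_simps[OF P(1)] P(2-4) and SU = Tri_simps[OF U(1)] U(2-4)
  let ?\<phi> = "u2 \<cdot> p" and ?\<rho> = "p2 \<cdot> u"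
  have ph: "?\<phi> \<in> Arr C" "Dom C ?\<phi> = Cod C s" "Cod C ?\<phi> = Cod C g" using SP SU by simp_all
  have h1: "h1 \<in> Arr C" "Dom C h1 = Cod C f" using SV(2,4) M l(1,3) by simp_all
  have "?\<phi> \<cdot> s = u2 \<cdot> (p \<cdot> s)" using SP SU SL by (simp add: comp_assoc)
  also have "\<dots> = (u2 \<cdot> h1) \<cdot> a'" unfolding P(5) using SU h1 M by (simp add: comp_assoc)
  finally have phs: "?\<phi> \<cdot> s = g \<cdot> a'" unfolding U(6) .
  have "?\<rho> \<cdot> b = p2 \<cdot> (u \<cdot> b)" using SP SU N by (simp add: comp_assoc)
  also have "\<dots> = (p2 \<cdot> h1) \<cdot> f" unfolding U(5) using SP h1 F by (simp add: comp_assoc)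
  finally have rb: "?\<rho> \<cdot> b = b' \<cdot> f" unfolding P(6) .
  have rho: "?\<rho> = r"
    by (rule heart_seq_epi[OF N(1)]) (use SP SU r N M rb in auto)
  obtain \<sigma> \<sigma>2 where S: "(?\<phi>, \<sigma>, \<sigma>2) \<in> Tri C" using Tri_extend ph by blast
  note SS = Tri_simps[OF S]
  obtain z z2 where Z: "(z, z2, ShM C 1 p2 \<cdot> Neg C (ShM C 1 u)) \<in> Tri C" "Dom C z = Cod C p2"
    "Cod C z = Cod C \<sigma>" "z \<cdot> p2 = \<sigma> \<cdot> u2"
    using seq_octahedron[OF P(1) Tri_rot[OF U(1)] S] SU SP by metis
  note SZ = Tri_simps[OF Z(1)] Z(2,3)
  have "ShM C 1 p2 \<cdot> Neg C (ShM C 1 u) = Neg C (ShM C 1 r)"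
    using SP SU by (simp add: comp_Neg ShM_comp flip: rho)
  then have Zr: "(z, z2, Neg C (ShM C 1 r)) \<in> Tri C" using Z(1) by simp
  have "seq (ShM C (-1) (Neg C (ShM C 1 r))) z" by (rule seq_next(4)[OF Zr])
  then have rz: "seq r z" using seq_Neg_left[of "Neg C r" z] r by simp
  have zb: "z \<cdot> b' = \<sigma> \<cdot> g"
  proof -
    have "z \<cdot> b' = (z \<cdot> p2) \<cdot> h1" unfolding P(6)[symmetric] using SZ SP h1 SV by (simp add: comp_assoc)
    also have "\<dots> = \<sigma> \<cdot> (u2 \<cdot> h1)" unfolding Z(4) using SS SU h1 ph by (simp add: comp_assoc)
    finally show ?thesis unfolding U(6) .
  qed
  have eS: "ext (Cod C b) (Cod C b') (Cod C \<sigma>)" using seq_ext[OF rz] r SZ by simp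
  have ephi: "ext (Cod C s) (Cod C g) (Cod C \<sigma>)" using seq_ext[OF seqI[OF S]] ph by simp
  have hphi: "heart_seq ?\<phi> \<sigma>"
  proof (rule mono_cone[OF seqI[OF S]])
    show "Dom C ?\<phi> \<in> H" "Cod C ?\<phi> \<in> H" unfolding ph using HL F by simp_all
    fix v assume v: "v \<in> Arr C" "Dom C v \<in> H" "Cod C v = Dom C ?\<phi>" "?\<phi> \<cdot> v = Zero C (Dom C v) (Cod C ?\<phi>)"
    obtain k e m q where K: "heart_seq k e" "heart_seq m q" "Cod C k = Dom C ?\<phi>" "Cod C e = Dom C m"
      "Cod C m = Cod C ?\<phi>" "m \<cdot> e = ?\<phi>"
      using heart_factor[of ?\<phi>] ph HL F by metis
    note KS = heart_seq_simps[OF K(1)] heart_seq_simps[OF K(2)] K(3-5)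
    have ok: "Dom C k \<in> Obj C" "Cod C b' \<in> Obj C" "Cod C b \<in> Obj C" using KS N M by auto
    have Kw: "Dom C k \<in> wle C w i" by (rule sub_wle[OF K(1)]) (use K ph Qw in simp)
    have o1: "orth (Dom C k) (ShO C (-1) (Cod C b'))"
      by (rule t_orth[of _ 0 _ 1]) (use KS M ok in \<open>auto simp: heart_iff tge_shift\<close>)
    have o2: "orth (Dom C k) (Cod C b)" by (rule w_orth[OF Kw N(3)]) simp
    have "orth (Dom C k) (ShO C (-1) (Cod C \<sigma>))" by (rule orth_ext(2)[OF ext_rot(4)[OF eS] o1 o2])
    moreover have "?\<phi> \<cdot> k = Zero C (Dom C k) (Cod C ?\<phi>)"
    proof -
      have "(m \<cdot> e) \<cdot> k = m \<cdot> (e \<cdot> k)" using KS by (simp add: comp_assoc)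
      also have "\<dots> = Zero C (Dom C k) (Cod C m)" using seq_comp[OF KS(1)] KS ok by simp
      finally show ?thesis unfolding K(5,6) .
    qed
    ultimately have k0: "k = Zero C (Dom C k) (Cod C k)"
      using lift_unique[OF seqI[OF S], of "Dom C k" k] KS by simp
    have vm: "m \<cdot> (e \<cdot> v) = Zero C (Dom C v) (Cod C m)"
      using comp_assoc[of v e m, unfolded K(6)] v KS by simp
    have "e \<cdot> v = Zero C (Dom C v) (Cod C e)"
      using heart_seq_mono_zero[OF K(2), of "e \<cdot> v"] vm v(1-3) KS by simp
    then obtain y where y: "y \<in> Arr C" "Dom C y = Dom C v" "Cod C y = Dom C k" "k \<cdot> y = v"
      using lift[OF KS(1), of v] v(1-3) KS by metis
    have "Zero C (Dom C k) (Cod C k) \<cdot> y = v" using y(4) k0 by simp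
    then show "v = Zero C (Dom C v) (Dom C ?\<phi>)" using y(1-3) KS by (simp add: heart_Obj)
  qed
  have Sh: "Cod C \<sigma> \<in> H" using heart_seq_simps[OF hphi] by simp
  have "Cod C b \<in> wge C w (i + 1 - 1)" using N(3) wge_mono by fastforce
  then have "Cod C \<sigma> \<in> wge C w (i + 1)" using w_ext(2)[OF eS M(3)] by simp
  then have np: "nice i ?\<phi> \<sigma>" using hphi Qw ph by (simp add: nice_def)
  have hr: "heart_seq r z" using rz r N M SZ Sh by (simp add: heart_seq_def)
  show ?thesis by (rule that[OF hl hr np]) (use ph SZ phs zb in auto)
qed

text \<open>A functor needs one fixed nice triangle for each object. The arrows are chosen in
  succession, each relative to the previous ones, so that the three belong to the same
  triangle.\<close>

definition left_part :: "int \<Rightarrow> 'o \<Rightarrow> 'm" where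
  "left_part i X = (SOME a. \<exists>b c. nice_decomp C t w i X a b c)"

definition right_part :: "int \<Rightarrow> 'o \<Rightarrow> 'm" where
  "right_part i X = (SOME b. \<exists>c. nice_decomp C t w i X (left_part i X) b c)"

definition boundary :: "int \<Rightarrow> 'o \<Rightarrow> 'm" where
  "boundary i X = (SOME c. nice_decomp C t w i X (left_part i X) (right_part i X) c)"

definition left_map :: "int \<Rightarrow> 'm \<Rightarrow> 'm" where
  "left_map i f = (SOME l. l \<in> Arr C \<and> Dom C l = Dom C (left_part i (Dom C f)) \<and>
     Cod C l = Dom C (left_part i (Cod C f)) \<and> left_part i (Cod C f) \<cdot> l = f \<cdot> left_part i (Dom C f))"

definition right_map :: "int \<Rightarrow> 'm \<Rightarrow> 'm" where
  "right_map i f = (SOME r. r \<in> Arr C \<and> Dom C r = Cod C (right_part i (Dom C f)) \<and>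
     Cod C r = Cod C (right_part i (Cod C f)) \<and> r \<cdot> right_part i (Dom C f) = right_part i (Cod C f) \<cdot> f)"

lemma parts_decomp:
  assumes "X \<in> H"
  shows "nice_decomp C t w i X (left_part i X) (right_part i X) (boundary i X)"
proof -
  have "\<exists>b c. nice_decomp C t w i X (left_part i X) b c"
    unfolding left_part_def by (rule someI_ex) (rule ex_nice[OF assms])
  then have "\<exists>c. nice_decomp C t w i X (left_part i X) (right_part i X) c"
    unfolding right_part_def by (rule someI_ex)
  then show ?thesis unfolding boundary_def by (rule someI_ex)
qed

lemma parts_nice:
  assumes "X \<in> H"
  shows "nice i (left_part i X) (right_part i X)" "Cod C (left_part i X) = X"
    "(left_part i X, right_part i X, boundary i X) \<in> Tri C"
  using parts_decomp[OF assms, of i] nice_iff[of i X "left_part i X" "right_part i X"]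
  by (auto simp: nice_decomp_def weight_decomp_def)

lemma left_map:
  assumes "f \<in> Arr C" "Dom C f \<in> H" "Cod C f \<in> H"
  shows "left_map i f \<in> Arr C" "Dom C (left_map i f) = Dom C (left_part i (Dom C f))"
     "Cod C (left_map i f) = Dom C (left_part i (Cod C f))"
     "left_part i (Cod C f) \<cdot> left_map i f = f \<cdot> left_part i (Dom C f)"
proof -
  note P = parts_nice[OF assms(2), of i] parts_nice[OF assms(3), of i]
  have "left_map i f \<in> Arr C \<and> Dom C (left_map i f) = Dom C (left_part i (Dom C f)) \<and>
     Cod C (left_map i f) = Dom C (left_part i (Cod C f)) \<and>
     left_part i (Cod C f) \<cdot> left_map i f = f \<cdot> left_part i (Dom C f)"
    unfolding left_map_def by (rule someI_ex) (rule nice_map(1)[OF P(1) P(4)], use P assms in simp_all)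
  then show "left_map i f \<in> Arr C" "Dom C (left_map i f) = Dom C (left_part i (Dom C f))"
     "Cod C (left_map i f) = Dom C (left_part i (Cod C f))"
     "left_part i (Cod C f) \<cdot> left_map i f = f \<cdot> left_part i (Dom C f)" by simp_all
qed

lemma right_map:
  assumes "f \<in> Arr C" "Dom C f \<in> H" "Cod C f \<in> H"
  shows "right_map i f \<in> Arr C" "Dom C (right_map i f) = Cod C (right_part i (Dom C f))"
     "Cod C (right_map i f) = Cod C (right_part i (Cod C f))"
     "right_map i f \<cdot> right_part i (Dom C f) = right_part i (Cod C f) \<cdot> f"
proof -
  note P = parts_nice[OF assms(2), of i] parts_nice[OF assms(3), of i]
  have "right_map i f \<in> Arr C \<and> Dom C (right_map i f) = Cod C (right_part i (Dom C f)) \<and>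
     Cod C (right_map i f) = Cod C (right_part i (Cod C f)) \<and>
     right_map i f \<cdot> right_part i (Dom C f) = right_part i (Cod C f) \<cdot> f"
    unfolding right_map_def by (rule someI_ex) (rule nice_map(2)[OF P(1) P(4)], use P assms in simp_all)
  then show "right_map i f \<in> Arr C" "Dom C (right_map i f) = Cod C (right_part i (Dom C f))"
     "Cod C (right_map i f) = Cod C (right_part i (Cod C f))"
     "right_map i f \<cdot> right_part i (Dom C f) = right_part i (Cod C f) \<cdot> f" by simp_all
qed

lemma left_map_eqI:
  assumes f: "f \<in> Arr C" "Dom C f \<in> H" "Cod C f \<in> H"
    and l: "l \<in> Arr C" "Dom C l = Dom C (left_part i (Dom C f))" "Cod C l = Dom C (left_part i (Cod C f))"
     "left_part i (Cod C f) \<cdot> l = f \<cdot> left_part i (Dom C f)"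
   shows "left_map i f = l"
proof -
  note N = parts_nice[OF f(3), of i] and M = parts_nice[OF f(2), of i]
  note d = heart_seq_simps(5)[OF nice_simps(1)[OF M(1)]]
  show ?thesis
    by (rule heart_seq_mono[OF nice_simps(1)[OF N(1)]]) (simp_all only: left_map[OF f] l d)
qed

lemma right_map_eqI:
  assumes f: "f \<in> Arr C" "Dom C f \<in> H" "Cod C f \<in> H"
    and r: "r \<in> Arr C" "Dom C r = Cod C (right_part i (Dom C f))" "Cod C r = Cod C (right_part i (Cod C f))"
     "r \<cdot> right_part i (Dom C f) = right_part i (Cod C f) \<cdot> f"
   shows "right_map i f = r"
proof -
  note N = parts_nice[OF f(3), of i] and M = parts_nice[OF f(2), of i]
  note d = heart_seq_simps(7)[OF nice_simps(1)[OF N(1)]]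
  show ?thesis
    by (rule heart_seq_epi[OF nice_simps(1)[OF M(1)]]) (simp_all only: right_map[OF f] r d)
qed

lemma parts_simps:
  assumes "X \<in> H"
  shows "left_part i X \<in> Arr C" "right_part i X \<in> Arr C" "Cod C (left_part i X) = X" "Dom C (right_part i X) = X"
    "Dom C (left_part i X) \<in> H" "Cod C (right_part i X) \<in> H" "boundary i X \<in> Arr C"
    "Dom C (boundary i X) = Cod C (right_part i X)" "Cod C (boundary i X) = ShO C 1 (Dom C (left_part i X))"
  using parts_nice[OF assms, of i] heart_seq_simps[OF nice_simps(1)[OF parts_nice(1)[OF assms, of i]]]
    Tri_simps[OF parts_nice(3)[OF assms, of i]] by simp_all

lemma left_functor:
  "additive_functor (Ht C t) (Ht C t) (\<lambda>X. Dom C (left_part i X)) (left_map i)"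
  unfolding additive_functor_def is_functor_def
proof (intro conjI ballI impI)
  fix X assume "X \<in> Obj (Ht C t)"
  then have X: "X \<in> H" "X \<in> Obj C" using heart_Obj by auto
  note P = parts_simps[OF X(1)]
  show "Dom C (left_part i X) \<in> Obj (Ht C t)" using P by simp
  then show "left_map i (Ident (Ht C t) X) = Ident (Ht C t) (Dom C (left_part i X))"
    using X P by (intro left_map_eqI) (auto simp: heart_Obj)
next
  fix f assume "f \<in> Arr (Ht C t)"
  then have f: "f \<in> Arr C" "Dom C f \<in> H" "Cod C f \<in> H" by auto
  note P = parts_simps[OF f(2), of i] parts_simps[OF f(3), of i] left_map[OF f, of i]
  show "left_map i f \<in> Hom (Ht C t) (Dom C (left_part i (Dom (Ht C t) f))) (Dom C (left_part i (Cod (Ht C t) f)))"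
    using P by simp
  {
    fix g assume "g \<in> Arr (Ht C t)" "Cod (Ht C t) f = Dom (Ht C t) g"
    then have g: "g \<in> Arr C" "Dom C g \<in> H" "Cod C g \<in> H" "Cod C f = Dom C g" by auto
    note Q = parts_simps[OF g(3), of i] left_map[OF g(1-3), of i]
    have "left_map i (g \<cdot> f) = left_map i g \<cdot> left_map i f"
    proof (rule left_map_eqI)
      have "left_part i (Cod C g) \<cdot> (left_map i g \<cdot> left_map i f) = (g \<cdot> left_part i (Dom C g)) \<cdot> left_map i f"
        using P Q g f by (simp flip: comp_assoc)
      also have "\<dots> = g \<cdot> (f \<cdot> left_part i (Dom C f))" using P g f by (simp add: comp_assoc)
      finally show "left_part i (Cod C (g \<cdot> f)) \<cdot> (left_map i g \<cdot> left_map i f) = (g \<cdot> f) \<cdot> left_part i (Dom C (g \<cdot> f))"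
        using P Q f g by (simp add: comp_assoc)
    qed (use P Q f g in auto)
    then show "left_map i (g \<cdot>\<^bsub>Ht C t\<^esub> f) = left_map i g \<cdot>\<^bsub>Ht C t\<^esub> left_map i f" by simp
  next
    fix g assume "g \<in> Hom (Ht C t) (Dom (Ht C t) f) (Cod (Ht C t) f)"
    then have g: "g \<in> Arr C" "Dom C g = Dom C f" "Cod C g = Cod C f" by auto
    have Q: "left_map i g \<in> Arr C" "Dom C (left_map i g) = Dom C (left_part i (Dom C f))"
     "Cod C (left_map i g) = Dom C (left_part i (Cod C f))"
     "left_part i (Cod C f) \<cdot> left_map i g = g \<cdot> left_part i (Dom C f)"
      using left_map[of g i] g f by simp_all
    have "left_map i (Plus C f g) = Plus C (left_map i f) (left_map i g)"
      by (rule left_map_eqI) (use P Q f g in \<open>simp_all add: comp_Plus Plus_comp\<close>)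
    then show "left_map i (Plus (Ht C t) f g) = Plus (Ht C t) (left_map i f) (left_map i g)" by simp
  }
qed

lemma right_functor:
  "additive_functor (Ht C t) (Ht C t) (\<lambda>X. Cod C (right_part i X)) (right_map i)"
  unfolding additive_functor_def is_functor_def
proof (intro conjI ballI impI)
  fix X assume "X \<in> Obj (Ht C t)"
  then have X: "X \<in> H" "X \<in> Obj C" using heart_Obj by auto
  note P = parts_simps[OF X(1)]
  show "Cod C (right_part i X) \<in> Obj (Ht C t)" using P by simp
  then show "right_map i (Ident (Ht C t) X) = Ident (Ht C t) (Cod C (right_part i X))"
    using X P by (intro right_map_eqI) (auto simp: heart_Obj)
next
  fix f assume "f \<in> Arr (Ht C t)"
  then have f: "f \<in> Arr C" "Dom C f \<in> H" "Cod C f \<in> H" by auto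
  note P = parts_simps[OF f(2), of i] parts_simps[OF f(3), of i] right_map[OF f, of i]
  show "right_map i f \<in> Hom (Ht C t) (Cod C (right_part i (Dom (Ht C t) f))) (Cod C (right_part i (Cod (Ht C t) f)))"
    using P by simp
  {
    fix g assume "g \<in> Arr (Ht C t)" "Cod (Ht C t) f = Dom (Ht C t) g"
    then have g: "g \<in> Arr C" "Dom C g \<in> H" "Cod C g \<in> H" "Cod C f = Dom C g" by auto
    note Q = parts_simps[OF g(3), of i] right_map[OF g(1-3), of i]
    have "right_map i (g \<cdot> f) = right_map i g \<cdot> right_map i f"
    proof (rule right_map_eqI)
      have "(right_map i g \<cdot> right_map i f) \<cdot> right_part i (Dom C f) = right_map i g \<cdot> (right_part i (Dom C g) \<cdot> f)"
        using P Q g f by (simp add: comp_assoc)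
      also have "\<dots> = (right_part i (Cod C g) \<cdot> g) \<cdot> f" using P Q g f by (simp flip: comp_assoc)
      finally show "(right_map i g \<cdot> right_map i f) \<cdot> right_part i (Dom C (g \<cdot> f)) = right_part i (Cod C (g \<cdot> f)) \<cdot> (g \<cdot> f)"
        using P Q f g by (simp add: comp_assoc)
    qed (use P Q f g in auto)
    then show "right_map i (g \<cdot>\<^bsub>Ht C t\<^esub> f) = right_map i g \<cdot>\<^bsub>Ht C t\<^esub> right_map i f" by simp
  next
    fix g assume "g \<in> Hom (Ht C t) (Dom (Ht C t) f) (Cod (Ht C t) f)"
    then have g: "g \<in> Arr C" "Dom C g = Dom C f" "Cod C g = Cod C f" by auto
    have Q: "right_map i g \<in> Arr C" "Dom C (right_map i g) = Cod C (right_part i (Dom C f))"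
     "Cod C (right_map i g) = Cod C (right_part i (Cod C f))"
     "right_map i g \<cdot> right_part i (Dom C f) = right_part i (Cod C f) \<cdot> g"
      using right_map[of g i] g f by simp_all
    have "right_map i (Plus C f g) = Plus C (right_map i f) (right_map i g)"
      by (rule right_map_eqI) (use P Q f g in \<open>simp_all add: comp_Plus Plus_comp\<close>)
    then show "right_map i (Plus (Ht C t) f g) = Plus (Ht C t) (right_map i f) (right_map i g)" by simp
  }
qed

text \<open>\<open>nice_cokernel\<close> makes the cokernels of the induced maps the outer terms of
  a nice decomposition of the quotient. By uniqueness it agrees with the chosen one, and the
  isomorphisms turn the cokernel maps into \<open>left_map i g\<close> and
  \<open>right_map i g\<close>.\<close>

lemma parts_exact:
  assumes "short_exact (Ht C t) f g"
  shows "short_exact (Ht C t) (left_map i f) (left_map i g)" "short_exact (Ht C t) (right_map i f) (right_map i g)"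
proof -
  have fg: "heart_seq f g" by (rule short_exact_heart_seq[OF assms])
  note F = heart_seq_simps[OF fg]
  have g: "Dom C g \<in> H" using F by simp
  note X = parts_nice[OF F(5), of i] parts_simps[OF F(5), of i]
  note Y = parts_nice[OF F(6), of i] parts_simps[OF F(6), of i]
  note Z = parts_nice[OF F(7), of i] parts_simps[OF F(7), of i]
  note L = left_map[OF F(2,5,6), of i] and R = right_map[OF F(2,5,6), of i]
  obtain s \<phi> \<sigma> s' where S: "heart_seq (left_map i f) s" "heart_seq (right_map i f) s'" "nice i \<phi> \<sigma>" "Cod C \<phi> = Cod C g"
    "Dom C \<phi> = Cod C s" "Cod C \<sigma> = Cod C s'" "\<phi> \<cdot> s = g \<cdot> left_part i (Cod C f)" "s' \<cdot> right_part i (Cod C f) = \<sigma> \<cdot> g"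
    by (rule nice_cokernel[OF fg X(1,2) Y(1,2) L R])
  have z: "Cod C \<phi> = Cod C (left_part i (Cod C g))" using S Z by simp
  obtain v v' where v: "inverse_pair v v'" "Dom C v = Dom C \<phi>" "Cod C v = Dom C (left_part i (Cod C g))"
    "left_part i (Cod C g) \<cdot> v = \<phi>"
    using nice_unique(1)[OF S(3) Z(1) z] by blast
  obtain u u' where u: "inverse_pair u u'" "Dom C u = Cod C \<sigma>" "Cod C u = Cod C (right_part i (Cod C g))"
    "u \<cdot> \<sigma> = right_part i (Cod C g)"
    using nice_unique(2)[OF S(3) Z(1) z] by blast
  have vA: "v \<in> Arr C" "u \<in> Arr C" using v u by (auto simp: inverse_pair_def)
  note S1 = heart_seq_simps[OF S(1)] and S2 = heart_seq_simps[OF S(2)] and S3 = heart_seq_simps[OF nice_simps(1)[OF S(3)]]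
  have "left_map i g = v \<cdot> s"
  proof (rule left_map_eqI[OF F(3) g F(7)])
    have "left_part i (Cod C g) \<cdot> (v \<cdot> s) = \<phi> \<cdot> s" using v vA S1 Z S by (simp flip: comp_assoc)
    then show "left_part i (Cod C g) \<cdot> (v \<cdot> s) = g \<cdot> left_part i (Dom C g)" using S F by simp
  qed (use v vA S1 S L F in auto)
  moreover have "seq (left_map i f) (v \<cdot> s)" by (rule seq_change_cod[OF S1(1) v(1)]) (use v S in simp)
  ultimately have "heart_seq (left_map i f) (left_map i g)"
    using S1 v vA Z S by (simp add: heart_seq_def)
  then show "short_exact (Ht C t) (left_map i f) (left_map i g)" by (rule heart_seq_short_exact)
  have "right_map i g = u \<cdot> s'"
  proof (rule right_map_eqI[OF F(3) g F(7)])
    have "(u \<cdot> s') \<cdot> right_part i (Cod C f) = u \<cdot> (\<sigma> \<cdot> g)" using u vA S2 Y S R by (simp add: comp_assoc)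
    also have "\<dots> = right_part i (Cod C g) \<cdot> g" using u vA S3 F S by (simp flip: comp_assoc)
    finally show "(u \<cdot> s') \<cdot> right_part i (Dom C g) = right_part i (Cod C g) \<cdot> g" using F by simp
  qed (use u vA S2 S R F in auto)
  moreover have "seq (right_map i f) (u \<cdot> s')" by (rule seq_change_cod[OF S2(1) u(1)]) (use u S in simp)
  ultimately have "heart_seq (right_map i f) (right_map i g)"
    using S2 u vA Z S by (simp add: heart_seq_def)
  then show "short_exact (Ht C t) (right_map i f) (right_map i g)" by (rule heart_seq_short_exact)
qed

text \<open>The axioms extend \<open>left_map i f\<close> and \<open>f\<close> to a morphism of
  triangles with some third component; that component satisfies the equation characterising
  \<open>right_map i f\<close>, so it is that arrow.\<close>

lemma boundary_natural:
  assumes f: "f \<in> Arr C" "Dom C f \<in> H" "Cod C f \<in> H"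
  shows "ShM C 1 (left_map i f) \<cdot> boundary i (Dom C f) = boundary i (Cod C f) \<cdot> right_map i f"
proof -
  note P = parts_simps[OF f(2), of i] parts_simps[OF f(3), of i] and L = left_map[OF f, of i]
  obtain r where r: "r \<in> Arr C" "Dom C r = Cod C (right_part i (Dom C f))" "Cod C r = Cod C (right_part i (Cod C f))"
    "r \<cdot> right_part i (Dom C f) = right_part i (Cod C f) \<cdot> f"
    "ShM C 1 (left_map i f) \<cdot> boundary i (Dom C f) = boundary i (Cod C f) \<cdot> r"
    using Tri_morphism[OF parts_nice(3)[OF f(2), of i] parts_nice(3)[OF f(3), of i], of "left_map i f" f] P L f
    by auto
  then show ?thesis using right_map_eqI[OF f r(1-4)] by simp
qed

lemma functorial_nice:
  "\<exists>L LM R RM. functorial_nice_decomp C t w i L LM R RM \<and>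
     exact_functor (Ht C t) (Ht C t) L LM \<and> exact_functor (Ht C t) (Ht C t) R RM"
proof (intro exI conjI)
  show "functorial_nice_decomp C t w i (\<lambda>X. Dom C (left_part i X)) (left_map i)
      (\<lambda>X. Cod C (right_part i X)) (right_map i)"
    unfolding functorial_nice_decomp_def
  proof (intro conjI exI ballI)
    show "is_functor (Ht C t) (Ht C t) (\<lambda>X. Dom C (left_part i X)) (left_map i)"
      "is_functor (Ht C t) (Ht C t) (\<lambda>X. Cod C (right_part i X)) (right_map i)"
      using left_functor right_functor by (simp_all add: additive_functor_def)
    show "nice_decomp C t w i X (left_part i X) (right_part i X) (boundary i X)" if "X \<in> H" for X
      by (rule parts_decomp[OF that])
    fix X Y f assume "X \<in> H" "Y \<in> H" "f \<in> Hom C X Y"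
    then have f: "f \<in> Arr C" "Dom C f \<in> H" "Cod C f \<in> H" "Dom C f = X" "Cod C f = Y" by auto
    show "f \<cdot> left_part i X = left_part i Y \<cdot> left_map i f"
      "right_map i f \<cdot> right_part i X = right_part i Y \<cdot> f"
      "ShM C 1 (left_map i f) \<cdot> boundary i X = boundary i Y \<cdot> right_map i f"
      using left_map(4)[OF f(1-3), of i] right_map(4)[OF f(1-3), of i] boundary_natural[OF f(1-3), of i] f
      by simp_all
  qed simp_all
  show "exact_functor (Ht C t) (Ht C t) (\<lambda>X. Dom C (left_part i X)) (left_map i)"
    "exact_functor (Ht C t) (Ht C t) (\<lambda>X. Cod C (right_part i X)) (right_map i)"
    unfolding exact_functor_def using left_functor right_functor parts_exact by blast+
qed

end

section \<open>Semi-orthogonal families\<close>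

locale family = triangulated_category C for C :: "('o, 'm, 'z) tricat_scheme" (structure) +
  fixes A :: "int \<Rightarrow> 'o set"
  assumes so: "semi_orthogonal C A"
begin

lemma A_additive: "additive_sub C (A i)"
  using so by (simp add: semi_orthogonal_def)

lemma A_sub: "A i \<subseteq> Obj C"
  using A_additive by (simp add: additive_sub_def)

lemma A_Obj: "X \<in> A i \<Longrightarrow> X \<in> Obj C"
  using A_sub by blast

lemma A_zero: "\<exists>Z \<in> A i. is_zero C Z"
  by (rule additive_sub_zero[OF A_additive])

lemma A_orth:
  assumes "X \<in> A i" "Y \<in> A j" "s < 0 \<or> s > i - j"
  shows "orth X (ShO C s Y)"
proof -
  have "perp C (A i) (shift_class C (A j) s)" using so assms(3) unfolding semi_orthogonal_def by blast
  then have "\<forall>X \<in> A i. \<forall>Y \<in> shift_class C (A j) s. orth X Y"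
    using perp_iff[OF A_sub shift_class_Obj[OF A_sub]] by blast
  moreover have "ShO C s Y \<in> shift_class C (A j) s" using assms(2) by (simp add: shift_class_def)
  ultimately show ?thesis using assms(1) by blast
qed

text \<open>A pair \<open>(i, j)\<close> stands for the objects of \<open>A\<^sub>i[j]\<close>, of
  weight \<open>i + j\<close> and cohomological degree \<open>-j\<close>. Bounds on weights and
  degrees become regions of the index plane.\<close>

definition gen :: "(int \<times> int) set \<Rightarrow> 'o set" where
  "gen S = (\<Union>(i, j) \<in> S. shift_class C (A i) j)"

lemma gen_iff: "X \<in> gen S \<longleftrightarrow> (\<exists>i j M. (i, j) \<in> S \<and> M \<in> A i \<and> X = ShO C j M)"
  unfolding gen_def shift_class_def by auto

lemma gen_sub: "gen S \<subseteq> Obj C"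
  using A_Obj by (auto simp: gen_iff)

lemma gen_mono: "S \<subseteq> S' \<Longrightarrow> gen S \<subseteq> gen S'"
  unfolding gen_def by blast

lemma gen_Un: "gen (S \<union> S') = gen S \<union> gen S'"
  by (auto simp: gen_def)

lemma gen_shift:
  assumes "X \<in> gen S" "\<And>i j. (i, j) \<in> S \<Longrightarrow> (i, j + n) \<in> S'"
  shows "ShO C n X \<in> gen S'"
proof -
  obtain i j M where M: "(i, j) \<in> S" "M \<in> A i" "X = ShO C j M" using assms(1) gen_iff by blast
  then have "ShO C n X = ShO C (j + n) M" using A_Obj by (simp add: add.commute)
  then show ?thesis using assms(2) M gen_iff by blast
qed

lemma zero_shift: "is_zero C Z \<Longrightarrow> is_zero C (ShO C n Z)"
  by (auto simp: is_zero_iff simp flip: ShM_Ident)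

lemma gen_zero:
  assumes "S \<noteq> {}" shows "\<exists>Z \<in> gen S. is_zero C Z"
proof -
  obtain i j where ij: "(i, j) \<in> S" using assms by auto
  obtain Z where "Z \<in> A i" "is_zero C Z" using A_zero by blast
  then have "ShO C j Z \<in> gen S" "is_zero C (ShO C j Z)" using ij gen_iff zero_shift by auto
  then show ?thesis by blast
qed

text \<open>Shifting by \<open>-j\<close> reduces the claim to arrows from \<open>A\<^sub>i\<close>
  to \<open>A\<^sub>k[l - j]\<close>; semi-orthogonality excludes them for l - j < 0 and for l - j >
  i - k.\<close>

lemma gen_orth:
  assumes "X \<in> gen S" "Y \<in> gen S'" "\<And>i j k l. (i, j) \<in> S \<Longrightarrow> (k, l) \<in> S' \<Longrightarrow> l < j \<or> l + k > i + j"
  shows "orth X Y"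
proof -
  obtain i j M where M: "(i, j) \<in> S" "M \<in> A i" "X = ShO C j M" using assms(1) gen_iff by blast
  obtain k l N where N: "(k, l) \<in> S'" "N \<in> A k" "Y = ShO C l N" using assms(2) gen_iff by blast
  have "l - j < 0 \<or> l - j > i - k" using assms(3)[OF M(1) N(1)] by linarith
  then have "orth M (ShO C (l - j) N)" by (rule A_orth[OF M(2) N(2)])
  then have "orth (ShO C j M) (ShO C j (ShO C (l - j) N))" using M N A_Obj by (intro orth_shift) auto
  then show ?thesis using M N A_Obj by simp
qed

abbreviation env :: "(int \<times> int) set \<Rightarrow> 'o set" where
  "env S \<equiv> envelope C (gen S)"

lemma env_sub: "env S \<subseteq> Obj C"
  by (rule envelope_Obj[OF gen_sub])

lemma env_mono: "S \<subseteq> S' \<Longrightarrow> env S \<subseteq> env S'"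
  by (rule envelope_mono[OF gen_mono])

lemma env_shift:
  assumes "X \<in> env S" "\<And>i j. (i, j) \<in> S \<Longrightarrow> (i, j + n) \<in> S'"
  shows "ShO C n X \<in> env S'"
  using assms(1) gen_sub
proof (induction rule: envelope_induct)
  case (base X)
  then show ?case using gen_shift[OF _ assms(2)] envelope_base by blast
next
  case (ext X Y Z)
  then show ?case using envelope_ext[OF ext_shift] by blast
qed

lemma env_iso: "X \<in> env S \<Longrightarrow> isomorphic X Y \<Longrightarrow> S \<noteq> {} \<Longrightarrow> Y \<in> env S"
  using envelope_iso[OF _ _ gen_sub gen_zero] by blast

lemma envelope_orth_left:
  assumes "X \<in> envelope C D" "D \<subseteq> Obj C" "\<And>X. X \<in> D \<Longrightarrow> orth X T"
  shows "orth X T"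
  using assms(1,2) by (induction rule: envelope_induct) (use assms(3) orth_ext(1) in blast)+

lemma envelope_orth_right:
  assumes "X \<in> envelope C D" "D \<subseteq> Obj C" "\<And>X. X \<in> D \<Longrightarrow> orth T X"
  shows "orth T X"
  using assms(1,2) by (induction rule: envelope_induct) (use assms(3) orth_ext(2) in blast)+

text \<open>If \<open>D\<^sub>1\<close> can be moved past \<open>D\<^sub>2\<close> to the left, then so can their envelopes, because \<open>star\<close> is
  associative; hence all generators from \<open>D\<^sub>1\<close> can be collected on the left.\<close>

lemma envelope_sort:
  assumes D: "D1 \<subseteq> Obj C" "D2 \<subseteq> Obj C" "\<exists>Z \<in> D1. is_zero C Z" "\<exists>Z \<in> D2. is_zero C Z"
    and sw: "star D2 D1 \<subseteq> star (envelope C D1) D2"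
  shows "envelope C (D1 \<union> D2) \<subseteq> star (envelope C D1) (envelope C D2)"
proof -
  let ?P = "envelope C D1" and ?Q = "envelope C D2"
  have PO: "?P \<subseteq> Obj C" "?Q \<subseteq> Obj C" using D envelope_Obj by auto
  have a: "star D2 {Z} \<subseteq> star ?P D2" if "Z \<in> ?P" for Z
    using that D(1)
  proof (induction rule: envelope_induct)
    case (base Z)
    then have "star D2 {Z} \<subseteq> star D2 D1" by (intro star_mono) auto
    then show ?case using sw by blast
  next
    case (ext X Y Z)
    have "star D2 {Y} \<subseteq> star D2 (star {X} {Z})" using ext(1) by (intro star_mono) (auto simp: star_def)
    also have "\<dots> = star (star D2 {X}) {Z}" by (simp add: star_assoc)
    also have "\<dots> \<subseteq> star (star ?P D2) {Z}" by (rule star_mono[OF ext(2) subset_refl])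
    also have "\<dots> = star ?P (star D2 {Z})" by (simp add: star_assoc)
    also have "\<dots> \<subseteq> star ?P (star ?P D2)" by (rule star_mono[OF subset_refl ext(3)])
    also have "\<dots> = star (star ?P ?P) D2" by (simp add: star_assoc)
    also have "\<dots> \<subseteq> star ?P D2" by (intro star_mono envelope_star) simp
    finally show ?case .
  qed
  have a': "star D2 ?P \<subseteq> star ?P D2"
  proof
    fix Y assume "Y \<in> star D2 ?P"
    then obtain X Z where "X \<in> D2" "Z \<in> ?P" "ext X Y Z" by (auto simp: star_def)
    then show "Y \<in> star ?P D2" using a[of Z] by (auto simp: star_def)
  qed
  have b: "star {X} ?P \<subseteq> star ?P ?Q" if "X \<in> ?Q" for X
    using that D(2)
  proof (induction rule: envelope_induct)
    case (base X)
    then have "star {X} ?P \<subseteq> star D2 ?P" by (intro star_mono) auto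
    also have "\<dots> \<subseteq> star ?P ?Q" using a' star_mono[OF subset_refl envelope_base] by blast
    finally show ?case .
  next
    case (ext X Y Z)
    have "star {Y} ?P \<subseteq> star (star {X} {Z}) ?P" using ext(1) by (intro star_mono) (auto simp: star_def)
    also have "\<dots> = star {X} (star {Z} ?P)" by (rule star_assoc)
    also have "\<dots> \<subseteq> star {X} (star ?P ?Q)" by (rule star_mono[OF subset_refl ext(3)])
    also have "\<dots> = star (star {X} ?P) ?Q" by (simp add: star_assoc)
    also have "\<dots> \<subseteq> star (star ?P ?Q) ?Q" by (rule star_mono[OF ext(2) subset_refl])
    also have "\<dots> = star ?P (star ?Q ?Q)" by (rule star_assoc)
    also have "\<dots> \<subseteq> star ?P ?Q" by (intro star_mono envelope_star) simp
    finally show ?case .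
  qed
  have b': "star ?Q ?P \<subseteq> star ?P ?Q"
  proof
    fix Y assume "Y \<in> star ?Q ?P"
    then obtain X Z where "X \<in> ?Q" "Z \<in> ?P" "ext X Y Z" by (auto simp: star_def)
    then show "Y \<in> star ?P ?Q" using b[of X] by (auto simp: star_def)
  qed
  have "star (star ?P ?Q) (star ?P ?Q) = star ?P (star (star ?Q ?P) ?Q)" by (simp add: star_assoc)
  also have "\<dots> \<subseteq> star ?P (star (star ?P ?Q) ?Q)" by (rule star_mono[OF subset_refl star_mono[OF b' subset_refl]])
  also have "\<dots> = star (star ?P ?P) (star ?Q ?Q)" by (simp add: star_assoc)
  also have "\<dots> \<subseteq> star ?P ?Q" by (intro star_mono envelope_star)
  finally have st: "ext_stable C (star ?P ?Q)" by (simp add: ext_stable_star)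
  have "star ?P ?Q \<subseteq> Obj C" using ext_Obj(2) by (auto simp: star_def)
  moreover have "D1 \<subseteq> star ?P ?Q"
  proof
    fix X assume X: "X \<in> D1"
    obtain Z where Z: "Z \<in> D2" "is_zero C Z" using D by blast
    have "ext X X Z" using ext_zero(1) X D(1) Z(2) by blast
    then show "X \<in> star ?P ?Q" using X Z envelope_base unfolding star_def by blast
  qed
  moreover have "D2 \<subseteq> star ?P ?Q"
  proof
    fix X assume X: "X \<in> D2"
    obtain Z where Z: "Z \<in> D1" "is_zero C Z" using D by blast
    have "ext Z X X" using ext_zero(2) X D(2) Z(2) by blast
    then show "X \<in> star ?P ?Q" using X Z envelope_base unfolding star_def by blast
  qed
  ultimately show ?thesis using st by (intro envelope_least) auto
qed

lemma star_swap_orth: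
  assumes "\<And>X Y. X \<in> D1 \<Longrightarrow> Y \<in> D2 \<Longrightarrow> orth X (ShO C 1 Y)"
  shows "star D2 D1 \<subseteq> star (envelope C D1) D2"
proof
  fix Y assume "Y \<in> star D2 D1"
  then obtain X Z where XZ: "X \<in> D2" "Z \<in> D1" "ext X Y Z" by (auto simp: star_def)
  then have "ext Z Y X" using ext_split_swap[OF XZ(3) assms] by simp
  moreover have "Z \<in> envelope C D1" using XZ(2) envelope_base by blast
  ultimately show "Y \<in> star (envelope C D1) D2" using XZ(1) by (auto simp: star_def)
qed

section \<open>The weight structure generated by the family\<close>

definition le_gen :: "int \<Rightarrow> (int \<times> int) set" where "le_gen n = {(i, j). i + j \<le> n}"
definition ge_gen :: "int \<Rightarrow> (int \<times> int) set" where "ge_gen n = {(i, j). i + j \<ge> n}"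

text \<open>An arrow from a generator of weight at most \<open>n\<close> to the [1]-shift of one of
  weight at least \<open>n + 1\<close> would raise the weight, so the swap is free. The region
  \<open>S\<close> is kept arbitrary: with \<open>nonneg\<close> and \<open>nonpos\<close> the
  sorting stays inside one class of the t-structure.\<close>

lemma weight_sort:
  assumes "S \<inter> le_gen n \<noteq> {}" "S \<inter> ge_gen (n + 1) \<noteq> {}"
  shows "env S \<subseteq> star (env (S \<inter> le_gen n)) (env (S \<inter> ge_gen (n + 1)))"
proof -
  have "S = (S \<inter> le_gen n) \<union> (S \<inter> ge_gen (n + 1))" by (auto simp: le_gen_def ge_gen_def)
  then have e: "gen S = gen (S \<inter> le_gen n) \<union> gen (S \<inter> ge_gen (n + 1))" using gen_Un by metis
  show ?thesis unfolding e
  proof (rule envelope_sort)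
    show "star (gen (S \<inter> ge_gen (n + 1))) (gen (S \<inter> le_gen n)) \<subseteq> star (env (S \<inter> le_gen n)) (gen (S \<inter> ge_gen (n + 1)))"
    proof (rule star_swap_orth)
      fix X Y assume XY: "X \<in> gen (S \<inter> le_gen n)" "Y \<in> gen (S \<inter> ge_gen (n + 1))"
      have "ShO C 1 Y \<in> gen (ge_gen (n + 2))" by (rule gen_shift[OF XY(2)]) (auto simp: ge_gen_def)
      then show "orth X (ShO C 1 Y)" by (rule gen_orth[OF XY(1)]) (auto simp: ge_gen_def le_gen_def)
    qed
  qed (use gen_sub gen_zero assms in auto)
qed

text \<open>The classes are orthogonals of the generators of positive and of negative weight. Unlike
  envelopes, these are visibly closed under retracts and sums; that they are orthogonal to each
  other after a shift must then be extracted from the decompositions.\<close>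

definition gen_w :: "'o set \<times> 'o set" where
  "gen_w = ({X \<in> Obj C. \<forall>Y \<in> gen (ge_gen 1). orth X Y}, {Y \<in> Obj C. \<forall>X \<in> gen (le_gen (-1)). orth X Y})"

lemma wle_gen_w: "wle C gen_w n = {X \<in> Obj C. \<forall>Y \<in> gen (ge_gen (n + 1)). orth X Y}"
proof -
  have s: "fst gen_w \<subseteq> Obj C" by (auto simp: gen_w_def)
  have 1: "(\<forall>Y \<in> gen (ge_gen 1). orth (ShO C (-n) X) Y) \<longleftrightarrow> (\<forall>Y \<in> gen (ge_gen (n + 1)). orth X Y)"
    if X: "X \<in> Obj C" for X
  proof (intro iffI ballI)
    fix Y assume A: "\<forall>Y \<in> gen (ge_gen 1). orth (ShO C (-n) X) Y" and Y: "Y \<in> gen (ge_gen (n + 1))"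
    have "ShO C (-n) Y \<in> gen (ge_gen 1)" by (rule gen_shift[OF Y]) (auto simp: ge_gen_def)
    then have "orth (ShO C (-n) X) (ShO C (-n) Y)" using A by blast
    moreover have "Y \<in> Obj C" using Y gen_sub by blast
    ultimately show "orth X Y" using orth_shift_iff[of X "ShO C (-n) Y" "-n"] X by simp
  next
    fix Y assume A: "\<forall>Y \<in> gen (ge_gen (n + 1)). orth X Y" and Y: "Y \<in> gen (ge_gen 1)"
    have "ShO C n Y \<in> gen (ge_gen (n + 1))" by (rule gen_shift[OF Y]) (auto simp: ge_gen_def)
    moreover have "Y \<in> Obj C" using Y gen_sub by blast
    ultimately show "orth (ShO C (-n) X) Y" using A X orth_shift_iff[of X Y "-n"] by simp
  qed
  show ?thesis unfolding wle_def using 1 s by (auto simp: shift_class_iff) (auto simp: gen_w_def)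
qed

lemma wge_gen_w: "wge C gen_w n = {Y \<in> Obj C. \<forall>X \<in> gen (le_gen (n - 1)). orth X Y}"
proof -
  have s: "snd gen_w \<subseteq> Obj C" by (auto simp: gen_w_def)
  have 1: "(\<forall>X \<in> gen (le_gen (-1)). orth X (ShO C (-n) Y)) \<longleftrightarrow> (\<forall>X \<in> gen (le_gen (n - 1)). orth X Y)"
    if Y: "Y \<in> Obj C" for Y
  proof (intro iffI ballI)
    fix X assume A: "\<forall>X \<in> gen (le_gen (-1)). orth X (ShO C (-n) Y)" and X: "X \<in> gen (le_gen (n - 1))"
    have "ShO C (-n) X \<in> gen (le_gen (-1))" by (rule gen_shift[OF X]) (auto simp: le_gen_def)
    then have "orth (ShO C (-n) X) (ShO C (-n) Y)" using A by blast
    moreover have "X \<in> Obj C" using X gen_sub by blast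
    ultimately show "orth X Y" using orth_shift_iff[of X "ShO C (-n) Y" "-n"] Y by simp
  next
    fix X assume A: "\<forall>X \<in> gen (le_gen (n - 1)). orth X Y" and X: "X \<in> gen (le_gen (-1))"
    have "ShO C n X \<in> gen (le_gen (n - 1))" by (rule gen_shift[OF X]) (auto simp: le_gen_def)
    moreover have "X \<in> Obj C" using X gen_sub by blast
    ultimately show "orth X (ShO C (-n) Y)" using A Y orth_shift_iff[of X Y n] by simp
  qed
  show ?thesis unfolding wge_def using 1 s by (auto simp: shift_class_iff) (auto simp: gen_w_def)
qed

lemma env_wle: "S \<subseteq> le_gen n \<Longrightarrow> env S \<subseteq> wle C gen_w n"
  unfolding wle_gen_w
proof (intro subsetI CollectI conjI ballI)
  fix X Y assume S: "S \<subseteq> le_gen n" and X: "X \<in> env S" and Y: "Y \<in> gen (ge_gen (n + 1))"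
  show "orth X Y"
    by (rule envelope_orth_left[OF X gen_sub], rule gen_orth[OF _ Y]) (use S in \<open>auto simp: le_gen_def ge_gen_def\<close>)
qed (use env_sub in auto)

lemma env_wge: "S \<subseteq> ge_gen n \<Longrightarrow> env S \<subseteq> wge C gen_w n"
  unfolding wge_gen_w
proof (intro subsetI CollectI conjI ballI)
  fix X Y assume S: "S \<subseteq> ge_gen n" and X: "X \<in> env S" and Y: "Y \<in> gen (le_gen (n - 1))"
  show "orth Y X"
    by (rule envelope_orth_right[OF X gen_sub], rule gen_orth[OF Y]) (use S in \<open>auto simp: le_gen_def ge_gen_def\<close>)
qed (use env_sub in auto)

lemma starE:
  assumes "X \<in> star D E" obtains a b where "seq a b" "Cod C a = X" "Dom C a \<in> D" "Cod C b \<in> E"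
  using assms by (auto simp: star_def ext_def)

lemma weight_decomposition:
  assumes full: "env UNIV = Obj C" and X: "X \<in> Obj C"
  obtains a b where "seq a b" "Cod C a = X" "Dom C a \<in> env (le_gen n)" "Cod C b \<in> env (ge_gen (n + 1))"
proof -
  have "(n, 0) \<in> le_gen n" "(n + 1, 0) \<in> ge_gen (n + 1)" by (simp_all add: le_gen_def ge_gen_def)
  then have "X \<in> star (env (le_gen n)) (env (ge_gen (n + 1)))" using weight_sort[of UNIV n] full X by auto
  then show ?thesis using that by (rule starE)
qed

lemma gen_w_weight_structure:
  assumes full: "env UNIV = Obj C"
  shows "weight_structure C gen_w"
  unfolding weight_structure_def
proof (intro conjI ballI)
  show s: "fst gen_w \<subseteq> Obj C" "snd gen_w \<subseteq> Obj C" by (auto simp: gen_w_def)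
  have rO: "X \<in> Obj C" if "retract X Y" for X Y using that by (auto simp: retract_def)
  show "retract_closed C (fst gen_w)" "retract_closed C (snd gen_w)"
  proof -
    have "X \<in> fst gen_w" if "retract X Y" "Y \<in> fst gen_w" for X Y
      using that(2) rO[OF that(1)] orth_retract_left[OF _ that(1)] by (simp add: gen_w_def)
    then show "retract_closed C (fst gen_w)" unfolding retract_closed_iff[OF s(1)] by metis
    have "X \<in> snd gen_w" if "retract X Y" "Y \<in> snd gen_w" for X Y
      using that(2) rO[OF that(1)] orth_retract_right[OF _ that(1)] by (simp add: gen_w_def)
    then show "retract_closed C (snd gen_w)" unfolding retract_closed_iff[OF s(2)] by metis
  qed
  have zO: "Z \<in> Obj C" if "is_zero C Z" for Z using that by (simp add: is_zero_iff)
  show "sum_closed C (fst gen_w)" "sum_closed C (snd gen_w)"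
    unfolding sum_closed_def is_biproduct_iff gen_w_def using zO orth_zero orth_biproduct by auto
  show "wle C gen_w 0 \<subseteq> wle C gen_w 1"
  proof -
    have "ge_gen 2 \<subseteq> ge_gen 1" by (auto simp: ge_gen_def)
    from gen_mono[OF this] show ?thesis unfolding wle_gen_w by auto
  qed
  show "wge C gen_w 1 \<subseteq> wge C gen_w 0"
  proof -
    have "le_gen (-1) \<subseteq> le_gen 0" by (auto simp: le_gen_def)
    from gen_mono[OF this] show ?thesis unfolding wge_gen_w by auto
  qed
  have wO: "wle C gen_w 0 \<subseteq> Obj C" "wge C gen_w 1 \<subseteq> Obj C" by (auto simp: wle_gen_w wge_gen_w)
  show "perp C (wle C gen_w 0) (wge C gen_w 1)"
    unfolding perp_iff[OF wO]
  proof (intro ballI)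
    fix X Y assume X: "X \<in> wle C gen_w 0" and Y: "Y \<in> wge C gen_w 1"
    then have XO: "X \<in> Obj C" using wO by blast
    \<comment> \<open>As \<open>X\<close> is orthogonal to all generators of weight at least 1, the
      second map vanishes and \<open>X\<close> is a retract of an object of
      \<open>env (le_gen 0)\<close>, which is orthogonal to \<open>Y\<close>.\<close>
    obtain a b where ab: "seq a b" "Cod C a = X" "Dom C a \<in> env (le_gen 0)" "Cod C b \<in> env (ge_gen (0 + 1))"
      by (rule weight_decomposition[OF full XO])
    have "orth X (Cod C b)"
      by (rule envelope_orth_right[OF ab(4) gen_sub]) (use X in \<open>auto simp: wle_gen_w\<close>)
    then have "b = Zero C (Cod C a) (Cod C b)" using ab seq_simps[OF ab(1)] by (intro orthD) auto
    then have r: "retract X (Dom C a)" using retract_trans_zero_right[OF ab(1)] ab(2) by simp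
    have "orth (Dom C a) Y"
      by (rule envelope_orth_left[OF ab(3) gen_sub]) (use Y in \<open>auto simp: wge_gen_w\<close>)
    then show "orth X Y" using r by (rule orth_retract_left)
  qed
  show "\<exists>a b c. weight_decomp C gen_w 0 X a b c" if X: "X \<in> Obj C" for X
  proof -
    obtain a b where ab: "seq a b" "Cod C a = X" "Dom C a \<in> env (le_gen 0)" "Cod C b \<in> env (ge_gen (0 + 1))"
      by (rule weight_decomposition[OF full X])
    then show ?thesis using env_wle[of "le_gen 0" 0] env_wge[of "ge_gen (0 + 1)" "0 + 1"]
      unfolding weight_decomp_def seq_def by blast
  qed
qed

lemma gen_w_bounded:
  assumes full: "env UNIV = Obj C"
  shows "bounded_weight_structure C gen_w"
  unfolding bounded_weight_structure_def
proof (intro conjI ballI gen_w_weight_structure[OF full])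
  note tow = w_tower[OF gen_w_weight_structure[OF full]]
  fix X assume "X \<in> Obj C"
  then have "X \<in> env UNIV" using full by simp
  from this gen_sub show "\<exists>n. X \<in> wle C gen_w n \<inter> wge C gen_w (- n)"
  proof (induction rule: envelope_induct)
    case (base X)
    then obtain i j M where M: "M \<in> A i" "X = ShO C j M" using gen_iff by blast
    then have "X \<in> gen {(i, j)}" using gen_iff by blast
    then have e: "X \<in> env {(i, j)}" using envelope_base by blast
    have "{(i, j)} \<subseteq> le_gen \<bar>i + j\<bar>" "{(i, j)} \<subseteq> ge_gen (- \<bar>i + j\<bar>)"
      by (auto simp: le_gen_def ge_gen_def)
    from subsetD[OF env_wle[OF this(1)] e] subsetD[OF env_wge[OF this(2)] e]
    have "X \<in> wle C gen_w \<bar>i + j\<bar> \<inter> wge C gen_w (- \<bar>i + j\<bar>)" by (rule IntI)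
    then show ?case by blast
  next
    case (ext X Y Z)
    then obtain m n where mn: "X \<in> wle C gen_w m \<inter> wge C gen_w (- m)" "Z \<in> wle C gen_w n \<inter> wge C gen_w (- n)" by blast
    have "X \<in> wle C gen_w (max m n)" "X \<in> wge C gen_w (- max m n)" "Z \<in> wle C gen_w (max m n)" "Z \<in> wge C gen_w (- max m n)"
      using mn torsion_tower_mono[OF tow, of m "max m n"] torsion_tower_mono[OF tow, of n "max m n"]
        torsion_tower_mono[OF tow, of "- max m n" "-m"] torsion_tower_mono[OF tow, of "- max m n" "-n"] by auto
    then show ?case using torsion_tower_ext[OF tow ext(1)] by blast
  qed
qed

section \<open>The t-structure generated by the family\<close>

definition nonneg :: "(int \<times> int) set" where "nonneg = {(i, j). 0 \<le> j}"
definition nonpos :: "(int \<times> int) set" where "nonpos = {(i, j). j \<le> 0}"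
definition neg :: "(int \<times> int) set" where "neg = {(i, j). j \<le> -1}"

lemma nonneg_neg: "nonneg \<union> neg = UNIV"
  by (auto simp: nonneg_def neg_def)

definition gen_t :: "'o set \<times> 'o set" where
  "gen_t = (env nonneg, env nonpos)"

lemma gen_t_eq: "gen_t = (envelope C (\<Union>i. \<Union>j \<in> {0..}. shift_class C (A i) j),
    envelope C (\<Union>i. \<Union>j \<in> {..0}. shift_class C (A i) j))"
proof -
  have "gen nonneg = (\<Union>i. \<Union>j \<in> {0..}. shift_class C (A i) j)"
    "gen nonpos = (\<Union>i. \<Union>j \<in> {..0}. shift_class C (A i) j)"
    by (auto simp: gen_def nonneg_def nonpos_def)
  then show ?thesis by (simp add: gen_t_def)
qed

lemma env_neg_iff: "X \<in> env neg \<longleftrightarrow> X \<in> tge C gen_t 1"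
proof -
  have o: "snd gen_t \<subseteq> Obj C" using env_sub by (simp add: gen_t_def)
  have "X \<in> env neg \<Longrightarrow> ShO C 1 X \<in> env nonpos" by (rule env_shift) (auto simp: neg_def nonpos_def)
  moreover have "X \<in> env neg" if "X \<in> Obj C" "ShO C 1 X \<in> env nonpos"
    using env_shift[OF that(2), of "-1" neg] that(1) by (auto simp: neg_def nonpos_def)
  ultimately show ?thesis unfolding tge_def shift_class_iff[OF o] using env_sub by (auto simp: gen_t_def)
qed

text \<open>Orthogonality follows from the condition on negative shifts. The truncation triangles
  come from sorting by the sign of the shift, and the swap \<open>sw\<close> this requires is the
  one ingredient that semi-orthogonality does not provide.\<close>

lemma gen_t_structure:
  assumes full: "env UNIV = Obj C" and sw: "star (gen neg) (gen nonneg) \<subseteq> star (env nonneg) (gen neg)"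
  shows "bounded_t_structure C gen_t"
proof -
  have ne: "(0, 0) \<in> nonneg" "(0, 0) \<in> nonpos" "(0, -1) \<in> neg" by (simp_all add: nonneg_def nonpos_def neg_def)
  have o: "fst gen_t \<subseteq> Obj C" "snd gen_t \<subseteq> Obj C" using env_sub by (simp_all add: gen_t_def)
  have ti: "X \<in> tle C gen_t n \<longleftrightarrow> X \<in> Obj C \<and> ShO C n X \<in> env nonneg"
    "X \<in> tge C gen_t n \<longleftrightarrow> X \<in> Obj C \<and> ShO C n X \<in> env nonpos" for X n
    using o by (simp_all add: tle_def tge_def shift_class_iff gen_t_def)
  have t0: "tle C gen_t 0 = env nonneg" using ti(1)[of _ 0] env_sub[of nonneg] by auto
  have ts: "t_structure C gen_t" unfolding t_structure_def
  proof (intro conjI ballI o)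
    show "iso_closed C (fst gen_t)" "iso_closed C (snd gen_t)" using ne env_iso by (auto simp: iso_closed_iff gen_t_def)
    show "tle C gen_t 0 \<subseteq> tle C gen_t 1"
      using env_shift[of _ nonneg 1 nonneg] by (auto simp: ti nonneg_def)
    show "tge C gen_t 1 \<subseteq> tge C gen_t 0"
    proof
      fix X assume "X \<in> tge C gen_t 1"
      then have X: "X \<in> env neg" by (simp add: env_neg_iff)
      have "neg \<subseteq> nonpos" by (auto simp: neg_def nonpos_def)
      moreover have "X \<in> Obj C" using X env_sub by blast
      ultimately show "X \<in> tge C gen_t 0" using X env_mono[of neg nonpos] by (auto simp: ti)
    qed
    have tO: "tle C gen_t 0 \<subseteq> Obj C" "tge C gen_t 1 \<subseteq> Obj C" by (auto simp: ti)
    show "perp C (tle C gen_t 0) (tge C gen_t 1)" unfolding perp_iff[OF tO]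
    proof (intro ballI)
      fix X Y assume X: "X \<in> tle C gen_t 0" and "Y \<in> tge C gen_t 1"
      then have XY: "X \<in> env nonneg" "Y \<in> env neg" by (auto simp: t0 env_neg_iff)
      show "orth X Y"
        by (rule envelope_orth_left[OF XY(1) gen_sub], rule envelope_orth_right[OF XY(2) gen_sub], erule gen_orth)
           (auto simp: nonneg_def neg_def)
    qed
    fix X assume "X \<in> Obj C"
    then have "X \<in> env (nonneg \<union> neg)" using full by (simp add: nonneg_neg)
    then have "X \<in> star (env nonneg) (env neg)"
      unfolding gen_Un using envelope_sort[OF gen_sub gen_sub gen_zero gen_zero sw] ne by blast
    then show "\<exists>a b c. (a, b, c) \<in> Tri C \<and> Cod C a = X \<and> Dom C a \<in> tle C gen_t 0 \<and> Cod C b \<in> tge C gen_t 1"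
      by (rule starE) (auto simp: t0 env_neg_iff seq_def)
  qed
  note tow = t_tower[OF ts]
  show ?thesis unfolding bounded_t_structure_def
  proof (intro conjI ballI ts)
    fix X assume "X \<in> Obj C"
    then have "X \<in> env UNIV" using full by simp
    from this gen_sub show "\<exists>n. X \<in> tle C gen_t n \<inter> tge C gen_t (- n)"
    proof (induction rule: envelope_induct)
      case (base X)
      then obtain i j M where M: "M \<in> A i" "X = ShO C j M" using gen_iff by blast
      have "X \<in> gen {(i, j)}" using M gen_iff by blast
      then have e: "X \<in> env {(i, j)}" using envelope_base by blast
      have "ShO C \<bar>j\<bar> X \<in> env nonneg" by (rule env_shift[OF e]) (auto simp: nonneg_def)
      moreover have "ShO C (- \<bar>j\<bar>) X \<in> env nonpos" by (rule env_shift[OF e]) (auto simp: nonpos_def)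
      ultimately have "X \<in> tle C gen_t \<bar>j\<bar> \<inter> tge C gen_t (- \<bar>j\<bar>)" using M A_Obj by (simp add: ti)
      then show ?case by blast
    next
      case (ext X Y Z)
      then obtain m n where mn: "X \<in> tle C gen_t m \<inter> tge C gen_t (- m)" "Z \<in> tle C gen_t n \<inter> tge C gen_t (- n)" by blast
      have "X \<in> tle C gen_t (max m n)" "X \<in> tge C gen_t (- max m n)" "Z \<in> tle C gen_t (max m n)" "Z \<in> tge C gen_t (- max m n)"
        using mn torsion_tower_mono[OF tow, of m "max m n"] torsion_tower_mono[OF tow, of n "max m n"]
          torsion_tower_mono[OF tow, of "- max m n" "-m"] torsion_tower_mono[OF tow, of "- max m n" "-n"] by auto
      then show ?case using torsion_tower_ext[OF tow ext(1)] by blast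
    qed
  qed
qed

section \<open>Generation\<close>

lemma env_UNIV_shift: "X \<in> env UNIV \<Longrightarrow> ShO C n X \<in> env UNIV"
  by (rule env_shift) auto

lemma env_UNIV_triangulated: "triangulated_sub C (env UNIV)"
  unfolding triangulated_sub_def
proof (intro conjI allI impI ballI env_sub)
  show "iso_closed C (env UNIV)" using env_iso[of _ UNIV] by (auto simp: iso_closed_iff)
  show "\<exists>Z \<in> env UNIV. is_zero C Z" using gen_zero[of UNIV] envelope_base by blast
  show "ShO C n X \<in> env UNIV" if "X \<in> env UNIV" for X n using that by (rule env_UNIV_shift)
  fix f g h assume a: "(f, g, h) \<in> Tri C \<and> Dom C f \<in> env UNIV \<and> Cod C f \<in> env UNIV"
  then have "ext (Dom C f) (Cod C f) (Cod C g)" using seq_ext[of f g] by (auto simp: seq_def)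
  from envelope_ext[OF ext_rot(1)[OF this]] show "Cod C g \<in> env UNIV" using a env_UNIV_shift by blast
qed

lemma gen_UNIV_A: "(\<Union>i. A i) \<subseteq> gen UNIV"
proof
  fix X assume "X \<in> (\<Union>i. A i)"
  then obtain i where "X \<in> A i" by blast
  then show "X \<in> gen UNIV" unfolding gen_iff using A_Obj by (intro exI[of _ i] exI[of _ 0] exI[of _ X]) auto
qed

text \<open>In the presence of shifts, closure under extensions and closure under cones are the same
  up to rotation. So the triangulated subcategory generated by the family is the envelope of all
  shifts of its objects.\<close>

lemma generating_env: "generating C A \<longleftrightarrow> env UNIV = Obj C"
proof
  assume "generating C A"
  then have "generated_sub C (\<Union>i. A i) = Obj C" by (simp add: generating_def)
  moreover have "generated_sub C (\<Union>i. A i) \<subseteq> env UNIV"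
    unfolding generated_sub_def using env_UNIV_triangulated gen_UNIV_A envelope_base by (intro Inter_lower) blast
  ultimately show "env UNIV = Obj C" using env_sub by blast
next
  assume full: "env UNIV = Obj C"
  have "triangulated_sub C (Obj C)" using env_UNIV_triangulated full by simp
  then have "generated_sub C (\<Union>i. A i) \<subseteq> Obj C"
    unfolding generated_sub_def using A_sub by (intro Inter_lower) blast
  moreover have "Obj C \<subseteq> generated_sub C (\<Union>i. A i)"
    unfolding generated_sub_def
  proof (rule Inter_greatest)
    fix E assume "E \<in> {E. triangulated_sub C E \<and> (\<Union>i. A i) \<subseteq> E}"
    then have E: "E \<subseteq> Obj C" "\<And>X n. X \<in> E \<Longrightarrow> ShO C n X \<in> E" "(\<Union>i. A i) \<subseteq> E"
      "\<And>f g h. (f, g, h) \<in> Tri C \<Longrightarrow> Dom C f \<in> E \<Longrightarrow> Cod C f \<in> E \<Longrightarrow> Cod C g \<in> E"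
      unfolding triangulated_sub_def by blast+
    have cone: "Z \<in> E" if "ext X Y Z" "X \<in> E" "Y \<in> E" for X Y Z
      using that E(4) unfolding ext_def seq_def by blast
    \<comment> \<open>The middle term is the cone of \<open>Z[-1] \<rightarrow> X\<close>.\<close>
    have "Y \<in> E" if "ext X Y Z" "X \<in> E" "Z \<in> E" for X Y Z
      using cone[OF ext_rot(2)[OF that(1)]] that(2,3) E(2) by blast
    then have "ext_stable C E" unfolding ext_stable_iff by blast
    moreover have "gen UNIV \<subseteq> E"
    proof
      fix X assume "X \<in> gen UNIV"
      then obtain i j M where "M \<in> A i" "X = ShO C j M" using gen_iff by blast
      then show "X \<in> E" using E(2)[of M j] E(3) by blast
    qed
    ultimately have "env UNIV \<subseteq> E" using E(1) by (intro envelope_least)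
    then show "Obj C \<subseteq> E" using full by simp
  qed
  ultimately show "generating C A" by (simp add: generating_def)
qed

end

section \<open>Comparison of the conditions\<close>

context t_category
begin

text \<open>A weight decomposition with left term in \<open>C\<^sup>t\<^sup>\<le>\<^sup>0\<close> and one with both terms in \<open>C\<^sup>t\<^sup>\<ge>\<^sup>0\<close> combine to a nice
  one: truncate the left term of the second, and recognise the outcome as a retract of terms of the
  given decompositions.\<close>

lemma nice_from_two:
  assumes tw: "torsion_tower L R" and X: "X \<in> H"
    and a1: "seq a1 b1" "Cod C a1 = X" "Dom C a1 \<in> tle C t 0" "Dom C a1 \<in> L n" "Cod C b1 \<in> R (n + 1)"
    and a2: "seq a2 b2" "Cod C a2 = X" "Dom C a2 \<in> tge C t 0" "Cod C b2 \<in> tge C t 0" "Dom C a2 \<in> L n" "Cod C b2 \<in> R (n + 1)"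
  shows "\<exists>a b. heart_seq a b \<and> Cod C a = X \<and> Dom C a \<in> L n \<and> Cod C b \<in> R (n + 1)"
proof -
  note S1 = seq_simps[OF a1(1)] a1 and S2 = seq_simps[OF a2(1)] a2
  have zero: "f = Zero C U V" if "f \<in> Arr C" "Dom C f = U" "Cod C f = V" "U \<in> L n" "V \<in> R (n + 1)" for f U V
    using torsion_tower_orth[OF tw that(4,5)] that(1-3) by (intro orthD) auto
  have oL: "Dom C a2 \<in> Obj C" using S2 by simp
  obtain p c where p: "seq p c" "Cod C p = Dom C a2" "Dom C p \<in> tle C t 0" "Cod C c \<in> tge C t (0 + 1)"
    using t_dec[OF oL] by blast
  note SP = seq_simps[OF p(1)] p
  let ?x = "a2 \<cdot> p"
  have x: "?x \<in> Arr C" "Dom C ?x = Dom C p" "Cod C ?x = X" using SP S2 by simp_all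
  obtain b h where B: "(?x, b, h) \<in> Tri C" using Tri_extend x by blast
  note SB = Tri_simps[OF B]
  obtain p' where p': "(p, c, p') \<in> Tri C" using p by (auto simp: seq_def)
  obtain a2' where a2': "(a2, b2, a2') \<in> Tri C" using a2 by (auto simp: seq_def)
  obtain u v where uv: "(u, v, ShM C 1 c \<cdot> a2') \<in> Tri C" "Dom C u = Cod C c" "Cod C u = Cod C b" "Cod C v = Cod C b2"
    using seq_octahedron[OF p' a2' B] p by metis
  have e1: "ext (Cod C c) (Cod C b) (Cod C b2)" using seq_ext[OF seqI[OF uv(1)]] uv by simp
  have e2: "ext (Dom C p) X (Cod C b)" using seq_ext[OF seqI[OF B]] x by simp
  have e3: "ext (Dom C p) (Dom C a2) (Cod C c)" using seq_ext[OF p(1)] p by simp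
  have "Cod C c \<in> tge C t (0 - 1)" "Cod C c \<in> tge C t 0" using p(4) tge_mono by fastforce+
  then have K: "Dom C p \<in> H" "Cod C b \<in> tge C t 0" using t_ext(6)[OF e3 a2(3)] t_ext(2)[OF e1] p(3) a2(4)
    by (auto simp: heart_iff)
  have "Cod C b \<in> tle C t 0" using t_ext(3)[OF e2, of 0] heart_tle X K by auto
  then have hs: "heart_seq ?x b" using K seqI[OF B] x X by (simp add: heart_seq_def heart_iff)
  have o: "Dom C p \<in> Obj C" "Cod C b1 \<in> Obj C" "Cod C b2 \<in> Obj C" "Cod C b \<in> Obj C" "X \<in> Obj C"
    using SP S1 S2 SB by auto
  have b1a2: "b1 \<cdot> a2 = Zero C (Dom C a2) (Cod C b1)" by (rule zero) (use S1 S2 in auto)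
  have "b1 \<cdot> ?x = Zero C (Dom C p) (Cod C b1)" using comp_assoc[of p a2 b1] b1a2 S1 S2 SP o by simp
  then obtain s where s: "s \<in> Arr C" "Dom C s = Dom C p" "Cod C s = Dom C a1" "a1 \<cdot> s = ?x"
    using lift[OF a1(1), of ?x] x S1 by metis
  have b2a1: "b2 \<cdot> a1 = Zero C (Dom C a1) (Cod C b2)" by (rule zero) (use S1 S2 in auto)
  then obtain r where r: "r \<in> Arr C" "Dom C r = Dom C a1" "Cod C r = Dom C a2" "a2 \<cdot> r = a1"
    using lift[OF a2(1), of a1] S1 S2 by metis
  have "orth (Dom C a1) (Cod C c)" by (rule t_orth[OF a1(3) p(4)]) simp
  then have "c \<cdot> r = Zero C (Dom C a1) (Cod C c)" using r SP by (intro orthD) auto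
  then obtain r' where r': "r' \<in> Arr C" "Dom C r' = Dom C a1" "Cod C r' = Dom C p" "p \<cdot> r' = r"
    using lift[OF p(1), of r] r SP by metis
  have xr: "?x \<cdot> r' = a1" using comp_assoc[of r' p a2] r' r SP S2 by simp
  have e4: "?x \<cdot> (r' \<cdot> s) = ?x \<cdot> Ident C (Dom C p)"
    using comp_assoc[of s r' ?x] xr s r' x by simp
  have "r' \<cdot> s = Ident C (Dom C p)"
    by (rule heart_seq_mono[OF hs _ _ _ _ _ _ e4]) (use K s(1-3) r'(1-3) x o in simp_all)
  then have "retract (Dom C p) (Dom C a1)" using s r' unfolding retract_def by blast
  then have Kw: "Dom C p \<in> L n" using torsion_tower_retract(1)[OF tw] a1(4) by blast
  have bx: "b \<cdot> ?x = Zero C (Dom C p) (Cod C b)" using seq_comp[OF seqI[OF B]] x by simp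
  have "b \<cdot> a1 = Zero C (Dom C a1) (Cod C b)"
    using comp_assoc[of r' ?x b] xr bx r' x SB o by simp
  then obtain q where q: "q \<in> Arr C" "Dom C q = Cod C b1" "Cod C q = Cod C b" "q \<cdot> b1 = b"
    using colift[OF a1(1), of b] SB S1 x by metis
  obtain y where y: "y \<in> Arr C" "Dom C y = Cod C b2" "Cod C y = Cod C b1" "y \<cdot> b2 = b1"
    using colift[OF a2(1), of b1] b1a2 S1 S2 by metis
  have "b2 \<cdot> a2 = Zero C (Dom C a2) (Cod C b2)" by (rule zero) (use S2 in auto)
  then have "b2 \<cdot> ?x = Zero C (Dom C p) (Cod C b2)" using comp_assoc[of p a2 b2] S2 SP o by simp
  then obtain z where z: "z \<in> Arr C" "Dom C z = Cod C b" "Cod C z = Cod C b2" "z \<cdot> b = b2"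
    using colift[OF seqI[OF B], of b2] x S2 by metis
  have "((q \<cdot> y) \<cdot> z) \<cdot> b = q \<cdot> (y \<cdot> (z \<cdot> b))" using q(1-3) y(1-3) z(1-3) SB by (simp add: comp_assoc)
  also have "\<dots> = Ident C (Cod C b) \<cdot> b" unfolding z(4) y(4) q(4) using SB by simp
  finally have e5: "((q \<cdot> y) \<cdot> z) \<cdot> b = Ident C (Cod C b) \<cdot> b" .
  have "(q \<cdot> y) \<cdot> z = Ident C (Cod C b)"
    by (rule heart_seq_epi[OF hs _ _ _ _ _ _ e5])
      (use o q(1-3) y(1-3) z(1-3) heart_seq_simps(7)[OF hs] in simp_all)
  then have "retract (Cod C b) (Cod C b2)" using q y z unfolding retract_def
    by (intro exI[of _ z] exI[of _ "q \<cdot> y"]) simp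
  then have "Cod C b \<in> R (n + 1)" using torsion_tower_retract(2)[OF tw] a2(6) by blast
  then show ?thesis using hs Kw x by (intro exI[of _ ?x] exI[of _ b]) simp
qed

end

locale heart_family = t_category C t + family C A
  for C :: "('o, 'm, 'z) tricat_scheme" (structure) and t A +
  assumes A_heart: "A i \<subseteq> heart C t"
begin

text \<open>The inclusion \<open>u\<close> inherits cancellation from the monomorphism
  \<open>W (i - 1)\<close>, so its cokernel completes it to a triangle in the heart.\<close>

lemma filtration_step:
  assumes "weight_filtration (Ht C t) A X W"
  shows "\<exists>u q. heart_seq u q \<and> Dom C u = Dom C (W (i - 1)) \<and> Cod C u = Dom C (W i) \<and>
    W i \<cdot> u = W (i - 1) \<and> Cod C q \<in> A i"
proof -
  have "\<exists>u \<in> Hom (Ht C t) (Dom (Ht C t) (W (i - 1))) (Dom (Ht C t) (W i)). \<exists>q.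
        W i \<cdot>\<^bsub>Ht C t\<^esub> u = W (i - 1) \<and> is_cokernel (Ht C t) u q \<and> Cod (Ht C t) q \<in> A i"
    using assms unfolding weight_filtration_def by blast
  then obtain u q where u: "u \<in> Arr C" "Dom C u = Dom C (W (i - 1))" "Cod C u = Dom C (W i)"
    "W i \<cdot> u = W (i - 1)" "is_cokernel (Ht C t) u q" "Cod C q \<in> A i" by auto
  have W: "is_mono (Ht C t) (W j)" for j using assms by (simp add: weight_filtration_def)
  have Wi: "W i \<in> Arr C" "Cod C (W i) \<in> Obj C" using W[of i] by (auto simp: is_mono_def)
  have "heart_seq u q"
  proof (rule mono_cokernel_heart_seq[OF u(5)])
    fix v assume v: "v \<in> Arr C" "Dom C v \<in> H" "Cod C v = Dom C u" "u \<cdot> v = Zero C (Dom C v) (Cod C u)"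
    have Wc: "Cod C (W (i - 1)) = Cod C (W i)" using u(1,3,4) Wi by (metis comp_simps(3))
    have "W (i - 1) \<cdot> v = Zero C (Dom C v) (Cod C (W (i - 1)))"
      unfolding Wc using comp_assoc[of v u "W i"] u(1-4) v Wi by simp
    then show "v = Zero C (Dom C v) (Dom C u)"
      using is_mono_Ht_zero[OF W[of "i - 1"], of v] v u by simp
  qed
  then show ?thesis using u by blast
qed

lemma filtration_low:
  assumes "weight_filtration (Ht C t) A X W"
  obtains n where "\<And>i. i \<le> n \<Longrightarrow> is_zero C (Dom C (W i))"
proof -
  obtain n where "\<forall>i \<le> n. is_zero (Ht C t) (Dom C (W i))" using assms unfolding weight_filtration_def by auto
  then show ?thesis using that[of n] unfolding Ht_def is_zero_full_sub[OF heart_sub] by blast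
qed

lemma filtration_high:
  assumes "weight_filtration (Ht C t) A X W"
  obtains n where "\<And>i. i \<ge> n \<Longrightarrow> is_isomorphism C (W i)"
proof -
  obtain n where "\<forall>i \<ge> n. is_isomorphism (Ht C t) (W i)" using assms unfolding weight_filtration_def by auto
  then show ?thesis using that[of n] unfolding Ht_def is_isomorphism_full_sub by blast
qed

text \<open>The subobject is built by extensions from objects of \<open>A j\<close> with j \<le> i,
  and for j < k semi-orthogonality applies with s = 0, because then 0 > j - k.\<close>

lemma filtration_orth:
  assumes wf: "weight_filtration (Ht C t) A X W" and T: "T \<in> A k" and "i < k"
  shows "orth (Dom C (W i)) T"
proof -
  obtain n where n: "\<And>i. i \<le> n \<Longrightarrow> is_zero C (Dom C (W i))" using filtration_low[OF wf] by blast
  show ?thesis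
  proof (cases "i \<le> n")
    case True
    then show ?thesis using orth_zero(2) n by blast
  next
    case False
    then have "n \<le> i" by simp
    then show ?thesis using \<open>i < k\<close>
    proof (induction i rule: int_ge_induct)
      case base
      then show ?case using orth_zero(2) n by blast
    next
      case (step i)
      obtain u q where u: "heart_seq u q" "Dom C u = Dom C (W i)" "Cod C u = Dom C (W (i + 1))" "Cod C q \<in> A (i + 1)"
        using filtration_step[OF wf, of "i + 1"] by auto
      have "orth (Cod C q) (ShO C 0 T)" using A_orth[OF u(4) T, of 0] step by simp
      then have "orth (Cod C q) T" using A_Obj[OF T] by simp
      then show ?case using orth_ext(1)[OF heart_seq_ext[OF u(1)]] u step by auto
    qed
  qed
qed

text \<open>The composite of \<open>f\<close> with \<open>W i\<close> lands in the whole of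
  \<open>Y\<close>, and the graded pieces of \<open>Y\<close> of index greater than \<open>i\<close>
  receive no arrows from the domain of \<open>W i\<close>; so it can be pushed down the filtration
  until it lands in the domain of \<open>V i\<close>.\<close>

lemma filtrations_functorial: "filtrations_functorial (Ht C t) A"
  unfolding filtrations_functorial_def
proof (intro ballI allI impI)
  fix X Y f W V i
  assume XY: "X \<in> Obj (Ht C t)" "Y \<in> Obj (Ht C t)" and f: "f \<in> Hom (Ht C t) X Y"
    and WV: "weight_filtration (Ht C t) A X W \<and> weight_filtration (Ht C t) A Y V"
  have fa: "f \<in> Arr C" "Dom C f = X" "Cod C f = Y" using f by auto
  have W: "W j \<in> Arr C" "Cod C (W j) = X" "Dom C (W j) \<in> H" for j
    using WV by (auto simp: weight_filtration_def is_mono_def)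
  have V: "V j \<in> Arr C" "Cod C (V j) = Y" "Dom C (V j) \<in> H" "is_mono (Ht C t) (V j)" for j
    using WV by (auto simp: weight_filtration_def is_mono_def)
  obtain n where n: "\<And>i. i \<ge> n \<Longrightarrow> is_isomorphism C (V i)" using filtration_high WV by blast
  have top: "\<exists>g. g \<in> Arr C \<and> Dom C g = Dom C (W i) \<and> Cod C g = Dom C (V k) \<and> V k \<cdot> g = f \<cdot> W i" if "k \<ge> n" for k
  proof -
    obtain v where v: "inverse_pair (V k) v" using n[OF \<open>k \<ge> n\<close>] is_isomorphism_iff by blast
    then have va: "v \<in> Arr C" "Dom C v = Y" "Cod C v = Dom C (V k)" "V k \<cdot> v = Ident C Y"
      using V by (auto simp: inverse_pair_def)
    have "V k \<cdot> (v \<cdot> (f \<cdot> W i)) = f \<cdot> W i"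
      using comp_assoc[of "f \<cdot> W i" v "V k"] va fa W V by simp
    then show ?thesis using va fa W by (intro exI[of _ "v \<cdot> (f \<cdot> W i)"]) simp
  qed
  \<comment> \<open>Downward induction on \<open>k\<close>. The start \<open>max n i\<close> is an
    index where \<open>V k\<close> is invertible and which is not below \<open>i\<close>.\<close>
  have "\<exists>g. g \<in> Arr C \<and> Dom C g = Dom C (W i) \<and> Cod C g = Dom C (V k) \<and> V k \<cdot> g = f \<cdot> W i"
    if "i \<le> k" "k \<le> max n i" for k
    using that(2,1)
  proof (induction k rule: int_le_induct)
    case base
    then show ?case using top by simp
  next
    case (step k)
    then obtain g where g: "g \<in> Arr C" "Dom C g = Dom C (W i)" "Cod C g = Dom C (V k)" "V k \<cdot> g = f \<cdot> W i" by auto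
    obtain u q where u: "heart_seq u q" "Dom C u = Dom C (V (k - 1))" "Cod C u = Dom C (V k)"
      "V k \<cdot> u = V (k - 1)" "Cod C q \<in> A k"
      using filtration_step[of Y V k] WV by blast
    note U = heart_seq_simps[OF u(1)]
    have "orth (Dom C (W i)) (Cod C q)" using filtration_orth[of X W _ k i] WV u(5) step by auto
    then have "q \<cdot> g = Zero C (Dom C (W i)) (Cod C q)" using g U u by (intro orthD) auto
    then obtain g' where g': "g' \<in> Arr C" "Dom C g' = Dom C (W i)" "Cod C g' = Dom C u" "u \<cdot> g' = g"
      using lift[OF U(1), of g] g u by metis
    have "V (k - 1) \<cdot> g' = f \<cdot> W i"
      using comp_assoc[of g' u "V k"] g' g u U V by simp
    then show ?case using g' u by auto
  qed
  from this[of i] obtain g where g: "g \<in> Arr C" "Dom C g = Dom C (W i)" "Cod C g = Dom C (V i)" "V i \<cdot> g = f \<cdot> W i" by auto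
  show "\<exists>!g. g \<in> Hom (Ht C t) (Dom (Ht C t) (W i)) (Dom (Ht C t) (V i)) \<and> V i \<cdot>\<^bsub>Ht C t\<^esub> g = f \<cdot>\<^bsub>Ht C t\<^esub> W i"
  proof (rule ex1I[of _ g])
    show "g \<in> Hom (Ht C t) (Dom (Ht C t) (W i)) (Dom (Ht C t) (V i)) \<and> V i \<cdot>\<^bsub>Ht C t\<^esub> g = f \<cdot>\<^bsub>Ht C t\<^esub> W i"
      using g W V by simp
    fix y assume "y \<in> Hom (Ht C t) (Dom (Ht C t) (W i)) (Dom (Ht C t) (V i)) \<and> V i \<cdot>\<^bsub>Ht C t\<^esub> y = f \<cdot>\<^bsub>Ht C t\<^esub> W i"
    then have y: "y \<in> Arr C" "Dom C y = Dom C (W i)" "Cod C y = Dom C (V i)" "V i \<cdot> y = f \<cdot> W i" by auto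
    show "y = g" using V(4)[of i] y g W V unfolding is_mono_def by simp
  qed
qed

lemma UN_A_sub: "(\<Union>i. A i) \<subseteq> Obj C"
  using A_sub by blast

text \<open>Climbing a finite filtration from zero to \<open>X\<close> writes \<open>X\<close> as an
  iterated extension of its graded pieces; conversely the heart is extension-stable.\<close>

lemma filtration_envelope:
  assumes "\<And>X. X \<in> H \<Longrightarrow> \<exists>W. weight_filtration (Ht C t) A X W"
  shows "envelope C (\<Union>i. A i) = H"
proof
  have "ext_stable C H" using heart_ext unfolding ext_stable_iff by blast
  then show "envelope C (\<Union>i. A i) \<subseteq> H" using A_heart heart_sub by (intro envelope_least) auto
  show "H \<subseteq> envelope C (\<Union>i. A i)"
  proof
    fix X assume X: "X \<in> H"
    obtain W where wf: "weight_filtration (Ht C t) A X W" using assms[OF X] by blast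
    obtain n where n: "\<And>i. i \<le> n \<Longrightarrow> is_zero C (Dom C (W i))" using filtration_low[OF wf] by blast
    obtain m where m: "\<And>i. i \<ge> m \<Longrightarrow> is_isomorphism C (W i)" using filtration_high[OF wf] by blast
    have z: "\<exists>Z \<in> \<Union>i. A i. is_zero C Z" using A_zero by blast
    have "n \<le> max n m" by simp
    then have "Dom C (W (max n m)) \<in> envelope C (\<Union>i. A i)"
    proof (induction rule: int_ge_induct)
      case base
      obtain Z where Z: "Z \<in> (\<Union>i. A i)" "is_zero C Z" using z by blast
      then have "Z \<in> envelope C (\<Union>i. A i)" using envelope_base by blast
      then show ?case by (rule envelope_iso[OF _ _ UN_A_sub z]) (rule iso_zero[OF Z(2)], use n in simp)
    next
      case (step i)
      obtain u q where u: "heart_seq u q" "Dom C u = Dom C (W i)" "Cod C u = Dom C (W (i + 1))" "Cod C q \<in> A (i + 1)"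
        using filtration_step[OF wf, of "i + 1"] by auto
      have "Cod C q \<in> envelope C (\<Union>i. A i)" using u(4) envelope_base by blast
      then show ?case using envelope_ext[OF heart_seq_ext[OF u(1)]] step u by simp
    qed
    moreover have "isomorphic (Dom C (W (max n m))) X"
    proof -
      have "Cod C (W (max n m)) = X" using wf by (simp add: weight_filtration_def)
      moreover obtain v where "inverse_pair (W (max n m)) v" using m[of "max n m"] is_isomorphism_iff by auto
      ultimately show ?thesis by (intro isoI) auto
    qed
    ultimately show "X \<in> envelope C (\<Union>i. A i)" using envelope_iso[OF _ _ UN_A_sub z] by blast
  qed
qed

end

context family
begin

text \<open>A bounded t-structure is determined by its heart: its two classes are the envelopes of
  the nonnegative and of the nonpositive shifts of the heart, and the heart is itself the envelope
  of the \<open>A i\<close>.\<close>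

lemma gen_t_eq_t:
  assumes bt: "bounded_t_structure C t" and h: "envelope C (\<Union>i. A i) = heart C t"
  shows "gen_t = t"
proof -
  have ts: "t_structure C t" using bt by (simp add: bounded_t_structure_def)
  interpret t: t_category C t by unfold_locales (rule ts)
  have A: "A i \<subseteq> heart C t" for i using envelope_base[of "\<Union>i. A i"] unfolding h by blast
  have o: "fst t \<subseteq> Obj C" "snd t \<subseteq> Obj C" using ts by (simp_all add: t_structure_def)
  have ft: "tle C t 0 = fst t" "tge C t 0 = snd t" using o by (simp_all add: tle_def tge_def shift_class_0)
  have st: "ext_stable C (fst t)" "ext_stable C (snd t)"
    using t.t_ext(1)[where n=0] t.t_ext(2)[where n=0] unfolding ft ext_stable_iff by blast+
  have g: "gen nonneg \<subseteq> fst t" "gen nonpos \<subseteq> snd t"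
  proof -
    show "gen nonneg \<subseteq> fst t"
    proof
      fix X assume "X \<in> gen nonneg"
      then obtain i j M where "0 \<le> j" "M \<in> A i" "X = ShO C j M" by (auto simp: gen_iff nonneg_def)
      then show "X \<in> fst t" using A[of i] t.heart_tle[of M j] A_Obj by (auto simp: t.tle_shift simp flip: ft(1))
    qed
    show "gen nonpos \<subseteq> snd t"
    proof
      fix X assume "X \<in> gen nonpos"
      then obtain i j M where "j \<le> 0" "M \<in> A i" "X = ShO C j M" by (auto simp: gen_iff nonpos_def)
      then show "X \<in> snd t" using A[of i] t.heart_tge[of M j] A_Obj by (auto simp: t.tge_shift simp flip: ft(2))
    qed
  qed
  have AG: "(\<Union>i. A i) \<subseteq> gen nonneg" "(\<Union>i. A i) \<subseteq> gen nonpos"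
    unfolding gen_iff subset_iff nonneg_def nonpos_def using A_Obj by fastforce+
  have es: "ext_stable C (env S)" for S by (simp add: ext_stable_star envelope_star)
  have "fst t \<subseteq> env nonneg"
  proof
    fix X assume X: "X \<in> fst t"
    obtain n where "X \<in> tge C t (- n)" using bt X o unfolding bounded_t_structure_def by blast
    then have n: "X \<in> tge C t (- int (nat n))" using t.tge_mono by fastforce
    show "X \<in> env nonneg"
    proof (rule t.tle_envelope[OF _ n es])
      show "ShO C 1 Y \<in> env nonneg" if "Y \<in> env nonneg" for Y
        by (rule env_shift[OF that]) (auto simp: nonneg_def)
      show "heart C t \<subseteq> env nonneg" using envelope_mono[OF AG(1)] h by simp
    qed (use X ft in simp)
  qed
  moreover have "snd t \<subseteq> env nonpos"
  proof
    fix X assume X: "X \<in> snd t"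
    obtain n where "X \<in> tle C t n" using bt X o unfolding bounded_t_structure_def by blast
    then have n: "X \<in> tle C t (int (nat n))" using t.tle_mono by fastforce
    show "X \<in> env nonpos"
    proof (rule t.tge_envelope[OF _ n es])
      show "ShO C (-1) Y \<in> env nonpos" if "Y \<in> env nonpos" for Y
        by (rule env_shift[OF that]) (auto simp: nonpos_def)
      show "heart C t \<subseteq> env nonpos" using envelope_mono[OF AG(2)] h by simp
    qed (use X ft in simp)
  qed
  moreover have "env nonneg \<subseteq> fst t" by (rule envelope_least[OF g(1) o(1) st(1)])
  moreover have "env nonpos \<subseteq> snd t" by (rule envelope_least[OF g(2) o(2) st(2)])
  ultimately show ?thesis by (simp add: gen_t_def prod_eq_iff)
qed

text \<open>A suitable shift of any object lies in \<open>env nonneg\<close>, and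
  \<open>env UNIV\<close> is stable under shifts; so boundedness forces the family to
  generate.\<close>

lemma gen_t_full:
  assumes "bounded_t_structure C gen_t"
  shows "env UNIV = Obj C"
proof
  show "Obj C \<subseteq> env UNIV"
  proof
    fix X assume X: "X \<in> Obj C"
    have ts: "t_structure C gen_t" using assms by (simp add: bounded_t_structure_def)
    obtain n where "X \<in> tle C gen_t n" using assms X unfolding bounded_t_structure_def by blast
    then have "ShO C n X \<in> env nonneg" using tle_iff[OF ts] by (simp add: gen_t_def)
    then have "ShO C n X \<in> env UNIV" using env_mono[of nonneg UNIV] by blast
    then show "X \<in> env UNIV" using env_UNIV_shift[of "ShO C n X" "-n"] X by simp
  qed
qed (rule env_sub)

text \<open>An object of the heart lies in \<open>env nonneg\<close> and in
  \<open>env nonpos\<close>. Sorting by weight in each gives one decomposition with terms in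
  \<open>tle C gen_t 0\<close> and one with terms in \<open>tge C gen_t 0\<close>;
  \<open>nice_from_two\<close> merges them.\<close>

lemma gen_t_nice:
  assumes bt: "bounded_t_structure C gen_t" and X: "X \<in> heart C gen_t"
  shows "\<exists>a b c. nice_decomp C gen_t gen_w n X a b c"
proof -
  have ts: "t_structure C gen_t" using bt by (simp add: bounded_t_structure_def)
  interpret t: t_category C gen_t by unfold_locales (rule ts)
  note full = gen_t_full[OF bt]
  note tw = w_tower[OF gen_w_weight_structure[OF full]]
  have o: "fst gen_t \<subseteq> Obj C" "snd gen_t \<subseteq> Obj C" using env_sub by (simp_all add: gen_t_def)
  have ft: "tle C gen_t 0 = env nonneg" "tge C gen_t 0 = env nonpos"
    using o by (simp_all add: tle_def tge_def shift_class_0) (simp_all add: gen_t_def)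
  have "(n, 0) \<in> nonneg \<inter> le_gen n" "(n + 1, 0) \<in> nonneg \<inter> ge_gen (n + 1)"
    by (simp_all add: nonneg_def le_gen_def ge_gen_def)
  then have "X \<in> star (env (nonneg \<inter> le_gen n)) (env (nonneg \<inter> ge_gen (n + 1)))"
    using weight_sort[of nonneg n] X ft t.heart_iff by blast
  then obtain a1 b1 where a1: "seq a1 b1" "Cod C a1 = X" "Dom C a1 \<in> env (nonneg \<inter> le_gen n)" "Cod C b1 \<in> env (nonneg \<inter> ge_gen (n + 1))"
    by (rule starE)
  have "(n, 0) \<in> nonpos \<inter> le_gen n" "(n + 1, 0) \<in> nonpos \<inter> ge_gen (n + 1)"
    by (simp_all add: nonpos_def le_gen_def ge_gen_def)
  then have "X \<in> star (env (nonpos \<inter> le_gen n)) (env (nonpos \<inter> ge_gen (n + 1)))"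
    using weight_sort[of nonpos n] X ft t.heart_iff by blast
  then obtain a2 b2 where a2: "seq a2 b2" "Cod C a2 = X" "Dom C a2 \<in> env (nonpos \<inter> le_gen n)" "Cod C b2 \<in> env (nonpos \<inter> ge_gen (n + 1))"
    by (rule starE)
  have i: "env (S \<inter> S') \<subseteq> env S" for S S' by (rule env_mono) simp
  have w: "env (S \<inter> le_gen n) \<subseteq> wle C gen_w n" "env (S \<inter> ge_gen (n + 1)) \<subseteq> wge C gen_w (n + 1)" for S
    by (rule env_wle, simp) (rule env_wge, simp)
  have "\<exists>a b. t.heart_seq a b \<and> Cod C a = X \<and> Dom C a \<in> wle C gen_w n \<and> Cod C b \<in> wge C gen_w (n + 1)"
  proof (rule t.nice_from_two[OF tw X a1(1,2) _ _ _ a2(1,2)])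
    show "Dom C a1 \<in> tle C gen_t 0" "Dom C a2 \<in> tge C gen_t 0" "Cod C b2 \<in> tge C gen_t 0"
      unfolding ft by (rule subsetD[OF i a1(3)], rule subsetD[OF i a2(3)], rule subsetD[OF i a2(4)])
  qed (rule subsetD[OF w(1) a1(3)], rule subsetD[OF w(2) a1(4)], rule subsetD[OF w(1) a2(3)], rule subsetD[OF w(2) a2(4)])
  then show ?thesis
    unfolding nice_decomp_def weight_decomp_def t.heart_seq_def seq_def by auto
qed

text \<open>The extension can be swapped whenever its connecting map
  \<open>Z \<rightarrow> X[1]\<close> vanishes. This fails at most for an arrow \<open>f\<close>
  inside one \<open>A i\<close>, and then kernel and cokernel of \<open>f\<close> take the places of
  \<open>Z\<close> and \<open>X\<close>.\<close>

lemma semisimple_star: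
  assumes st: "strongly_semi_orthogonal C A" and ss: "\<And>i. semisimple_abelian_category (full_sub C (A i))"
  shows "star (gen neg) (gen nonneg) \<subseteq> star (env nonneg) (gen neg)"
proof
  fix Y assume "Y \<in> star (gen neg) (gen nonneg)"
  then obtain X Z where XZ: "X \<in> gen neg" "Z \<in> gen nonneg" "ext X Y Z" by (auto simp: star_def)
  obtain i n M where M: "n \<le> -1" "M \<in> A i" "X = ShO C n M" using XZ(1) by (auto simp: gen_iff neg_def)
  obtain k l N where N: "0 \<le> l" "N \<in> A k" "Z = ShO C l N" using XZ(2) by (auto simp: gen_iff nonneg_def)
  have MO: "M \<in> Obj C" "N \<in> Obj C" using M N A_Obj by auto
  show "Y \<in> star (env nonneg) (gen neg)"
  proof (cases "l = 0 \<and> n = -1 \<and> k = i")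
    case False
    \<comment> \<open>The shift \<open>n + 1 - l\<close> is at most 0. If negative,
      semi-orthogonality suffices; if zero, then k differs from i, and strong semi-orthogonality
      settles k > i, ordinary semi-orthogonality k < i.\<close>
    have "orth N (ShO C (n + 1 - l) M)"
    proof (cases "n + 1 - l < 0")
      case True
      then show ?thesis using A_orth[OF N(2) M(2)] by blast
    next
      case neg: False
      then have s: "n + 1 - l = 0" using M(1) N(1) by simp
      then have "k \<noteq> i" using False M(1) N(1) by auto
      then consider "k > i" | "k < i" by linarith
      then show ?thesis
      proof cases
        case 1
        then have "perp C (A k) (A i)" using st by (simp add: strongly_semi_orthogonal_def)
        then have "orth N M" using perp_iff[OF A_sub A_sub] M N by blast
        then show ?thesis using s MO by simp
      next
        case 2
        then show ?thesis using A_orth[OF N(2) M(2), of "n + 1 - l"] s by simp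
      qed
    qed
    then have "orth (ShO C l N) (ShO C l (ShO C (n + 1 - l) M))" using MO by (intro orth_shift) auto
    then have "orth Z (ShO C 1 X)" using M N MO by (simp add: add.commute)
    then have "ext Z Y X" by (rule ext_split_swap[OF XZ(3)])
    moreover have "Z \<in> env nonneg" using XZ(2) envelope_base by blast
    ultimately show ?thesis using XZ(1) by (auto simp: star_def)
  next
    case True
    then have e: "X = ShO C (-1) M" "Z = N" "N \<in> A i" using M N MO by auto
    \<comment> \<open>In the exceptional case \<open>Y[1]\<close> is the cone of the connecting map
      \<open>f\<close>, which goes from \<open>N\<close> to \<open>M\<close>, both in
      \<open>A i\<close>.\<close>
    have "ext N M (ShO C 1 Y)" using ext_rot(3)[OF XZ(3)] e MO by simp
    then obtain f g where fg: "seq f g" "Dom C f = N" "Cod C f = M" "Cod C g = ShO C 1 Y" by (auto simp: ext_def)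
    note F = seq_simps[OF fg(1)] fg
    interpret S: semisimple_abelian_category "full_sub C (A i)" by (rule ss)
    have fS: "f \<in> Arr (full_sub C (A i))" using F M(2) e(3) by simp
    obtain k e m q r s r' s' where "S.biproduct_data (Dom C k) (Dom C m) (Dom C f) k s r e"
      "S.biproduct_data (Dom C m) (Cod C q) (Cod C f) m s' r' q" "m \<cdot> e = f"
      by (rule S.semisimple_factor[OF fS, unfolded full_sub_simps])
    then have B: "biproduct_data (Dom C k) (Dom C m) N k s r e" "biproduct_data (Dom C m) (Cod C q) M m s' r' q"
      "m \<cdot> e = f" "Dom C k \<in> A i" "Cod C q \<in> A i"
      using fg by (simp_all add: biproduct_data_full_sub[OF A_sub])
    have a: "Dom C k \<in> Obj C" "Cod C q \<in> Obj C" "Cod C e = Dom C m" using B A_Obj by (auto simp: biproduct_data_def)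
    obtain h where h: "(k, e, h) \<in> Tri C" using biproduct_data_seq[OF B(1)] by (auto simp: seq_def)
    obtain h' where h': "(m, q, h') \<in> Tri C" using biproduct_data_seq[OF B(2)] by (auto simp: seq_def)
    obtain h'' where h'': "(m \<cdot> e, g, h'') \<in> Tri C" using fg(1) B(3) by (auto simp: seq_def)
    \<comment> \<open>The octahedron for \<open>f = m \<cdot> e\<close> presents the cone of
      \<open>f\<close> as an extension of the cone of \<open>m\<close>, which is the cokernel, by
      the cone of \<open>e\<close>, which is the kernel shifted by [1]. Shifting back puts the
      kernel on the left and the cokernel shifted by [-1] on the right.\<close>
    obtain u v where uv: "(u, v, ShM C 1 h \<cdot> h') \<in> Tri C" "Dom C u = Cod C h" "Cod C u = Cod C g" "Cod C v = Cod C q"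
      using seq_octahedron[OF Tri_rot[OF h] h' h''] a by metis
    have "ext (ShO C 1 (Dom C k)) (ShO C 1 Y) (Cod C q)"
      using seq_ext[OF seqI[OF uv(1)]] uv Tri_simps[OF h] fg by simp
    from ext_shift[OF this, of "-1"] have "ext (Dom C k) Y (ShO C (-1) (Cod C q))"
      using a ext_Obj[OF XZ(3)] by simp
    moreover have "Dom C k \<in> gen nonneg" unfolding gen_iff nonneg_def using B(4) a
      by (intro exI[of _ i] exI[of _ 0] exI[of _ "Dom C k"]) simp
    then have "Dom C k \<in> env nonneg" using envelope_base by blast
    moreover have "ShO C (-1) (Cod C q) \<in> gen neg" unfolding gen_iff neg_def using B(5) by auto
    ultimately show ?thesis by (auto simp: star_def)
  qed
qed

end

lemma (in nice_category) pure_semisimple: "semisimple_abelian_category (full_sub C (pure i))"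
proof -
  interpret S: additive_category "full_sub C (pure i)"
    using pure_semi_orthogonal by (simp add: semi_orthogonal_def additive_sub_def)
  show ?thesis
  proof (rule S.semisimpleI)
    fix f assume "f \<in> Arr (full_sub C (pure i))"
    then have f: "f \<in> Arr C" "Dom C f \<in> pure i" "Cod C f \<in> pure i" by auto
    obtain k e m q r s r' s' where F: "biproduct_data (Dom C k) (Dom C m) (Dom C f) k s r e"
      "biproduct_data (Dom C m) (Cod C q) (Cod C f) m s' r' q" "m \<cdot> e = f"
      "Dom C k \<in> pure i" "Dom C m \<in> pure i" "Cod C q \<in> pure i"
      by (rule pure_factor[OF f])
    then have "S.biproduct_data (Dom C k) (Dom C m) (Dom C f) k s r e \<and>
        S.biproduct_data (Dom C m) (Cod C q) (Cod C f) m s' r' q \<and> m \<cdot> e = f"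
      using f by (simp add: biproduct_data_full_sub[OF pure_sub(2)])
    then show "\<exists>k e m q r s r' s'.
        S.biproduct_data (Dom (full_sub C (pure i)) k) (Dom (full_sub C (pure i)) m) (Dom (full_sub C (pure i)) f) k s r e \<and>
        S.biproduct_data (Dom (full_sub C (pure i)) m) (Cod (full_sub C (pure i)) q) (Cod (full_sub C (pure i)) f) m s' r' q \<and>
        m \<cdot>\<^bsub>full_sub C (pure i)\<^esub> e = f"
      unfolding full_sub_simps by blast
  qed
qed

text \<open>The filtrations show that the envelope of the pure objects is the heart, so the
  t-structure they generate is \<open>t\<close> itself, and boundedness of \<open>t\<close> gives
  generation.\<close>

lemma (in nice_category) pure_generating:
  assumes "bounded_t_structure C t" "bounded_weight_structure C w"
  shows "generating C pure"
proof -
  interpret F: heart_family C t pure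
    by unfold_locales (use pure_semi_orthogonal pure_sub in auto)
  have "envelope C (\<Union>i. pure i) = heart C t"
    by (rule F.filtration_envelope) (rule nice_filtration[OF assms(2)])
  then have "bounded_t_structure C F.gen_t" using F.gen_t_eq_t[OF assms(1)] assms(1) by simp
  then show ?thesis using F.gen_t_full F.generating_env by blast
qed

text \<open>Condition \<open>P6\<close>, the existence of nice decompositions, is the hub. The
  filtration conditions \<open>P4\<close> and \<open>P5\<close> are reached from it and return
  through the envelope condition \<open>P3\<close> to \<open>P2\<close>, which leads back to the
  hub.\<close>

lemma all_equivalentI:
  assumes "P1 \<Longrightarrow> P2" "P2 \<Longrightarrow> P6" "P6 \<Longrightarrow> P1" "P6 \<Longrightarrow> P4" "P4 \<Longrightarrow> P5" "P5 \<Longrightarrow> P4" "P4 \<Longrightarrow> P3" "P3 \<Longrightarrow> P2"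
    "P6 \<Longrightarrow> P7" "P7 \<Longrightarrow> P6" "P6 \<Longrightarrow> P9" "P9 \<Longrightarrow> P8" "P8 \<Longrightarrow> P6"
  shows "all_equivalent [P1, P2, P3, P4, P5, P6, P7, P8, P9]"
proof -
  have "P1 \<longleftrightarrow> P6" "P2 \<longleftrightarrow> P6" using assms(1-3) by iprover+
  moreover have "P4 \<longleftrightarrow> P6" "P3 \<longleftrightarrow> P6" "P5 \<longleftrightarrow> P6" using assms(2,4-8) by iprover+
  moreover have "P7 \<longleftrightarrow> P6" "P8 \<longleftrightarrow> P6" "P9 \<longleftrightarrow> P6" using assms(9-13) by iprover+
  ultimately show ?thesis by (simp add: all_equivalent_def)
qed

theorem theorem1p2p1:
  fixes C :: "('o, 'm) tricat"
  assumes "triangulated_category C"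
  shows "all_equivalent
   [\<comment> \<open>(i)\<close>
    \<exists>A. strongly_semi_orthogonal C A \<and> generating C A \<and>
      (\<forall>i. semisimple_abelian_category (full_sub C (A i))),
    \<comment> \<open>(ii)\<close>
    \<exists>A. semi_orthogonal C A \<and>
      bounded_t_structure C
        (envelope C (\<Union>i. \<Union>j \<in> {0..}. shift_class C (A i) j),
         envelope C (\<Union>i. \<Union>j \<in> {..0}. shift_class C (A i) j)),
    \<comment> \<open>(ii')\<close>
    \<exists>A t. semi_orthogonal C A \<and> bounded_t_structure C t \<and> envelope C (\<Union>i. A i) = heart C t,
    \<comment> \<open>(iii)\<close>
    \<exists>t A. bounded_t_structure C t \<and> semi_orthogonal C A \<and> (\<forall>i. A i \<subseteq> heart C t) \<and>
      (\<forall>X \<in> heart C t. \<exists>W. weight_filtration (Ht C t) A X W),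
    \<comment> \<open>(iii')\<close>
    \<exists>t A. bounded_t_structure C t \<and> semi_orthogonal C A \<and> (\<forall>i. A i \<subseteq> heart C t) \<and>
      (\<forall>X \<in> heart C t. \<exists>W. weight_filtration (Ht C t) A X W) \<and>
      filtrations_functorial (Ht C t) A,
    \<comment> \<open>(iv)\<close>
    \<exists>t w. bounded_t_structure C t \<and> bounded_weight_structure C w \<and>
      (\<forall>X \<in> heart C t. \<forall>i. \<exists>a b c. nice_decomp C t w i X a b c),
    \<comment> \<open>(iv')\<close>
    \<exists>t w. bounded_t_structure C t \<and> bounded_weight_structure C w \<and>
      (\<forall>i. \<exists>L LM R RM. functorial_nice_decomp C t w i L LM R RM \<and>
         exact_functor (Ht C t) (Ht C t) L LM \<and> exact_functor (Ht C t) (Ht C t) R RM),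
    \<comment> \<open>(v)\<close>
    \<exists>t w. bounded_t_structure C t \<and> bounded_weight_structure C w \<and>
      (\<forall>X \<in> heart C t. \<forall>i. \<exists>a b c. weight_decomp C w i X a b c \<and>
         (\<exists>m. is_image_H0 C t a m \<and> extends_to_nice C t w i X m)),
    \<comment> \<open>(v')\<close>
    \<exists>t w. bounded_t_structure C t \<and> bounded_weight_structure C w \<and>
      (\<forall>X \<in> heart C t. \<forall>i a b c. weight_decomp C w i X a b c \<longrightarrow>
         (\<forall>m. is_image_H0 C t a m \<longrightarrow> extends_to_nice C t w i X m))]"
proof -
  interpret triangulated_category C by (rule assms)
  have nice: "nice_category C t w" if tw: "bounded_t_structure C t \<and> bounded_weight_structure C w \<and>
      (\<forall>X \<in> heart C t. \<forall>i. \<exists>a b c. nice_decomp C t w i X a b c)" for t w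
    by unfold_locales (use tw in \<open>auto simp: bounded_t_structure_def bounded_weight_structure_def\<close>)
  have family: "heart_family C t A" if tA: "bounded_t_structure C t" "semi_orthogonal C A" "\<forall>i. A i \<subseteq> heart C t" for t A
    by unfold_locales (use tA in \<open>auto simp: bounded_t_structure_def\<close>)
  show ?thesis (is "all_equivalent [?i, ?ii, ?ii', ?iii, ?iii', ?iv, ?iv', ?v, ?v']")
  proof (rule all_equivalentI)
    assume ?i
    then obtain A where A: "strongly_semi_orthogonal C A" "generating C A"
      "\<And>i. semisimple_abelian_category (full_sub C (A i))" by blast
    then have so: "semi_orthogonal C A" by (simp add: strongly_semi_orthogonal_def)
    interpret F: family C A by unfold_locales (rule so)
    have "bounded_t_structure C F.gen_t"
      using A(2) F.generating_env by (intro F.gen_t_structure F.semisimple_star[OF A(1,3)]) simp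
    then show ?ii unfolding F.gen_t_eq using so by blast
  next
    assume ?ii
    then obtain A where so: "semi_orthogonal C A" and bt: "bounded_t_structure C
        (envelope C (\<Union>i. \<Union>j \<in> {0..}. shift_class C (A i) j),
         envelope C (\<Union>i. \<Union>j \<in> {..0}. shift_class C (A i) j))" by blast
    interpret F: family C A by unfold_locales (rule so)
    have bt': "bounded_t_structure C F.gen_t" unfolding F.gen_t_eq by (rule bt)
    have "bounded_weight_structure C F.gen_w" by (rule F.gen_w_bounded[OF F.gen_t_full[OF bt']])
    then show ?iv using bt' F.gen_t_nice[OF bt'] by blast
  next
    assume ?iv
    then obtain t w where tw: "bounded_t_structure C t \<and> bounded_weight_structure C w \<and>
      (\<forall>X \<in> heart C t. \<forall>i. \<exists>a b c. nice_decomp C t w i X a b c)" by blast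
    interpret N: nice_category C t w by (rule nice[OF tw])
    show ?i
      using N.pure_strongly_semi_orthogonal N.pure_generating N.pure_semisimple tw by blast
  next
    assume ?iv
    then obtain t w where tw: "bounded_t_structure C t \<and> bounded_weight_structure C w \<and>
      (\<forall>X \<in> heart C t. \<forall>i. \<exists>a b c. nice_decomp C t w i X a b c)" by blast
    interpret N: nice_category C t w by (rule nice[OF tw])
    show ?iii
      using N.pure_semi_orthogonal N.pure_sub(1) N.nice_filtration tw by blast
  next
    assume ?iii
    then obtain t A where tA: "bounded_t_structure C t" "semi_orthogonal C A" "\<forall>i. A i \<subseteq> heart C t"
      "\<forall>X \<in> heart C t. \<exists>W. weight_filtration (Ht C t) A X W" by blast
    interpret F: heart_family C t A by (rule family[OF tA(1-3)])
    show ?iii' using tA F.filtrations_functorial by blast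
  next
    assume ?iii'
    then show ?iii by blast
  next
    assume ?iii
    then obtain t A where tA: "bounded_t_structure C t" "semi_orthogonal C A" "\<forall>i. A i \<subseteq> heart C t"
      "\<forall>X \<in> heart C t. \<exists>W. weight_filtration (Ht C t) A X W" by blast
    interpret F: heart_family C t A by (rule family[OF tA(1-3)])
    have "envelope C (\<Union>i. A i) = heart C t" by (rule F.filtration_envelope) (use tA(4) in blast)
    then show ?ii' using tA(1,2) by blast
  next
    assume ?ii'
    then obtain A t where At: "semi_orthogonal C A" "bounded_t_structure C t" "envelope C (\<Union>i. A i) = heart C t"
      by blast
    interpret F: family C A by unfold_locales (rule At(1))
    have "bounded_t_structure C F.gen_t" using F.gen_t_eq_t[OF At(2,3)] At(2) by simp
    then show ?ii unfolding F.gen_t_eq using At(1) by blast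
  next
    assume ?iv
    then obtain t w where tw: "bounded_t_structure C t \<and> bounded_weight_structure C w \<and>
      (\<forall>X \<in> heart C t. \<forall>i. \<exists>a b c. nice_decomp C t w i X a b c)" by blast
    interpret N: nice_category C t w by (rule nice[OF tw])
    show ?iv' using tw N.functorial_nice by blast
  next
    assume ?iv'
    then obtain t w where tw: "bounded_t_structure C t" "bounded_weight_structure C w"
      "\<And>i. \<exists>L LM R RM. functorial_nice_decomp C t w i L LM R RM" by blast
    have "\<exists>a b c. nice_decomp C t w i X a b c" if "X \<in> heart C t" for X i
      using tw(3)[of i] that unfolding functorial_nice_decomp_def by meson
    then show ?iv using tw(1,2) by blast
  next
    assume ?iv
    then obtain t w where tw: "bounded_t_structure C t \<and> bounded_weight_structure C w \<and>
      (\<forall>X \<in> heart C t. \<forall>i. \<exists>a b c. nice_decomp C t w i X a b c)" by blast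
    interpret N: nice_category C t w by (rule nice[OF tw])
    show ?v' using tw N.image_H0_nice by blast
  next
    assume ?v'
    then obtain t w where bt: "bounded_t_structure C t" and bw: "bounded_weight_structure C w"
      and tw: "\<forall>X \<in> heart C t. \<forall>i a b c. weight_decomp C w i X a b c \<longrightarrow>
         (\<forall>m. is_image_H0 C t a m \<longrightarrow> extends_to_nice C t w i X m)" by blast
    interpret N: t_category C t by unfold_locales (use bt in \<open>simp add: bounded_t_structure_def\<close>)
    have ws: "weight_structure C w" using bw by (simp add: bounded_weight_structure_def)
    \<comment> \<open>The universal condition is instantiated at some weight decomposition, supplied
      by the weight structure, and some image, supplied by \<open>ex_image_H0\<close>.\<close>
    have "\<exists>a b c. weight_decomp C w i X a b c \<and> (\<exists>m. is_image_H0 C t a m \<and> extends_to_nice C t w i X m)"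
      if X: "X \<in> heart C t" for X i
    proof -
      obtain a b where "seq a b" "Cod C a = X" "Dom C a \<in> wle C w i" "Cod C b \<in> wge C w (i + 1)"
        using torsion_tower_dec[OF w_tower[OF ws] N.heart_Obj[OF X]] by blast
      then obtain c where abc: "weight_decomp C w i X a b c" by (auto simp: weight_decomp_def seq_def)
      then have "a \<in> Arr C" "Cod C a \<in> heart C t" using X Tri_simps by (auto simp: weight_decomp_def)
      then obtain m where "is_image_H0 C t a m" using N.ex_image_H0 by blast
      then show ?thesis using abc tw X by blast
    qed
    then show ?v using bt bw by blast
  next
    assume ?v
    then obtain t w where tw: "bounded_t_structure C t" "bounded_weight_structure C w"
      "\<And>X i. X \<in> heart C t \<Longrightarrow> \<exists>a b c. weight_decomp C w i X a b c \<and>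
         (\<exists>m. is_image_H0 C t a m \<and> extends_to_nice C t w i X m)" by blast
    then show ?iv unfolding extends_to_nice_def by meson
  qed
qed

end
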